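(* Let $n\ge 2$, let $\mu$ be a finite and rotationally invariant Borel measure on $D_R^n$ for some $R\in(0,\infty)$, and let $k\in\{1,\ldots,n\}$. If $u_{k+1},\ldots,u_n\in\mathrm{Conv}(D_R^n)$ are radially symmetric such that \[ 0<p_{u_{k+1}},\ldots,p_{u_n}<\infty\qquad \text{on } (0,R], \] then there exists a unique radially symmetric $u\in\mathrm{Conv}(D_R^n)$ solving the problem \[ \begin{cases} \mathrm{MA}(u[k],u_{k+1},\ldots,u_n;\cdot)=\mu &\text{ in } D_R^n, \\ u\equiv 0 &\text{ on } \mathrm{bd}(D_R^n), \end{cases} \] if and only if \[ r\mapsto F_\mu(r)= \frac{\mu(D_r^n)}{p_{u_{k+1}}(r)\cdots p_{u_n}(r)},\quad r\in(0,R], \] is non-decreasing. In this case, $u$ is given by \[ u(x) = -\int_{|x|}^R \left( \tfrac{1}{\kappa_n} F_\mu(t)\right)^{\frac 1k} \,\mathrm{d} t \] for $x\in D_R^n$.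
   Context: $D_r^n=\{x\in\mathbb{R}^n:|x|<r\}$ is the open Euclidean ball of radius $r$ centered at the origin, $\mathrm{bd}$ denotes the boundary, and $\kappa_n$ is the volume of the unit ball in $\mathbb{R}^n$. A measure $\mu$ on $D_R^n$ is rotationally invariant if $\mu(\vartheta B)=\mu(B)$ for every rotation $\vartheta\in\mathrm{SO}(n)$ of $\mathbb{R}^n$ and every Borel $B\subseteq D_R^n$. A function is radially symmetric if its value at $x$ depends only on $|x|$. For open convex $\Omega\subseteq\mathbb{R}^n$, $\mathrm{Conv}(\Omega)$ is the set of finite-valued convex functions $u\colon\Omega\to\mathbb{R}$, and $\partial u(x)=\{p\in\mathbb{R}^n: u(z)\ge u(x)+\langle p,z-x\rangle\ \text{for all } z\in\Omega\}$ is the subdifferential. The boundary condition $u\equiv 0$ on $\mathrm{bd}(D_R^n)$ means that $u$ extends continuously to $\mathrm{bd}(D_R^n)$ with value $0$ there. For radially symmetric $v\in\mathrm{Conv}(D_R^n)$ and $r\in(0,R]$, \[ p_v(r)=\sup\{|p|:p\in\partial v(x),\ 0\le|x|<r\}\in[0,\infty]. \] The Monge--Ampère measure of $u\in\mathrm{Conv}(\Omega)$ is $\mathrm{MA}(u;B)=\mathrm{vol}_n\big(\bigcup_{x\in B}\partial u(x)\big)$ for Borel $B\subseteq\Omega$. The mixed Monge--Ampère measure assigns to $u_1,\ldots,u_n\in\mathrm{Conv}(\Omega)$ the unique Radon measure $\mathrm{MA}(u_1,\ldots,u_n;\cdot)$ on $\Omega$ that is symmetric in its entries and satisfies \[ \mathrm{MA}(\lambda_1u_1+\cdots+\lambda_mu_m;B)=\sum_{i_1,\ldots,i_n=1}^m\lambda_{i_1}\cdots\lambda_{i_n}\mathrm{MA}(u_{i_1},\ldots,u_{i_n};B)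 \] for all $m\in\mathbb{N}$, $u_1,\ldots,u_m\in\mathrm{Conv}(\Omega)$, $\lambda_1,\ldots,\lambda_m\ge0$ and Borel $B\subseteq\Omega$. The notation $u[k]$ means that the entry $u$ is repeated $k$ times. For $k=n$ there are no functions $u_{k+1},\ldots,u_n$ and $F_\mu(r)=\mu(D_r^n)$. *)

theory Defs
  imports "HOL-Analysis.Analysis" "HOL-Library.Multiset"
begin

text \<open>
  Functions on a set \<open>\<Omega>\<close> are total functions whose values outside \<open>\<Omega>\<close> are irrelevant; thus
  \<open>u \<in> Conv(\<Omega>)\<close> is \<^term>\<open>convex_on \<Omega> u\<close>, and equality of two such functions means
  agreement on \<open>\<Omega>\<close>.
\<close>

definition subdifferential :: "'a::euclidean_space set \<Rightarrow> ('a \<Rightarrow> real) \<Rightarrow> 'a \<Rightarrow> 'a set" where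
  "subdifferential \<Omega> u x = {p. \<forall>z\<in>\<Omega>. u z \<ge> u x + p \<bullet> (z - x)}"

text \<open>
  Volume is taken with respect to the completed Lebesgue measure, since the union of the
  subdifferentials over a Borel set need not be a Borel set.
\<close>

definition monge_ampere :: "'a::euclidean_space set \<Rightarrow> ('a \<Rightarrow> real) \<Rightarrow> 'a set \<Rightarrow> ennreal" where
  "monge_ampere \<Omega> u B = emeasure lebesgue (\<Union>x\<in>B. subdifferential \<Omega> u x)"

text \<open>
  Locally finite Borel measures; on an open subset of a Euclidean space, the regularity that is
  often included in the notion of a Radon measure is automatic.
\<close>

definition radon_measure_on :: "'a::euclidean_space set \<Rightarrow> 'a measure \<Rightarrow> bool" where
  "radon_measure_on \<Omega> \<nu> \<longleftrightarrow>
     sets \<nu> = sets (restrict_space borel \<Omega>) \<and>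
     (\<forall>K. compact K \<and> K \<subseteq> \<Omega> \<longrightarrow> emeasure \<nu> K < \<infinity>)"

text \<open>
  An \<open>n\<close>-tuple of functions is a list of length \<open>n\<close>, and two tuples agree up to the order of
  their entries iff the lists have the same multiset. The functions \<open>u\<^sub>1, \<dots>, u\<^sub>m\<close> are indexed
  by \<^term>\<open>{..<m}\<close>, and the sum over \<open>i\<^sub>1, \<dots>, i\<^sub>n\<close> is the sum over all lists of length \<open>n\<close> with
  entries in \<^term>\<open>{..<m}\<close>. Values may be infinite on sets that are not relatively compact in
  \<open>\<Omega>\<close>, with the usual convention \<open>0 \<cdot> \<infinity> = 0\<close>.
\<close>

definition mixed_monge_ampere_functional ::
    "'a::euclidean_space set \<Rightarrow> (('a \<Rightarrow> real) list \<Rightarrow> 'a measure) \<Rightarrow> bool" where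
  "mixed_monge_ampere_functional \<Omega> M \<longleftrightarrow>
     (\<forall>us. length us = DIM('a) \<and> (\<forall>u\<in>set us. convex_on \<Omega> u) \<longrightarrow>
        radon_measure_on \<Omega> (M us)) \<and>
     (\<forall>us vs. length us = DIM('a) \<and> (\<forall>u\<in>set us. convex_on \<Omega> u) \<and> mset us = mset vs \<longrightarrow>
        M us = M vs) \<and>
     (\<forall>(m::nat) (u :: nat \<Rightarrow> 'a \<Rightarrow> real) (c :: nat \<Rightarrow> real) B.
        (\<forall>i<m. convex_on \<Omega> (u i)) \<and> (\<forall>i<m. c i \<ge> 0) \<and> B \<in> sets borel \<and> B \<subseteq> \<Omega> \<longrightarrow>
        monge_ampere \<Omega> (\<lambda>x. \<Sum>i<m. c i * u i x) B =
          (\<Sum>is\<in>{is. length is = DIM('a) \<and> set is \<subseteq> {..<m}}.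
             ennreal (prod_list (map c is)) * emeasure (M (map u is)) B))"

text \<open>
  By polarization, the value of a functional as above at a tuple of convex functions on \<open>\<Omega>\<close> is
  unique; its values at other lists are not constrained, so the description picks the value at
  \<open>us\<close> rather than the functional.
\<close>

definition mixed_monge_ampere ::
    "'a::euclidean_space set \<Rightarrow> ('a \<Rightarrow> real) list \<Rightarrow> 'a measure" where
  "mixed_monge_ampere \<Omega> us =
     (THE \<nu>. \<exists>M. mixed_monge_ampere_functional \<Omega> M \<and> M us = \<nu>)"

definition rotation_invariant_on :: "(real^'n) set \<Rightarrow> (real^'n) measure \<Rightarrow> bool" where
  "rotation_invariant_on D \<mu> \<longleftrightarrow>
     (\<forall>Q B. rotation_matrix Q \<and> B \<in> sets borel \<and> B \<subseteq> D \<longrightarrow>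
        emeasure \<mu> ((\<lambda>x. Q *v x) ` B) = emeasure \<mu> B)"

definition radially_symmetric_on :: "'a::real_normed_vector set \<Rightarrow> ('a \<Rightarrow> real) \<Rightarrow> bool" where
  "radially_symmetric_on D u \<longleftrightarrow> (\<forall>x\<in>D. \<forall>y\<in>D. norm x = norm y \<longrightarrow> u x = u y)"

definition p_sup :: "real \<Rightarrow> ('a::euclidean_space \<Rightarrow> real) \<Rightarrow> real \<Rightarrow> ennreal" where
  "p_sup R v r = (SUP p\<in>(\<Union>x\<in>ball 0 r. subdifferential (ball 0 R) v x). ennreal (norm p))"

text \<open>
  The functions \<open>u\<^sub>k\<^sub>+\<^sub>1, \<dots>, u\<^sub>n\<close> are \<open>us (k+1), \<dots>, us n\<close> for \<open>us\<close> indexed by natural numbers.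
\<close>

definition F_quot ::
    "real \<Rightarrow> 'a::euclidean_space measure \<Rightarrow> nat \<Rightarrow> (nat \<Rightarrow> 'a \<Rightarrow> real) \<Rightarrow> real \<Rightarrow> real" where
  "F_quot R \<mu> k us r =
     measure \<mu> (ball 0 r) / (\<Prod>i\<in>{k+1..DIM('a)}. enn2real (p_sup R (us i) r))"

definition vanishes_on_boundary ::
    "'a::topological_space set \<Rightarrow> ('a \<Rightarrow> real) \<Rightarrow> bool" where
  "vanishes_on_boundary D u \<longleftrightarrow>
     (\<exists>w. continuous_on (closure D) w \<and> (\<forall>x\<in>D. w x = u x) \<and> (\<forall>x\<in>frontier D. w x = 0))"

definition solves_dirichlet ::
    "real \<Rightarrow> 'a::euclidean_space measure \<Rightarrow> nat \<Rightarrow> (nat \<Rightarrow> 'a \<Rightarrow> real) \<Rightarrow> ('a \<Rightarrow> real) \<Rightarrow> bool" where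
  "solves_dirichlet R \<mu> k us u \<longleftrightarrow>
     convex_on (ball 0 R) u \<and>
     radially_symmetric_on (ball 0 R) u \<and>
     mixed_monge_ampere (ball 0 R) (replicate k u @ map us [k+1..<DIM('a)+1]) = \<mu> \<and>
     vanishes_on_boundary (ball 0 R) u"

definition kappa :: "'a::euclidean_space itself \<Rightarrow> real" where
  "kappa _ = measure lborel (ball (0::'a) 1)"

end

(*
  Existence of the mixed Monge-Ampere measure is obtained by transferring determinant inequalities.
  A linear inequality between the numbers det (sum c_i H_i) that holds for all positive semidefinite
  matrices H_i integrates, by the change of variables formula for the gradient map, to the same
  inequality between the measures MA(sum c_i f_i; .) of regular convex functions f_i.  Log-sum-exp
  regularizations of maxima of affine functions approximate every convex function, and the
  Monge-Ampere measure is weakly continuous, so the inequality holds for all convex functions.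
  Applied to mixed discriminants, it shows that the polarized set function is non-negative and
  that it reproduces MA(sum c_i u_i; .).

  For radially symmetric v the subgradients taken on the ball of radius r < R fill a ball of radius
  p_v(r) up to its boundary, and p is additive.  Polarization gives
  MA(v_1, ..., v_n; D_r) = kappa_n p_{v_1}(r) ... p_{v_n}(r).  Hence a solution u satisfies
  kappa_n p_u(r)^k = F_mu(r), which forces F_mu to be monotone and determines u, because p_u is
  the slope of the radial profile of u.  Conversely the function with slope (F_mu / kappa_n)^(1/k)
  has a mixed measure that agrees with mu on centred balls, and finite rotationally invariant
  measures are determined by their values on centred balls.
*)
theory Submission
  imports Defs "HOL-Combinatorics.Multiset_Permutations"
begin

section \<open>Subdifferentials of convex functions and the Monge--Ampere measure\<close>

text \<open>\<open>mixed_monge_ampere\<close> is a definite description, so nothing can be said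
  about it before a functional has been constructed on all tuples of convex functions, smooth or
  not. The two facts needed, non-negativity of the polarized set function and the expansion formula,
  are both linear in Monge-Ampere measures, and an identity is a pair of opposite inequalities. One
  transfer principle therefore serves for both.

  Positive semidefiniteness is used as a finite sum of rank-one matrices (\<open>gram\<close>). The
  Hessian of a log-sum-exp function is a covariance matrix and arrives in this form, so no spectral
  decomposition is required. An added quadratic term makes the gradient injective, as the change of
  variables demands.

  Mixed measures are known to be finite only on compact subsets of the ball, so explicit values are
  computed for radii \<open>r < R\<close>; the radius \<open>R\<close> is reached by left
  continuity. Measures agreeing on centred balls are compared without integration over the rotation
  group: the masses of balls of a fixed radius are radial functions of the centre, and their squared
  difference integrates to 0.\<close>

definition gradient_image :: "'a::euclidean_space set \<Rightarrow> ('a \<Rightarrow> real) \<Rightarrow> 'a set \<Rightarrow> 'a set" where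
  "gradient_image \<Omega> u B = (\<Union>x\<in>B. subdifferential \<Omega> u x)"

definition gradient_overlap :: "'a::euclidean_space set \<Rightarrow> ('a \<Rightarrow> real) \<Rightarrow> 'a set" where
  "gradient_overlap \<Omega> u =
     {p. \<exists>x\<in>\<Omega>. \<exists>y\<in>\<Omega>. x \<noteq> y \<and> p \<in> subdifferential \<Omega> u x \<and> p \<in> subdifferential \<Omega> u y}"

section \<open>Supporting affine functions and bounds for subgradients\<close>

lemma subdifferentialD:
  "p \<in> subdifferential \<Omega> u x \<Longrightarrow> z \<in> \<Omega> \<Longrightarrow> u x + p \<bullet> (z - x) \<le> u z"
  by (simp add: subdifferential_def)

lemma subdifferential_monotone:
  assumes "p \<in> subdifferential \<Omega> u x" "q \<in> subdifferential \<Omega> u y" "x \<in> \<Omega>" "y \<in> \<Omega>"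
  shows "0 \<le> (p - q) \<bullet> (x - y)"
  using subdifferentialD[OF assms(1,4)] subdifferentialD[OF assms(2,3)]
  by (simp add: inner_diff_left inner_diff_right)

text \<open>A function with a supporting affine function at every point is a pointwise maximum of
  affine functions. This later gives convexity of log-sum-exp functions and of radial integrals from
  explicit subgradients.\<close>

lemma convex_on_if_subdifferential_nonempty:
  assumes "convex \<Omega>" "\<And>x. x \<in> \<Omega> \<Longrightarrow> subdifferential \<Omega> u x \<noteq> {}"
  shows "convex_on \<Omega> u"
proof (rule convex_onI)
  fix t :: real and x y assume t: "0 < t" "t < 1" and xy: "x \<in> \<Omega>" "y \<in> \<Omega>"
  let ?w = "(1 - t) *\<^sub>R x + t *\<^sub>R y"
  have "?w \<in> \<Omega>" using assms(1) xy t by (simp add: convex_alt)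
  then obtain p where p: "p \<in> subdifferential \<Omega> u ?w" using assms(2) by blast
  have 1: "u ?w + p \<bullet> (x - ?w) \<le> u x" and 2: "u ?w + p \<bullet> (y - ?w) \<le> u y"
    using subdifferentialD[OF p] xy by auto
  have "(1 - t) * (u ?w + p \<bullet> (x - ?w)) + t * (u ?w + p \<bullet> (y - ?w)) \<le> (1 - t) * u x + t * u y"
    using 1 2 t by (intro add_mono mult_left_mono) auto
  moreover have "(1 - t) * (u ?w + p \<bullet> (x - ?w)) + t * (u ?w + p \<bullet> (y - ?w)) = u ?w"
    by (simp add: inner_add_right inner_diff_right algebra_simps)
  ultimately show "u ?w \<le> (1 - t) * u x + t * u y" by simp
qed (use assms in auto)

text \<open>The strict epigraph and the point \<open>(x, u x)\<close> are separated by a hyperplane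
  in the product space; its normal has a negative last component, and rescaling that component to -1
  leaves the subgradient.\<close>

lemma subdifferential_nonempty:
  fixes x :: "'a::euclidean_space"
  assumes "open \<Omega>" "convex_on \<Omega> u" "x \<in> \<Omega>"
  shows "\<exists>p. p \<in> subdifferential \<Omega> u x"
proof -
  define S where "S = {w :: 'a \<times> real. fst w \<in> \<Omega> \<and> u (fst w) < snd w}"
  have cv: "convex \<Omega>" using assms(2) by (simp add: convex_on_def)
  have "convex S"
  proof (rule convexI)
    fix a b :: "'a \<times> real" and s t :: real
    assume a: "a \<in> S" "b \<in> S" and st: "0 \<le> s" "0 \<le> t" "s + t = 1"
    have "u (s *\<^sub>R fst a + t *\<^sub>R fst b) \<le> s * u (fst a) + t * u (fst b)"
      using assms(2) a st by (auto simp: S_def convex_on_def)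
    moreover have "s * u (fst a) + t * u (fst b) < s * snd a + t * snd b"
    proof (cases "s = 0")
      case True then show ?thesis using a st by (simp add: S_def)
    next
      case False
      then have "s * u (fst a) < s * snd a" using a st by (simp add: S_def)
      moreover have "t * u (fst b) \<le> t * snd b" using a st by (intro mult_left_mono) (auto simp: S_def)
      ultimately show ?thesis by simp
    qed
    moreover have "s *\<^sub>R fst a + t *\<^sub>R fst b \<in> \<Omega>"
      using cv a st by (auto simp: S_def convex_def)
    ultimately show "s *\<^sub>R a + t *\<^sub>R b \<in> S" by (simp add: S_def)
  qed
  moreover have "S \<noteq> {}"
    using assms(3) by (auto simp: S_def intro!: exI[of _ x] exI[of _ "u x + 1"])
  ultimately obtain a b where ab: "a \<noteq> 0" "\<forall>w\<in>S. inner a w \<le> b" "\<forall>w\<in>{(x, u x)}. inner a w \<ge> b"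
    using separating_hyperplane_sets[of S "{(x, u x)}"] by (auto simp: S_def)
  obtain a1 a2 where a: "a = (a1, a2)" by fastforce
  have sep: "a1 \<bullet> z + a2 * t \<le> a1 \<bullet> x + a2 * u x" if "z \<in> \<Omega>" "u z < t" for z t
    using ab(2)[rule_format, of "(z,t)"] ab(3) that by (auto simp: S_def a)
  have "a2 \<le> 0"
    using sep[of x "u x + 1"] assms(3) by (simp add: algebra_simps)
  \<comment> \<open>A vertical hyperplane through an interior point is impossible: moving from
    \<open>x\<close> by a small positive multiple of \<open>a1\<close> stays in \<Omega> and
    increases \<open>a1 \<bullet> z\<close>.\<close>
  have "a2 \<noteq> 0"
  proof
    assume a20: "a2 = 0"
    obtain e where e: "e > 0" "cball x e \<subseteq> \<Omega>"
      using assms open_contains_cball_eq by blast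
    have "a1 \<noteq> 0" using ab(1) a a20 by (auto simp: zero_prod_def)
    let ?z = "x + (e / norm a1) *\<^sub>R a1"
    have "?z \<in> \<Omega>" using e by (auto simp: dist_norm subset_eq \<open>a1 \<noteq> 0\<close>)
    then have "a1 \<bullet> ?z \<le> a1 \<bullet> x" using sep[of ?z "u ?z + 1"] a20 by simp
    moreover have "a1 \<bullet> ?z = a1 \<bullet> x + e * norm a1"
      using \<open>a1 \<noteq> 0\<close> by (simp add: inner_add_right power2_norm_eq_inner[symmetric] power2_eq_square)
    moreover have "0 < e * norm a1" using e \<open>a1 \<noteq> 0\<close> by simp
    ultimately show False by linarith
  qed
  with \<open>a2 \<le> 0\<close> have neg: "a2 < 0" by simp
  have "(inverse (- a2)) *\<^sub>R a1 \<in> subdifferential \<Omega> u x"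
    unfolding subdifferential_def
  proof clarify
    fix z assume z: "z \<in> \<Omega>"
    \<comment> \<open>The graph is not part of the strict epigraph, so the separation is applied at
      height \<open>e / (- a2)\<close> above it and \<open>e\<close> is then sent to 0.\<close>
    have "a1 \<bullet> z + a2 * u z - a1 \<bullet> x - a2 * u x \<le> e" if "e > 0" for e
    proof -
      have "u z < u z + e / (- a2)" using that neg by (simp add: divide_pos_neg)
      moreover have "a2 * (u z + e / (- a2)) = a2 * u z - e" using neg by (simp add: field_simps)
      ultimately show ?thesis using sep[OF z, of "u z + e / (- a2)"] by linarith
    qed
    then have "a1 \<bullet> z + a2 * u z - a1 \<bullet> x - a2 * u x \<le> 0"
      by (rule dense_ge)
    moreover have "(- a2) * (u x + (inverse (- a2)) * (a1 \<bullet> (z - x))) = (- a2) * u x + a1 \<bullet> z - a1 \<bullet> x"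
    proof -
      have "(- a2) * (inverse (- a2) * (a1 \<bullet> (z - x))) = a1 \<bullet> (z - x)" using neg by simp
      then show ?thesis unfolding distrib_left by (simp add: inner_diff_right)
    qed
    ultimately have "(- a2) * (u x + (inverse (- a2)) * (a1 \<bullet> (z - x))) \<le> (- a2) * u z"
      by linarith
    then show "u x + (inverse (- a2) *\<^sub>R a1) \<bullet> (z - x) \<le> u z"
      unfolding inner_scaleR_left by (rule mult_left_le_imp_le) (use neg in linarith)
  qed
  then show ?thesis by blast
qed

text \<open>A local supporting inequality spreads along segments: it holds at a point close to
  \<open>x\<close> on the segment to \<open>z\<close>, and convexity allows division by the segment
  parameter.\<close>

lemma subdifferential_local:
  assumes "convex_on \<Omega> u" "x \<in> \<Omega>" "\<delta> > 0"
    and loc: "\<And>z. z \<in> \<Omega> \<Longrightarrow> dist x z < \<delta> \<Longrightarrow> u x + p \<bullet> (z - x) \<le> u z"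
  shows "p \<in> subdifferential \<Omega> u x"
  unfolding subdifferential_def
proof clarify
  fix z assume z: "z \<in> \<Omega>"
  \<comment> \<open>The factor keeps the point within \<open>\<delta>\<close> of \<open>x\<close>;
    adding 1 to the norm covers \<open>z = x\<close>.\<close>
  define t where "t = min 1 (\<delta> / (2 * (1 + norm (z - x))))"
  have t: "0 < t" "t \<le> 1" using assms(3) by (auto simp: t_def add_pos_nonneg)
  let ?y = "(1 - t) *\<^sub>R x + t *\<^sub>R z"
  have "t * norm (z - x) \<le> (\<delta> / (2 * (1 + norm (z - x)))) * norm (z - x)"
    by (intro mult_right_mono) (auto simp: t_def)
  also have "\<dots> < \<delta>"
  proof -
    have "0 \<le> norm (z - x)" by simp
    moreover have "a / (2 * (1 + n)) * n < a" if "a > 0" "n \<ge> 0" for a n :: real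
    proof -
      have "a * n < a * (2 * (1 + n))" using that by simp
      then show ?thesis using that by (simp add: field_simps)
    qed
    ultimately show ?thesis using assms(3) by blast
  qed
  finally have small: "t * norm (z - x) < \<delta>" .
  have yx: "?y - x = t *\<^sub>R (z - x)" by (simp add: algebra_simps)
  have "dist x ?y < \<delta>"
    using small t by (simp add: dist_norm norm_minus_commute[of x] yx)
  moreover have "?y \<in> \<Omega>"
    using assms(1,2) z t by (simp add: convex_on_def convex_alt)
  ultimately have "u x + p \<bullet> (?y - x) \<le> u ?y" using loc by blast
  moreover have "u ?y \<le> (1 - t) * u x + t * u z"
    using assms(1,2) z t by (simp add: convex_on_def)
  ultimately have "t * (u x + p \<bullet> (z - x)) \<le> t * u z"
    unfolding yx by (simp add: algebra_simps)
  then show "u x + p \<bullet> (z - x) \<le> u z" using t by simp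
qed

text \<open>The subgradient inequality is tested at the point at distance \<open>\<delta>\<close>
  from \<open>x\<close> in the direction of \<open>p\<close>.\<close>

lemma subdifferential_norm_bound:
  assumes p: "p \<in> subdifferential \<Omega> u x" and "\<delta> > 0" "cball x \<delta> \<subseteq> \<Omega>"
    and bd: "\<And>z. z \<in> cball x \<delta> \<Longrightarrow> \<bar>u z\<bar> \<le> M"
  shows "norm p \<le> 2 * M / \<delta>"
proof (cases "p = 0")
  case True
  have "0 \<le> M" using bd[of x] assms(2) by (smt (verit) centre_in_cball)
  with True assms(2) show ?thesis by simp
next
  case False
  let ?z = "x + (\<delta> / norm p) *\<^sub>R p"
  have z: "?z \<in> cball x \<delta>" using False assms(2) by (simp add: dist_norm)
  then have "u x + p \<bullet> (?z - x) \<le> u ?z" using subdifferentialD[OF p] assms(3) by blast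
  moreover have "p \<bullet> (?z - x) = \<delta> * norm p"
    using False by (simp add: power2_norm_eq_inner[symmetric] power2_eq_square)
  moreover have "\<bar>u ?z\<bar> \<le> M" "\<bar>u x\<bar> \<le> M" using bd[OF z] bd[of x] assms(2) by auto
  ultimately have "\<delta> * norm p \<le> 2 * M" by linarith
  then show ?thesis using assms(2) by (simp add: field_simps)
qed

lemma compact_cball_neighbourhood:
  fixes K :: "'a::euclidean_space set"
  assumes "compact K" "K \<subseteq> \<Omega>" "open \<Omega>"
  obtains \<delta> where "\<delta> > 0" "compact (\<Union>x\<in>K. cball x \<delta>)" "(\<Union>x\<in>K. cball x \<delta>) \<subseteq> \<Omega>"
proof -
  obtain e where e: "e > 0" "(\<Union>x\<in>K. ball x e) \<subseteq> \<Omega>"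
    using compact_subset_open_imp_ball_epsilon_subset[OF assms(1,3,2)] by blast
  have "(\<Union>x\<in>K. cball x (e/2)) \<subseteq> \<Omega>"
    using e by fastforce
  \<comment> \<open>The neighbourhood is the Minkowski sum of two compact sets, hence
    compact.\<close>
  moreover have "(\<Union>x\<in>K. cball x (e/2)) = {x + y | x y. x \<in> K \<and> y \<in> cball 0 (e/2)}"
    by (auto simp: dist_norm) (metis add.commute diff_add_cancel norm_minus_commute)+
  ultimately show ?thesis
    using that[of "e/2"] e compact_sums[OF assms(1) compact_cball[of 0 "e/2"]] by auto
qed

text \<open>The translates by \<open>b / (j + 1)\<close> are pairwise disjoint, have equal measure
  and stay in one bounded ball, so their common measure is 0.\<close>

lemma null_set_if_lines_meet_once:
  fixes S :: "'a::euclidean_space set"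
  assumes "compact S" and once: "\<And>p t. p \<in> S \<Longrightarrow> t > 0 \<Longrightarrow> p + t *\<^sub>R b \<notin> S"
  shows "S \<in> null_sets lebesgue"
proof -
  define A where "A j = (+) ((1 / (real j + 1)) *\<^sub>R b) ` S" for j :: nat
  obtain r where r: "S \<subseteq> cball 0 r" "r > 0"
    using compact_imp_bounded[OF assms(1)] unfolding bounded_pos by (auto simp: subset_eq)
  have S: "S \<in> lmeasurable" using assms(1) by (simp add: lmeasurable_compact)
  have A: "A j \<in> lmeasurable" and mA: "measure lebesgue (A j) = measure lebesgue S" for j
    using S by (auto simp: A_def measurable_translation measure_translation)
  have "disjoint_family A"
  proof -
    have False if "i < j" "x \<in> S" "y \<in> S"
      and eq: "(1 / (real i + 1)) *\<^sub>R b + x = (1 / (real j + 1)) *\<^sub>R b + y" for i j x y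
    proof -
      have "y = x + (1 / (real i + 1) - 1 / (real j + 1)) *\<^sub>R b"
        using eq by (simp add: algebra_simps)
      moreover have "1 / (real i + 1) - 1 / (real j + 1) > 0"
        using that(1) by (simp add: frac_less2)
      ultimately show False using once that by blast
    qed
    then show ?thesis
      unfolding disjoint_family_on_def A_def by (smt (verit, ccfv_threshold) disjoint_iff imageE linorder_neqE_nat)
  qed
  have sub: "A j \<subseteq> cball 0 (r + norm b)" for j
  proof
    fix z assume "z \<in> A j"
    then obtain x where x: "x \<in> S" "z = (1 / (real j + 1)) *\<^sub>R b + x" by (auto simp: A_def)
    have "norm z \<le> norm ((1 / (real j + 1)) *\<^sub>R b) + norm x" using x norm_triangle_ineq by blast
    moreover have "norm ((1 / (real j + 1)) *\<^sub>R b) \<le> norm b"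
      by (simp add: mult_left_le_one_le field_simps)
    moreover have "norm x \<le> r" using x r by auto
    ultimately show "z \<in> cball 0 (r + norm b)" by simp
  qed
  have bound: "real J * measure lebesgue S \<le> measure lebesgue (cball (0::'a) (r + norm b))" for J
  proof -
    have "real J * measure lebesgue S = (\<Sum>j<J. measure lebesgue (A j))" by (simp add: mA)
    also have "\<dots> = measure lebesgue (\<Union>j<J. A j)"
      using A \<open>disjoint_family A\<close>
      by (intro measure_UNION'[symmetric]) (auto simp: pairwise_def disjoint_family_on_def disjnt_def)
    also have "\<dots> \<le> measure lebesgue (cball (0::'a) (r + norm b))"
      using sub A by (intro measure_mono_fmeasurable) (auto simp: fmeasurableD intro!: sets.finite_UN)
    finally show ?thesis .
  qed
  have "measure lebesgue S \<le> 0"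
  proof (rule ccontr)
    assume "\<not> ?thesis"
    then have pos: "measure lebesgue S > 0" by simp
    then obtain J :: nat where "measure lebesgue (cball (0::'a) (r + norm b)) < real J * measure lebesgue S"
      using reals_Archimedean3 by blast
    with bound[of J] show False by simp
  qed
  then show ?thesis
    using S emeasure_eq_measure2[OF S] by (intro null_setsI) (auto simp: fmeasurable_def ennreal_eq_0_iff simp del: emeasure_completion)
qed

section \<open>Subgradient images and the Borel measure they induce\<close>

locale open_convex_function =
  fixes \<Omega> :: "'a::euclidean_space set" and u :: "'a \<Rightarrow> real"
  assumes open_dom: "open \<Omega>" and convex_on: "convex_on \<Omega> u"
begin

abbreviation "T \<equiv> gradient_image \<Omega> u"

lemma continuous_on: "continuous_on \<Omega> u"
  using convex_on_continuous[OF open_dom convex_on] .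

text \<open>Bounds for \<open>u\<close> on a compact neighbourhood bound the subgradients, and the
  subgradient inequality survives limits of base points and slopes. All later measurability rests on
  this, since open sets are countable unions of compact sets.\<close>

lemma compact_gradient_image:
  assumes K: "compact K" "K \<subseteq> \<Omega>"
  shows "compact (T K)"
proof -
  obtain \<delta> where d: "\<delta> > 0" "compact (\<Union>x\<in>K. cball x \<delta>)" "(\<Union>x\<in>K. cball x \<delta>) \<subseteq> \<Omega>"
    using compact_cball_neighbourhood[OF K open_dom] by blast
  have "compact (u ` (\<Union>x\<in>K. cball x \<delta>))"
    using compact_continuous_image[OF continuous_on_subset[OF continuous_on d(3)] d(2)] .
  then have "bounded (u ` (\<Union>x\<in>K. cball x \<delta>))" by (rule compact_imp_bounded)
  then obtain M where M: "\<And>z. z \<in> (\<Union>x\<in>K. cball x \<delta>) \<Longrightarrow> \<bar>u z\<bar> \<le> M"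
    unfolding bounded_iff by force
  have "norm p \<le> 2 * M / \<delta>" if pT: "p \<in> T K" for p
  proof -
    obtain x where x: "x \<in> K" "p \<in> subdifferential \<Omega> u x" using pT by (auto simp: gradient_image_def)
    show ?thesis
    proof (rule subdifferential_norm_bound[OF x(2) d(1)])
      show "cball x \<delta> \<subseteq> \<Omega>" using d(3) x(1) by blast
      show "\<bar>u z\<bar> \<le> M" if "z \<in> cball x \<delta>" for z using M x(1) that by blast
    qed
  qed
  then have "bounded (T K)" unfolding bounded_iff by blast
  moreover have "closed (T K)"
    unfolding closed_sequential_limits
  proof (intro allI impI, elim conjE)
    fix p l assume p: "\<forall>n. p n \<in> T K" and lim: "p \<longlonglongrightarrow> l"
    have "\<forall>n. \<exists>x. x \<in> K \<and> p n \<in> subdifferential \<Omega> u x"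
      using p by (simp add: gradient_image_def Bex_def)
    from choice[OF this] obtain x
      where x: "\<And>n. x n \<in> K" "\<And>n. p n \<in> subdifferential \<Omega> u (x n)" by auto
    obtain y r where y: "y \<in> K" "strict_mono r" "(x \<circ> r) \<longlonglongrightarrow> y"
      by (rule seq_compactE[OF compact_imp_seq_compact[OF K(1)], of x]) (use x(1) in blast)+
    have ux: "(\<lambda>n. u ((x \<circ> r) n)) \<longlonglongrightarrow> u y"
    proof (rule continuous_on_tendsto_compose[OF continuous_on y(3)])
      show "y \<in> \<Omega>" using y(1) K(2) by blast
      show "\<forall>\<^sub>F n in sequentially. (x \<circ> r) n \<in> \<Omega>"
        using x(1) K(2) by (intro always_eventually) auto
    qed
    have pr: "(p \<circ> r) \<longlonglongrightarrow> l" by (rule LIMSEQ_subseq_LIMSEQ[OF lim y(2)])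
    have "l \<in> subdifferential \<Omega> u y"
      unfolding subdifferential_def
    proof clarify
      fix z assume z: "z \<in> \<Omega>"
      have "(\<lambda>n. u ((x \<circ> r) n) + (p \<circ> r) n \<bullet> (z - (x \<circ> r) n)) \<longlonglongrightarrow> u y + l \<bullet> (z - y)"
        by (intro tendsto_intros ux pr y)
      then show "u y + l \<bullet> (z - y) \<le> u z"
        by (rule LIMSEQ_le_const2) (use subdifferentialD[OF x(2) z] in \<open>simp add: exI[of _ 0]\<close>)
    qed
    then show "l \<in> T K" using y(1) by (auto simp: gradient_image_def)
  qed
  ultimately show ?thesis by (simp add: compact_eq_bounded_closed)
qed

text \<open>If \<open>p\<close> supports \<open>u\<close> at two points, some coordinate and two
  rational levels separate these points. For fixed \<open>b\<close> and
  \<open>\<alpha> < \<beta>\<close> the slopes shared by the two half-spaces within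
  \<open>C n\<close> form a compact set that lines in direction \<open>b\<close> meet at most once,
  by monotonicity of subgradients. Countably many such null sets cover the overlap.\<close>

lemma null_gradient_overlap: "gradient_overlap \<Omega> u \<in> null_sets lebesgue"
proof -
  obtain C :: "nat \<Rightarrow> 'a set" where C: "\<And>n. compact (C n)" "\<And>n. C n \<subseteq> \<Omega>" "\<Union>(range C) = \<Omega>"
    "\<And>K. compact K \<Longrightarrow> K \<subseteq> \<Omega> \<Longrightarrow> \<exists>N. \<forall>n\<ge>N. K \<subseteq> C n"
    using open_Union_compact_subsets[OF open_dom] by metis
  define S where "S n \<alpha> \<beta> b = T (C n \<inter> {x. b \<bullet> x \<le> \<alpha>}) \<inter> T (C n \<inter> {x. b \<bullet> x \<ge> \<beta>})"
    for n \<alpha> \<beta> and b :: 'a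
  have null: "S n \<alpha> \<beta> b \<in> null_sets lebesgue" if "\<alpha> < \<beta>" for n \<alpha> \<beta> b
  proof (rule null_set_if_lines_meet_once[where b = b])
    have "compact (C n \<inter> {x. b \<bullet> x \<le> \<alpha>})" "compact (C n \<inter> {x. b \<bullet> x \<ge> \<beta>})"
      by (intro compact_Int_closed C closed_halfspace_le closed_halfspace_ge)+
    then have "compact (T (C n \<inter> {x. b \<bullet> x \<le> \<alpha>}))" "compact (T (C n \<inter> {x. b \<bullet> x \<ge> \<beta>}))"
      using C(2) by (meson compact_gradient_image inf.coboundedI1)+
    then show "compact (S n \<alpha> \<beta> b)" unfolding S_def by (rule compact_Int)
  next
    fix p t assume p: "p \<in> S n \<alpha> \<beta> b" and t: "(t::real) > 0"
    show "p + t *\<^sub>R b \<notin> S n \<alpha> \<beta> b"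
    proof
      assume "p + t *\<^sub>R b \<in> S n \<alpha> \<beta> b"
      then obtain x where x: "x \<in> \<Omega>" "b \<bullet> x \<le> \<alpha>" "p + t *\<^sub>R b \<in> subdifferential \<Omega> u x"
        using C(2) by (auto simp: S_def gradient_image_def)
      obtain y where y: "y \<in> \<Omega>" "b \<bullet> y \<ge> \<beta>" "p \<in> subdifferential \<Omega> u y"
        using p C(2) by (auto simp: S_def gradient_image_def)
      have "0 \<le> t * (b \<bullet> (x - y))"
        using subdifferential_monotone[OF x(3) y(3) x(1) y(1)] by simp
      then show False using t x y that by (simp add: zero_le_mult_iff inner_diff_right)
    qed
  qed
  have "gradient_overlap \<Omega> u \<subseteq> (\<Union>n. \<Union>(\<alpha>,\<beta>)\<in>{(\<alpha>,\<beta>). \<alpha> \<in> \<rat> \<and> \<beta> \<in> \<rat> \<and> \<alpha> < \<beta>}. \<Union>b\<in>Basis. S n \<alpha> \<beta> b)"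
  proof
    fix p assume "p \<in> gradient_overlap \<Omega> u"
    then obtain x y where xy: "x \<in> \<Omega>" "y \<in> \<Omega>" "x \<noteq> y"
      "p \<in> subdifferential \<Omega> u x" "p \<in> subdifferential \<Omega> u y"
      by (auto simp: gradient_overlap_def)
    obtain n where n: "{x, y} \<subseteq> C n"
      using C(4)[of "{x,y}"] xy by (meson empty_subsetI finite.emptyI finite.insertI finite_imp_compact insert_subset order_refl)
    obtain b where b: "b \<in> Basis" "x \<bullet> b \<noteq> y \<bullet> b" using xy(3) by (auto simp: euclidean_eq_iff[of x])
    have *: "\<exists>\<alpha> \<beta>. \<alpha> \<in> \<rat> \<and> \<beta> \<in> \<rat> \<and> \<alpha> < \<beta> \<and> s \<le> \<alpha> \<and> \<beta> \<le> t" if "s < t" for s t :: real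
    proof -
      obtain \<alpha> where \<alpha>: "\<alpha> \<in> \<rat>" "s < \<alpha>" "\<alpha> < t" using Rats_dense_in_real[OF \<open>s < t\<close>] by blast
      obtain \<beta> where "\<beta> \<in> \<rat>" "\<alpha> < \<beta>" "\<beta> < t" using Rats_dense_in_real[OF \<open>\<alpha> < t\<close>] by blast
      with \<alpha> show ?thesis by (intro exI[of _ \<alpha>] exI[of _ \<beta>]) auto
    qed
    have mem: "p \<in> S n \<alpha> \<beta> b" if "v \<in> C n" "w \<in> C n" "p \<in> subdifferential \<Omega> u v"
      "p \<in> subdifferential \<Omega> u w" "b \<bullet> v \<le> \<alpha>" "\<beta> \<le> b \<bullet> w" for v w \<alpha> \<beta>
      using that by (auto simp: S_def gradient_image_def)
    have "\<exists>\<alpha> \<beta>. \<alpha> \<in> \<rat> \<and> \<beta> \<in> \<rat> \<and> \<alpha> < \<beta> \<and> p \<in> S n \<alpha> \<beta> b"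
    proof (cases "b \<bullet> x < b \<bullet> y")
      case True
      from *[OF this] show ?thesis using n mem[of x y] xy(4,5) by (meson insert_subset)
    next
      case False
      then have "b \<bullet> y < b \<bullet> x" using b by (simp add: inner_commute)
      from *[OF this] show ?thesis using n mem[of y x] xy(4,5) by (meson insert_subset)
    qed
    then obtain \<alpha> \<beta> where "\<alpha> \<in> \<rat>" "\<beta> \<in> \<rat>" "\<alpha> < \<beta>" "p \<in> S n \<alpha> \<beta> b" by blast
    then show "p \<in> (\<Union>n. \<Union>(\<alpha>,\<beta>)\<in>{(\<alpha>,\<beta>). \<alpha> \<in> \<rat> \<and> \<beta> \<in> \<rat> \<and> \<alpha> < \<beta>}. \<Union>b\<in>Basis. S n \<alpha> \<beta> b)"
      using b(1) by (intro UN_I[of n] UN_I[of "(\<alpha>,\<beta>)"]) auto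
  qed
  moreover have "(\<Union>n. \<Union>(\<alpha>,\<beta>)\<in>{(\<alpha>,\<beta>). \<alpha> \<in> \<rat> \<and> \<beta> \<in> \<rat> \<and> \<alpha> < \<beta>}. \<Union>b\<in>Basis. S n \<alpha> \<beta> b)
      \<in> null_sets lebesgue"
  proof (intro null_sets_UN null_sets_UN')
    have "{(\<alpha>, \<beta>). \<alpha> \<in> \<rat> \<and> \<beta> \<in> \<rat> \<and> \<alpha> < \<beta>} \<subseteq> \<rat> \<times> (\<rat> :: real set)" by auto
    then show "countable {(\<alpha>, \<beta>). \<alpha> \<in> \<rat> \<and> \<beta> \<in> \<rat> \<and> \<alpha> < (\<beta>::real)}"
      by (rule countable_subset) (intro countable_SIGMA countable_rat)
  next
    fix n and q :: "real \<times> real" assume "q \<in> {(\<alpha>, \<beta>). \<alpha> \<in> \<rat> \<and> \<beta> \<in> \<rat> \<and> \<alpha> < \<beta>}"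
    then show "(case q of (\<alpha>, \<beta>) \<Rightarrow> \<Union>b\<in>Basis. S n \<alpha> \<beta> b) \<in> null_sets lebesgue"
      using null by (auto intro!: null_sets_UN' countable_finite)
  qed
  ultimately show ?thesis
    using null_sets_completion_subset by blast
qed

lemma gradient_image_open_borel:
  assumes "open A" "A \<subseteq> \<Omega>"
  shows "T A \<in> sets borel"
proof -
  obtain C :: "nat \<Rightarrow> 'a set" where C: "\<And>n. compact (C n)" "\<And>n. C n \<subseteq> A" "\<Union>(range C) = A"
    using open_Union_compact_subsets[OF assms(1)] by metis
  have "T A = (\<Union>n. T (C n))" using C(3) by (auto simp: gradient_image_def)
  moreover have "T (C n) \<in> sets borel" for n
    using compact_gradient_image[OF C(1) subset_trans[OF C(2) assms(2)]] by (rule borel_compact)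
  ultimately show ?thesis by auto
qed

text \<open>Meaningful off \<open>gradient_overlap\<close>, where a slope is attained at only one
  point; it plays the part of the gradient of the Legendre transform.\<close>

definition inverse_gradient :: "'a \<Rightarrow> 'a" where
  "inverse_gradient p = (THE x. x \<in> \<Omega> \<and> p \<in> subdifferential \<Omega> u x)"

text \<open>A push-forward of Lebesgue measure, which makes countable additivity automatic. It lives
  on the whole space; sets are cut with \<Omega> when it is compared with
  \<open>monge_ampere\<close>.\<close>

definition ma_measure :: "'a measure" where
  "ma_measure = distr (restrict_space lebesgue (T \<Omega> - gradient_overlap \<Omega> u)) borel inverse_gradient"

lemma inverse_gradient_eq:
  assumes "x \<in> \<Omega>" "p \<in> subdifferential \<Omega> u x" "p \<notin> gradient_overlap \<Omega> u"
  shows "inverse_gradient p = x"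
  unfolding inverse_gradient_def
  using assms by (intro the_equality) (auto simp: gradient_overlap_def)

lemma vimage_inverse_gradient:
  "inverse_gradient -` B \<inter> (T \<Omega> - gradient_overlap \<Omega> u) = T (B \<inter> \<Omega>) - gradient_overlap \<Omega> u"
  using inverse_gradient_eq by (auto simp: gradient_image_def)

lemma gradient_domain_measurable: "T \<Omega> - gradient_overlap \<Omega> u \<in> sets lebesgue"
  using gradient_image_open_borel[OF open_dom order_refl] null_gradient_overlap
  by (auto intro: sets.Diff simp: null_sets_def)

lemma measurable_inverse_gradient:
  "inverse_gradient \<in> measurable (restrict_space lebesgue (T \<Omega> - gradient_overlap \<Omega> u)) borel"
proof (rule borel_measurableI)
  fix S :: "'a set" assume "open S"
  then have "T (S \<inter> \<Omega>) \<in> sets borel"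
    using open_dom by (intro gradient_image_open_borel) auto
  then have "T (S \<inter> \<Omega>) - gradient_overlap \<Omega> u \<in> sets lebesgue"
    using null_gradient_overlap by (auto intro: sets.Diff simp: null_sets_def)
  moreover have "T (S \<inter> \<Omega>) - gradient_overlap \<Omega> u \<subseteq> T \<Omega> - gradient_overlap \<Omega> u"
    by (auto simp: gradient_image_def)
  ultimately show "inverse_gradient -` S \<inter> space (restrict_space lebesgue (T \<Omega> - gradient_overlap \<Omega> u))
      \<in> sets (restrict_space lebesgue (T \<Omega> - gradient_overlap \<Omega> u))"
    using gradient_domain_measurable
    by (simp add: space_restrict_space sets_restrict_space_iff vimage_inverse_gradient)
qed

lemma sets_ma_measure [simp, measurable_cong]: "sets ma_measure = sets borel"
  and space_ma_measure [simp]: "space ma_measure = UNIV"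
  by (auto simp: ma_measure_def)

lemma
  assumes "B \<in> sets borel"
  shows gradient_image_measurable: "T (B \<inter> \<Omega>) \<in> sets lebesgue"
    and emeasure_ma_measure: "emeasure ma_measure B = monge_ampere \<Omega> u (B \<inter> \<Omega>)"
proof -
  let ?N = "gradient_overlap \<Omega> u" and ?D = "T \<Omega> - gradient_overlap \<Omega> u"
  have "inverse_gradient -` B \<inter> space (restrict_space lebesgue ?D) \<in> sets (restrict_space lebesgue ?D)"
    using measurable_inverse_gradient assms by (rule measurable_sets)
  then have m: "T (B \<inter> \<Omega>) - ?N \<in> sets lebesgue"
    using gradient_domain_measurable
    by (simp add: space_restrict_space sets_restrict_space_iff vimage_inverse_gradient)
  \<comment> \<open>What was cut off is a subset of a null set, so completeness of Lebesgue measure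
    makes the full image measurable.\<close>
  have "T (B \<inter> \<Omega>) \<inter> ?N \<in> null_sets lebesgue"
    using null_gradient_overlap null_sets_completion_subset[of "T (B \<inter> \<Omega>) \<inter> ?N" ?N] by blast
  moreover have eq: "T (B \<inter> \<Omega>) = (T (B \<inter> \<Omega>) - ?N) \<union> (T (B \<inter> \<Omega>) \<inter> ?N)" by blast
  ultimately show meas: "T (B \<inter> \<Omega>) \<in> sets lebesgue"
    using m by (metis null_setsD2 sets.Un)
  have "emeasure ma_measure B = emeasure (restrict_space lebesgue ?D) (T (B \<inter> \<Omega>) - ?N)"
    unfolding ma_measure_def
    using assms measurable_inverse_gradient gradient_domain_measurable
    by (simp add: emeasure_distr space_restrict_space vimage_inverse_gradient)
  also have "\<dots> = emeasure lebesgue (T (B \<inter> \<Omega>) - ?N)"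
    using gradient_domain_measurable by (intro emeasure_restrict_space) (auto simp: gradient_image_def)
  also have "\<dots> = emeasure lebesgue (T (B \<inter> \<Omega>))"
    using emeasure_Diff_null_set[OF null_gradient_overlap meas] .
  finally show "emeasure ma_measure B = monge_ampere \<Omega> u (B \<inter> \<Omega>)"
    by (simp add: monge_ampere_def gradient_image_def)
qed

lemma monge_ampere_eq: "B \<in> sets borel \<Longrightarrow> B \<subseteq> \<Omega> \<Longrightarrow> monge_ampere \<Omega> u B = emeasure ma_measure B"
  by (simp add: emeasure_ma_measure Int_absorb2)

lemma ma_measure_compact_finite:
  assumes "compact K" "K \<subseteq> \<Omega>"
  shows "emeasure ma_measure K < \<infinity>"
proof -
  have "emeasure ma_measure K = emeasure lebesgue (T K)"
    using monge_ampere_eq[of K] assms by (simp add: borel_compact monge_ampere_def gradient_image_def)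
  also have "\<dots> < \<infinity>"
    using lmeasurable_compact[OF compact_gradient_image[OF assms]] by (simp add: fmeasurable_def del: emeasure_completion)
  finally show ?thesis .
qed

end

section \<open>Polarization and mixed discriminants\<close>

definition tuples :: "nat \<Rightarrow> 'b set \<Rightarrow> 'b list set" where
  "tuples n A = {xs. length xs = n \<and> set xs \<subseteq> A}"

text \<open>The polarization formula: if \<open>f S\<close> is the value of a form of degree
  \<open>n\<close> at the sum of the arguments with index in \<open>S\<close>, this is the value of
  the associated symmetric multilinear form.\<close>

definition polarization :: "nat \<Rightarrow> (nat set \<Rightarrow> real) \<Rightarrow> real" where
  "polarization n f = (\<Sum>S\<in>Pow {..<n}. (-1) ^ (n - card S) * f S) / fact n"

lemma finite_tuples [simp]: "finite A \<Longrightarrow> finite (tuples n A)"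
  using finite_lists_length_eq[of A n] by (simp add: tuples_def conj_commute)

lemma permutations_of_set_lessThan: "js \<in> permutations_of_set {..<n} \<longleftrightarrow> length js = n \<and> set js = {..<n}"
proof
  assume "js \<in> permutations_of_set {..<n}"
  then have js: "set js = {..<n}" "distinct js" by (auto simp: permutations_of_set_def)
  from distinct_card[OF js(2)] js(1) show "length js = n \<and> set js = {..<n}" by simp
next
  assume "length js = n \<and> set js = {..<n}"
  then show "js \<in> permutations_of_set {..<n}"
    using card_distinct[of js] by (simp add: permutations_of_set_def)
qed

text \<open>Inclusion-exclusion: above a proper subset \<open>T\<close>, sets of even and of odd
  cardinality are equally many.\<close>

lemma alternating_sum_supersets:
  assumes "T \<subseteq> {..<n}"
  shows "(\<Sum>S | S \<subseteq> {..<n} \<and> T \<subseteq> S. (-1) ^ (n - card S)) = (if T = {..<n} then 1 else 0 :: real)"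
proof (cases "T = {..<n}")
  case True
  then have "{S. S \<subseteq> {..<n} \<and> T \<subseteq> S} = {{..<n}}" by auto
  with True show ?thesis by simp
next
  case False
  then have "(-1) ^ (n - card S) = (-1) ^ n * ((-1) ^ card S :: real)" if "S \<subseteq> {..<n}" for S
    using card_mono[OF _ that] by (auto simp: minus_one_power_iff)
  then have "(\<Sum>S | S \<subseteq> {..<n} \<and> T \<subseteq> S. (-1) ^ (n - card S))
      = (-1) ^ n * (\<Sum>S | S \<subseteq> {..<n} \<and> T \<subseteq> S. (-1) ^ card S :: real)"
    by (simp add: sum_distrib_left)
  also have "(\<Sum>S | S \<subseteq> {..<n} \<and> T \<subseteq> S. (-1) ^ card S :: real) = 0"
    using card_subsupersets_even_odd[of "{..<n}" T] assms False
    by (intro sum_alternating_cancels) (auto simp: conj_ac)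
  finally show ?thesis using False by simp
qed

text \<open>After exchanging the sums, a tuple is weighted by the alternating number of index sets
  containing its entries. Only tuples that hit every index survive, and those are the
  permutations.\<close>

lemma polarization_tuples:
  "polarization n (\<lambda>S. \<Sum>is\<in>tuples n S. a is) = (\<Sum>js\<in>permutations_of_set {..<n}. a js) / fact n"
proof -
  have "(\<Sum>S\<in>Pow {..<n}. (-1) ^ (n - card S) * (\<Sum>is\<in>tuples n S. a is))
      = (\<Sum>S\<in>Pow {..<n}. \<Sum>is\<in>{is\<in>tuples n {..<n}. set is \<subseteq> S}. (-1) ^ (n - card S) * a is)"
    by (intro sum.cong refl) (auto simp: sum_distrib_left tuples_def intro!: sum.cong)
  also have "\<dots> = (\<Sum>is\<in>tuples n {..<n}. \<Sum>S\<in>{S\<in>Pow {..<n}. set is \<subseteq> S}. (-1) ^ (n - card S) * a is)"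
    by (rule sum.swap_restrict) auto
  also have "\<dots> = (\<Sum>is\<in>tuples n {..<n}. if set is = {..<n} then a is else 0)"
  proof (rule sum.cong)
    fix "is" assume "is \<in> tuples n {..<n}"
    then have "set is \<subseteq> {..<n}" by (simp add: tuples_def)
    from alternating_sum_supersets[OF this]
    show "(\<Sum>S\<in>{S\<in>Pow {..<n}. set is \<subseteq> S}. (-1) ^ (n - card S) * a is)
        = (if set is = {..<n} then a is else 0)"
      by (simp flip: sum_distrib_right)
  qed simp
  also have "\<dots> = (\<Sum>js\<in>permutations_of_set {..<n}. a js)"
  proof -
    have "tuples n {..<n} \<inter> {is. set is = {..<n}} = permutations_of_set {..<n}"
      by (auto simp: permutations_of_set_lessThan tuples_def)
    then show ?thesis by (simp add: sum.If_cases)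
  qed
  finally show ?thesis by (simp add: polarization_def)
qed

lemma polarization_tuples_symmetric:
  assumes "\<And>js. js \<in> permutations_of_set {..<n} \<Longrightarrow> a js = A"
  shows "polarization n (\<lambda>S. \<Sum>is\<in>tuples n S. a is) = A"
  using assms by (simp add: polarization_tuples card_permutations_of_set)

lemma mset_map_nth_permutation:
  assumes "js \<in> permutations_of_set {..<n}" "length xs = n"
  shows "mset (map ((!) xs) js) = mset xs"
proof -
  have "mset js = mset [0..<n]"
    using assms set_eq_iff_mset_eq_distinct[of js "[0..<n]"]
    by (auto simp: permutations_of_set_def lessThan_atLeast0)
  then have "mset (map ((!) xs) js) = mset (map ((!) xs) [0..<n])" by simp
  also have "map ((!) xs) [0..<n] = xs" using assms(2) map_nth by blast
  finally show ?thesis .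
qed

lemma bij_betw_tuples_permute:
  assumes "js \<in> permutations_of_set {..<n}" "finite A"
  shows "bij_betw (\<lambda>xs. map ((!) xs) js) (tuples n A) (tuples n A)"
proof -
  have js: "length js = n" "set js = {..<n}" using assms by (auto simp: permutations_of_set_lessThan)
  have "inj_on (\<lambda>xs. map ((!) xs) js) (tuples n A)"
    using js by (auto simp: inj_on_def tuples_def intro!: nth_equalityI)
  moreover have "(\<lambda>xs. map ((!) xs) js) ` tuples n A \<subseteq> tuples n A"
    using js by (auto simp: tuples_def) (metis nth_mem subsetD)
  ultimately show ?thesis
    using assms(2) by (simp add: bij_betw_def endo_inj_surj)
qed

lemma indicator_prod_list:
  "prod_list (map (\<lambda>j. if j \<in> S then 1 else 0) js) = (if set js \<subseteq> S then 1 else 0 :: real)"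
  by (induction js) auto

lemma sum_tuples_indicator:
  fixes S :: "nat set"
  assumes "S \<subseteq> {..<n}"
  shows "(\<Sum>js\<in>tuples m {..<n}. prod_list (map (\<lambda>j. if j \<in> S then 1 else 0) js) * a js)
       = (\<Sum>js\<in>tuples m S. a js :: real)"
proof -
  have "(\<Sum>js\<in>tuples m {..<n}. prod_list (map (\<lambda>j. if j \<in> S then 1 else 0) js) * a js)
      = (\<Sum>js\<in>tuples m {..<n}. if set js \<subseteq> S then a js else 0)"
    by (intro sum.cong refl) (simp add: indicator_prod_list)
  also have "\<dots> = (\<Sum>js\<in>tuples m S. a js)"
  proof -
    have "tuples m {..<n} \<inter> {js. set js \<subseteq> S} = tuples m S"
      using assms by (auto simp: tuples_def)
    then show ?thesis by (simp add: sum.If_cases)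
  qed
  finally show ?thesis .
qed

section \<open>Determinants of linear combinations and mixed discriminants\<close>

definition enum_index :: "'n::finite \<Rightarrow> nat" where
  "enum_index = (SOME f. bij_betw f UNIV {..<CARD('n)})"

lemma bij_betw_enum_index: "bij_betw (enum_index :: 'n::finite \<Rightarrow> nat) UNIV {..<CARD('n)}"
  unfolding enum_index_def
  using someI_ex[OF ex_bij_betw_finite_nat[of "UNIV :: 'n set"]] by (simp add: lessThan_atLeast0)

lemma enum_index_less: "enum_index (i :: 'n::finite) < CARD('n)"
  using bij_betw_enum_index[where 'n='n] by (auto simp: bij_betw_def)

definition enum_of :: "nat \<Rightarrow> 'n::finite" where
  "enum_of = inv_into UNIV enum_index"

lemma enum_of_index [simp]: "enum_of (enum_index (i :: 'n::finite)) = i"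
  unfolding enum_of_def using bij_betw_enum_index[where 'n='n]
  by (simp add: bij_betw_def)

lemma enum_index_of [simp]: "k < CARD('n::finite) \<Longrightarrow> enum_index (enum_of k :: 'n) = k"
  unfolding enum_of_def using bij_betw_enum_index[where 'n='n]
  by (auto simp: bij_betw_def intro!: f_inv_into_f)

text \<open>The matrix of one term in the row expansion of the determinant of a sum;
  \<open>enum_index\<close> matches list positions with the index type of the rows.\<close>

definition mixed_rows :: "(nat \<Rightarrow> real^'n^'n) \<Rightarrow> nat list \<Rightarrow> real^'n^'n" where
  "mixed_rows H is = (\<chi> j. H (is ! enum_index j) $ j)"

lemma bij_betw_tuples_functions:
  "bij_betw (\<lambda>is j. is ! enum_index (j :: 'n::finite)) (tuples CARD('n) A) (UNIV \<rightarrow>\<^sub>E A)"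
proof (rule bij_betw_byWitness[where f' = "\<lambda>f. map (\<lambda>k. f (enum_of k)) [0..<CARD('n)]"])
  show "\<forall>is\<in>tuples CARD('n) A. map (\<lambda>k. is ! enum_index (enum_of k :: 'n)) [0..<CARD('n)] = is"
    by (auto simp: tuples_def intro!: nth_equalityI)
  show "\<forall>f\<in>(UNIV :: 'n set) \<rightarrow>\<^sub>E A. (\<lambda>j. map (\<lambda>k. f (enum_of k)) [0..<CARD('n)] ! enum_index j) = f"
    by (auto simp: enum_index_less)
  show "(\<lambda>is (j :: 'n). is ! enum_index j) ` tuples CARD('n) A \<subseteq> UNIV \<rightarrow>\<^sub>E A"
    by (auto simp: tuples_def enum_index_less)
  show "(\<lambda>f. map (\<lambda>k. f (enum_of k)) [0..<CARD('n)]) ` ((UNIV :: 'n set) \<rightarrow>\<^sub>E A) \<subseteq> tuples CARD('n) A"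
    by (auto simp: tuples_def PiE_iff)
qed

lemma prod_list_enum:
  assumes "length is = CARD('n::finite)"
  shows "prod_list (map c is) = (\<Prod>j\<in>(UNIV :: 'n set). c (is ! enum_index j))"
proof -
  have "prod_list (map c is) = (\<Prod>k<CARD('n). c (is ! k))"
    using assms by (simp add: prod.list_conv_set_nth lessThan_atLeast0)
  also have "\<dots> = (\<Prod>j\<in>(UNIV :: 'n set). c (is ! enum_index j))"
    using prod.reindex_bij_betw[OF bij_betw_enum_index[where 'n='n], of "\<lambda>k. c (is ! k)"] by simp
  finally show ?thesis .
qed

text \<open>Distributivity in the Leibniz formula turns a product of row sums into a sum over
  functions that choose a summand for each row.\<close>

lemma det_rows_sum:
  fixes R :: "nat \<Rightarrow> 'n::finite \<Rightarrow> real^'n"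
  assumes "finite I"
  shows "det (\<chi> j. \<Sum>i\<in>I. R i j) = (\<Sum>f\<in>UNIV \<rightarrow>\<^sub>E I. det (\<chi> j. R (f j) j))"
proof -
  have "det (\<chi> j. \<Sum>i\<in>I. R i j)
      = (\<Sum>p | p permutes (UNIV :: 'n set). of_int (sign p) * (\<Prod>j\<in>UNIV. \<Sum>i\<in>I. R i j $ p j))"
    by (simp add: det_def)
  also have "\<dots> = (\<Sum>p | p permutes (UNIV :: 'n set). of_int (sign p) *
      (\<Sum>f\<in>UNIV \<rightarrow>\<^sub>E I. \<Prod>j\<in>UNIV. R (f j) j $ p j))"
    using assms by (simp add: prod_sum_PiE)
  also have "\<dots> = (\<Sum>f\<in>UNIV \<rightarrow>\<^sub>E I. \<Sum>p | p permutes (UNIV :: 'n set).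
      of_int (sign p) * (\<Prod>j\<in>UNIV. R (f j) j $ p j))"
    by (simp add: sum_distrib_left) (rule sum.swap)
  also have "\<dots> = (\<Sum>f\<in>UNIV \<rightarrow>\<^sub>E I. det (\<chi> j. R (f j) j))"
    by (simp add: det_def)
  finally show ?thesis .
qed

lemma det_linear_combination:
  fixes H :: "nat \<Rightarrow> real^'n^'n"
  shows "det (\<Sum>i<m. c i *\<^sub>R H i)
       = (\<Sum>is\<in>tuples CARD('n) {..<m}. prod_list (map c is) * det (mixed_rows H is))"
proof -
  have "(\<Sum>i<m. c i *\<^sub>R H i) = (\<chi> j. \<Sum>i<m. c i *s (H i $ j))"
    by (simp add: vec_eq_iff)
  then have "det (\<Sum>i<m. c i *\<^sub>R H i)
      = (\<Sum>f\<in>UNIV \<rightarrow>\<^sub>E {..<m}. det (\<chi> j. c (f j) *s (H (f j) $ j)))"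
    by (simp add: det_rows_sum)
  also have "\<dots> = (\<Sum>f\<in>UNIV \<rightarrow>\<^sub>E {..<m}. (\<Prod>j\<in>UNIV. c (f j)) * det (\<chi> j. H (f j) $ j))"
    by (simp add: det_rows_mul)
  also have "\<dots> = (\<Sum>is\<in>tuples CARD('n) {..<m}.
      (\<Prod>j\<in>(UNIV :: 'n set). c (is ! enum_index j)) * det (\<chi> j. H (is ! enum_index j) $ j))"
    using sum.reindex_bij_betw[OF bij_betw_tuples_functions[where 'n='n and A="{..<m}"],
        of "\<lambda>f. (\<Prod>j\<in>UNIV. c (f j)) * det (\<chi> j. H (f j) $ j)"] by simp
  also have "\<dots> = (\<Sum>is\<in>tuples CARD('n) {..<m}. prod_list (map c is) * det (mixed_rows H is))"
    by (intro sum.cong refl) (auto simp: tuples_def mixed_rows_def prod_list_enum[where 'n='n])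
  finally show ?thesis .
qed

text \<open>The mixed discriminant. It is written as a polarization of determinants so that it has
  the form of \<open>mixed_ma\<close>, with determinants in place of measures.\<close>

definition mixed_disc :: "(nat \<Rightarrow> real^'n^'n) \<Rightarrow> real" where
  "mixed_disc H = polarization CARD('n) (\<lambda>S. det (\<Sum>j<CARD('n). (if j \<in> S then 1 else 0) *\<^sub>R H j))"

lemma mixed_disc_eq:
  fixes H :: "nat \<Rightarrow> real^'n^'n"
  shows "mixed_disc H = (\<Sum>js\<in>permutations_of_set {..<CARD('n)}. det (mixed_rows H js)) / fact CARD('n)"
proof -
  have "mixed_disc H = polarization CARD('n) (\<lambda>S. \<Sum>js\<in>tuples CARD('n) S. det (mixed_rows H js))"
    unfolding mixed_disc_def polarization_def det_linear_combination
    by (simp add: sum_tuples_indicator del: of_nat_fact)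
  then show ?thesis by (simp add: polarization_tuples)
qed

text \<open>Rearranging positions is a bijection of the tuples and leaves the coefficient product
  unchanged, so averaging the row expansion over all rearrangements does not alter its
  value.\<close>

lemma det_eq_sum_mixed_disc:
  fixes H :: "nat \<Rightarrow> real^'n^'n"
  shows "det (\<Sum>i<m. c i *\<^sub>R H i)
       = (\<Sum>is\<in>tuples CARD('n) {..<m}. prod_list (map c is) * mixed_disc (\<lambda>j. H (is ! j)))"
proof -
  let ?n = "CARD('n)" and ?P = "permutations_of_set {..<CARD('n)}" and ?L = "tuples CARD('n) {..<m}"
  have rows: "mixed_rows (\<lambda>j. H (is ! j)) js = mixed_rows H (map ((!) is) js)" if "js \<in> ?P" for "is" js
    using that by (simp add: mixed_rows_def permutations_of_set_lessThan enum_index_less)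
  have inv: "prod_list (map c (map ((!) is) js)) = prod_list (map c is)" if "js \<in> ?P" "is \<in> ?L" for "is" js
  proof -
    have "mset (map c (map ((!) is) js)) = mset (map c is)"
      using mset_map_nth_permutation[of js ?n "is"] that by (simp add: tuples_def) (metis image_mset.compositionality mset_map)
    then show ?thesis by (metis prod_mset_prod_list)
  qed
  have "(\<Sum>is\<in>?L. prod_list (map c is) * (\<Sum>js\<in>?P. det (mixed_rows (\<lambda>j. H (is ! j)) js)))
      = (\<Sum>is\<in>?L. \<Sum>js\<in>?P. prod_list (map c (map ((!) is) js)) * det (mixed_rows H (map ((!) is) js)))"
    by (simp add: sum_distrib_left rows inv del: map_map)
  also have "\<dots> = (\<Sum>js\<in>?P. \<Sum>is\<in>?L. prod_list (map c (map ((!) is) js)) * det (mixed_rows H (map ((!) is) js)))"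
    by (rule sum.swap)
  also have "\<dots> = (\<Sum>js\<in>?P. \<Sum>is\<in>?L. prod_list (map c is) * det (mixed_rows H is))"
    by (intro sum.cong refl sum.reindex_bij_betw bij_betw_tuples_permute) auto
  also have "\<dots> = fact ?n * det (\<Sum>i<m. c i *\<^sub>R H i)"
    by (simp add: card_permutations_of_set det_linear_combination)
  finally show ?thesis
    by (simp add: mixed_disc_eq sum_divide_distrib[symmetric] field_simps)
qed

text \<open>Positive semidefinite matrices, presented as finite sums of rank-one matrices; the
  Hessians in the proof come with such a presentation.\<close>

definition gram :: "(real^'n^'n) \<Rightarrow> bool" where
  "gram A \<longleftrightarrow> (\<exists>(N::nat) v. A = (\<Sum>k<N. \<chi> i j. v k $ i * v k $ j))"

lemma gram_outer: "gram (\<chi> i j. v $ i * v $ j)"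
  unfolding gram_def by (intro exI[of _ 1] exI[of _ "\<lambda>_. v"]) simp

lemma gram_0: "gram 0"
  unfolding gram_def by (intro exI[of _ 0]) simp

lemma gram_add_outer:
  assumes "gram A"
  shows "gram (A + (\<chi> i j. w $ i * w $ j))"
proof -
  obtain N :: nat and v where A: "A = (\<Sum>k<N. \<chi> i j. v k $ i * v k $ j)"
    using assms unfolding gram_def by blast
  then have "A + (\<chi> i j. w $ i * w $ j) = (\<Sum>k<Suc N. \<chi> i j. (v(N := w)) k $ i * (v(N := w)) k $ j)"
    by simp
  then show ?thesis unfolding gram_def by blast
qed

lemma gram_add:
  assumes "gram A" "gram B"
  shows "gram (A + B)"
proof -
  obtain N :: nat and v where B: "B = (\<Sum>k<N. \<chi> i j. v k $ i * v k $ j)"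
    using assms unfolding gram_def by blast
  have "gram (A + (\<Sum>k<N. \<chi> i j. v k $ i * v k $ j))"
    by (induction N) (use assms gram_add_outer in \<open>auto simp: add.assoc[symmetric]\<close>)
  then show ?thesis by (simp add: B)
qed

lemma gram_scale:
  assumes "gram A" "0 \<le> c"
  shows "gram (c *\<^sub>R A)"
proof -
  obtain N :: nat and v where A: "A = (\<Sum>k<N. \<chi> i j. v k $ i * v k $ j)"
    using assms unfolding gram_def by blast
  have "c *\<^sub>R A = (\<Sum>k<(N::nat). \<chi> i j. (sqrt c *\<^sub>R v k) $ i * (sqrt c *\<^sub>R v k) $ j)"
    using assms(2) by (simp add: A vec_eq_iff sum_distrib_left mult_ac power2_eq_square[symmetric]) (simp add: mult.assoc[symmetric])
  then show ?thesis unfolding gram_def by (intro exI[of _ N] exI[of _ "\<lambda>k. sqrt c *\<^sub>R v k"])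
qed

lemma gram_sum: "(\<And>i. i \<in> I \<Longrightarrow> gram (A i)) \<Longrightarrow> gram (\<Sum>i\<in>I. A i)"
  by (induction I rule: infinite_finite_induct) (auto intro: gram_0 gram_add)

text \<open>Zero vectors bring all matrices to the same number of rank-one terms, so that one index
  set serves for all rows.\<close>

lemma gram_pad:
  fixes m :: nat
  assumes "\<And>i. i < m \<Longrightarrow> gram (H i)"
  shows "\<exists>(N::nat) v. \<forall>i<m. H i = (\<Sum>k<N. \<chi> a b. v i k $ a * v i k $ b)"
proof -
  have "\<forall>i. \<exists>N v. i < m \<longrightarrow> H i = (\<Sum>k<(N::nat). \<chi> a b. v k $ a * v k $ b)"
    using assms unfolding gram_def by blast
  from choice[OF this] obtain N where "\<forall>i. \<exists>v. i < m \<longrightarrow> H i = (\<Sum>k<(N i::nat). \<chi> a b. v k $ a * v k $ b)"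
    by blast
  from choice[OF this] obtain w where w: "\<And>i. i < m \<Longrightarrow> H i = (\<Sum>k<N i. \<chi> a b. w i k $ a * w i k $ b)"
    by blast
  define M where "M = Max (N ` {..<m})"
  have "H i = (\<Sum>k<M. \<chi> a b. (if k < N i then w i k else 0) $ a * (if k < N i then w i k else 0) $ b)"
    if "i < m" for i
  proof -
    have "N i \<le> M" using that by (auto simp: M_def intro!: Max_ge)
    have "H i = (\<Sum>k<N i. \<chi> a b. (if k < N i then w i k else 0) $ a * (if k < N i then w i k else 0) $ b)"
      using w[OF that] by simp
    also have "\<dots> = (\<Sum>k<M. \<chi> a b. (if k < N i then w i k else 0) $ a * (if k < N i then w i k else 0) $ b)"
      using \<open>N i \<le> M\<close> by (intro sum.mono_neutral_left) (auto simp: vec_eq_iff)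
    finally show ?thesis .
  qed
  then show ?thesis
    by (intro exI[of _ M] exI[of _ "\<lambda>i k. if k < N i then w i k else 0"]) blast
qed

lemma bij_betw_permutations_of_set_permutes:
  "bij_betw (\<lambda>js (j::'n::finite). enum_of (js ! enum_index j))
     (permutations_of_set {..<CARD('n)}) {p. p permutes (UNIV :: 'n set)}"
proof (rule bij_betw_byWitness[where f' = "\<lambda>p. map (\<lambda>k. enum_index (p (enum_of k :: 'n))) [0..<CARD('n)]"])
  have less: "js ! k < CARD('n)" if "js \<in> permutations_of_set {..<CARD('n)}" "k < CARD('n)" for js k
    using that nth_mem[of k js] by (auto simp: permutations_of_set_lessThan)
  show "\<forall>js\<in>permutations_of_set {..<CARD('n)}.
      map (\<lambda>k. enum_index (enum_of (js ! enum_index (enum_of k :: 'n)) :: 'n)) [0..<CARD('n)] = js"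
    using less by (auto simp: permutations_of_set_lessThan intro!: nth_equalityI)
  show "\<forall>p\<in>{p. p permutes (UNIV :: 'n set)}.
      (\<lambda>j. enum_of (map (\<lambda>k. enum_index (p (enum_of k))) [0..<CARD('n)] ! enum_index j)) = p"
    by (auto simp: enum_index_less)
  show "(\<lambda>js j. enum_of (js ! enum_index j)) ` permutations_of_set {..<CARD('n)} \<subseteq> {p. p permutes (UNIV :: 'n set)}"
  proof clarify
    fix js assume js: "js \<in> permutations_of_set {..<CARD('n)}"
    have "inj (\<lambda>j::'n. enum_of (js ! enum_index j) :: 'n)"
    proof (rule injI)
      fix x y :: 'n assume "(enum_of (js ! enum_index x) :: 'n) = enum_of (js ! enum_index y)"
      then have "js ! enum_index x = js ! enum_index y"
        using less[OF js] enum_index_less by (metis enum_index_of)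
      then have "enum_index x = enum_index y"
        using js enum_index_less[where 'n='n] permutations_of_set_lessThan[of js]
        by (metis nth_eq_iff_index_eq permutations_of_setD(2))
      then show "x = y" by (metis enum_of_index)
    qed
    then show "(\<lambda>j::'n. enum_of (js ! enum_index j)) permutes UNIV"
      by (metis UNIV_I bij_imp_permutes finite finite_UNIV_inj_surj bij_def)
  qed
  show "(\<lambda>p. map (\<lambda>k. enum_index (p (enum_of k :: 'n))) [0..<CARD('n)]) ` {p. p permutes UNIV}
      \<subseteq> permutations_of_set {..<CARD('n)}"
  proof clarify
    fix p assume p: "p permutes (UNIV :: 'n set)"
    define xs where "xs = map (\<lambda>k. enum_index (p (enum_of k :: 'n))) [0..<CARD('n)]"
    have d: "distinct xs"
      unfolding xs_def distinct_map
    proof (intro conjI inj_onI)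
      fix x y assume "x \<in> set [0..<CARD('n)]" "y \<in> set [0..<CARD('n)]"
        and eq: "enum_index (p (enum_of x :: 'n)) = enum_index (p (enum_of y :: 'n))"
      then have xy: "x < CARD('n)" "y < CARD('n)" by auto
      have "p (enum_of x) = p (enum_of y)" using arg_cong[OF eq, of "enum_of :: nat \<Rightarrow> 'n"] by simp
      then have "(enum_of x :: 'n) = enum_of y" using permutes_inj[OF p] by (simp add: inj_eq)
      then show "x = y" by (metis enum_index_of xy)
    qed simp
    have sub: "set xs \<subseteq> {..<CARD('n)}"
      by (auto simp: xs_def enum_index_less)
    have "length xs = CARD('n)" by (simp add: xs_def)
    then have "card (set xs) = card {..<CARD('n)}"
      using distinct_card[OF d] by simp
    then have "set xs = {..<CARD('n)}"
      using card_subset_eq[OF finite_lessThan sub] by blast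
    with d show "map (\<lambda>k. enum_index (p (enum_of k :: 'n))) [0..<CARD('n)] \<in> permutations_of_set {..<CARD('n)}"
      unfolding xs_def by (intro permutations_of_setI)
  qed
qed

lemma mixed_disc_eq_permutes:
  fixes H :: "nat \<Rightarrow> real^'n^'n"
  shows "fact CARD('n) * mixed_disc H
    = (\<Sum>p | p permutes (UNIV :: 'n set). det (\<chi> j. H (enum_index (p j)) $ j))"
proof -
  have "(\<Sum>p | p permutes (UNIV :: 'n set). det (\<chi> j. H (enum_index (p j)) $ j))
      = (\<Sum>js\<in>permutations_of_set {..<CARD('n)}. det (\<chi> j. H (enum_index (enum_of (js ! enum_index j) :: 'n)) $ j))"
    using sum.reindex_bij_betw[OF bij_betw_permutations_of_set_permutes[where 'n='n],
        of "\<lambda>p. det (\<chi> j. H (enum_index (p j)) $ j)"] by simp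
  also have "\<dots> = (\<Sum>js\<in>permutations_of_set {..<CARD('n)}. det (mixed_rows H js))"
  proof (rule sum.cong)
    fix js assume js: "js \<in> permutations_of_set {..<CARD('n)}"
    have "js ! enum_index j < CARD('n)" for j :: 'n
      using js nth_mem[of "enum_index j" js] by (auto simp: permutations_of_set_lessThan enum_index_less)
    then show "det (\<chi> j. H (enum_index (enum_of (js ! enum_index j) :: 'n)) $ j) = det (mixed_rows H js)"
      by (simp add: mixed_rows_def)
  qed simp
  finally show ?thesis by (simp add: mixed_disc_eq)
qed

text \<open>
  Expanding all matrices into rank-one terms turns the symmetrized determinant into a sum of
  squares of determinants.
\<close>

lemma mixed_disc_nonneg:
  fixes H :: "nat \<Rightarrow> real^'n^'n"
  assumes "\<And>j. j < CARD('n) \<Longrightarrow> gram (H j)"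
  shows "0 \<le> mixed_disc H"
proof -
  obtain N :: nat and v :: "nat \<Rightarrow> nat \<Rightarrow> real^'n"
    where v: "\<And>i. i < CARD('n) \<Longrightarrow> H i = (\<Sum>k<N. \<chi> a b. v i k $ a * v i k $ b)"
    using gram_pad[of "CARD('n)" H] assms by blast
  let ?\<Pi> = "{p. p permutes (UNIV :: 'n set)}" and ?F = "(UNIV :: 'n set) \<rightarrow>\<^sub>E {..<N}"
  define w where "w g j = v (enum_index j) (g j)" for g and j :: 'n
  have row: "det (\<chi> j. H (enum_index (p j)) $ j) = (\<Sum>g\<in>?F. (\<Prod>j\<in>UNIV. w g (p j) $ j) * (of_int (sign p) * det (\<chi> j. w g j)))"
    if p: "p permutes UNIV" for p
  proof -
    have "det (\<chi> j. H (enum_index (p j)) $ j)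
        = det (\<chi> j. \<Sum>k<N. v (enum_index (p j)) k $ j *s v (enum_index (p j)) k)"
      by (intro arg_cong[where f=det]) (simp add: vec_eq_iff v enum_index_less)
    also have "\<dots> = (\<Sum>f\<in>?F. det (\<chi> j. v (enum_index (p j)) (f j) $ j *s v (enum_index (p j)) (f j)))"
      by (simp add: det_rows_sum)
    \<comment> \<open>Choosing by matrix instead of by row makes the rows a permutation of rows that
      depend only on \<open>g\<close>, so \<open>p\<close> enters the determinant just through its
      sign.\<close>
    also have "\<dots> = (\<Sum>g\<in>?F. det (\<chi> j. v (enum_index (p j)) (g (p j)) $ j *s v (enum_index (p j)) (g (p j))))"
      using permutes_inverses[OF p]
      by (intro sum.reindex_bij_witness[of _ "\<lambda>g. g \<circ> p" "\<lambda>f. f \<circ> inv p"]) (auto simp: fun_eq_iff)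
    also have "\<dots> = (\<Sum>g\<in>?F. (\<Prod>j\<in>UNIV. w g (p j) $ j) * det (\<chi> j. w g (p j)))"
      by (simp add: det_rows_mul w_def)
    also have "\<dots> = (\<Sum>g\<in>?F. (\<Prod>j\<in>UNIV. w g (p j) $ j) * (of_int (sign p) * det (\<chi> j. w g j)))"
      using det_permute_rows[OF p, of "\<chi> j. w _ j"] by simp
    finally show ?thesis .
  qed
  have "fact CARD('n) * mixed_disc H = (\<Sum>p\<in>?\<Pi>. \<Sum>g\<in>?F. (\<Prod>j\<in>UNIV. w g (p j) $ j) * (of_int (sign p) * det (\<chi> j. w g j)))"
    unfolding mixed_disc_eq_permutes by (intro sum.cong refl row) auto
  also have "\<dots> = (\<Sum>g\<in>?F. \<Sum>p\<in>?\<Pi>. (\<Prod>j\<in>UNIV. w g (p j) $ j) * (of_int (sign p) * det (\<chi> j. w g j)))"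
    by (rule sum.swap)
  also have "\<dots> = (\<Sum>g\<in>?F. det (\<chi> j. w g j) * det (transpose (\<chi> j. w g j)))"
  proof (rule sum.cong)
    fix g
    have "det (transpose (\<chi> j. w g j)) = (\<Sum>p\<in>?\<Pi>. of_int (sign p) * (\<Prod>j\<in>UNIV. w g (p j) $ j))"
      unfolding det_def by (simp add: transpose_def)
    then show "(\<Sum>p\<in>?\<Pi>. (\<Prod>j\<in>UNIV. w g (p j) $ j) * (of_int (sign p) * det (\<chi> j. w g j)))
        = det (\<chi> j. w g j) * det (transpose (\<chi> j. w g j))"
      by (simp add: sum_distrib_left mult_ac)
  qed simp
  also have "\<dots> = (\<Sum>g\<in>?F. (det (\<chi> j. w g j))\<^sup>2)"
    by (simp add: power2_eq_square)
  also have "\<dots> \<ge> 0" by (intro sum_nonneg) simp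
  finally have "0 \<le> fact CARD('n) * mixed_disc H" .
  moreover have "(0::real) < fact CARD('n)" by simp
  ultimately show ?thesis by (metis zero_le_mult_iff not_le)
qed

text \<open>The mixed discriminant of \<open>n\<close> copies of a matrix is its
  determinant.\<close>

lemma gram_det_nonneg:
  fixes A :: "real^'n^'n"
  assumes "gram A"
  shows "0 \<le> det A"
proof -
  have "(\<chi> j. A $ j) = A" by (simp add: vec_eq_iff)
  then have "fact CARD('n) * mixed_disc (\<lambda>_. A) = fact CARD('n) * det A"
    unfolding mixed_disc_eq_permutes by (simp add: card_permutations)
  then show ?thesis using mixed_disc_nonneg[of "\<lambda>_. A"] assms by simp
qed

section \<open>Change of variables for arbitrary finite index types\<close>

text \<open>
  The change of variables theorem of the library asks for a well-ordered index type; a copy of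
  the index type, ordered by an enumeration, makes it available for every finite index type.
\<close>

typedef 'a ordered_copy = "UNIV :: 'a set" by simp

lemma bij_Rep_ordered_copy: "bij Rep_ordered_copy"
  by (metis Abs_ordered_copy_inverse Rep_ordered_copy_inverse UNIV_I bijI' surj_def)

instance ordered_copy :: (finite) finite
proof
  have "finite (Abs_ordered_copy ` (UNIV :: 'a set))" by simp
  moreover have "range Abs_ordered_copy = (UNIV :: 'a ordered_copy set)"
    by (metis Rep_ordered_copy_inverse surj_def)
  ultimately show "finite (UNIV :: 'a ordered_copy set)" by simp
qed

instantiation ordered_copy :: (finite) wellorder
begin

definition less_eq_ordered_copy :: "'a ordered_copy \<Rightarrow> 'a ordered_copy \<Rightarrow> bool" where
  "x \<le> y \<longleftrightarrow> enum_index (Rep_ordered_copy x) \<le> enum_index (Rep_ordered_copy y)"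

definition less_ordered_copy :: "'a ordered_copy \<Rightarrow> 'a ordered_copy \<Rightarrow> bool" where
  "x < y \<longleftrightarrow> enum_index (Rep_ordered_copy x) < enum_index (Rep_ordered_copy y)"

instance
proof
  fix x y :: "'a ordered_copy" assume "x \<le> y" "y \<le> x"
  then have "enum_index (Rep_ordered_copy x) = enum_index (Rep_ordered_copy y)"
    by (simp add: less_eq_ordered_copy_def)
  then have "Rep_ordered_copy x = Rep_ordered_copy y" by (metis enum_of_index)
  then show "x = y" by (simp add: Rep_ordered_copy_inject)
next
  fix P and a :: "'a ordered_copy"
  assume step: "\<And>x :: 'a ordered_copy. (\<And>y. y < x \<Longrightarrow> P y) \<Longrightarrow> P x"
  show "P a"
    by (induction a rule: measure_induct_rule[of "\<lambda>x. enum_index (Rep_ordered_copy x)"])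
       (use step less_ordered_copy_def in blast)
qed (auto simp: less_eq_ordered_copy_def less_ordered_copy_def)

end

section \<open>Renaming coordinates\<close>

definition relabel :: "('m \<Rightarrow> 'n) \<Rightarrow> real^'n \<Rightarrow> real^'m" where
  "relabel f x = (\<chi> i. x $ f i)"

lemma relabel_nth [simp]: "relabel f x $ i = x $ f i"
  by (simp add: relabel_def)

lemma linear_relabel: "linear (relabel f)"
  by (rule linearI) (simp_all add: vec_eq_iff)

lemma bounded_linear_relabel: "bounded_linear (relabel (f :: 'm::finite \<Rightarrow> 'n::finite))"
  by (simp add: linear_relabel linear_conv_bounded_linear[symmetric])

lemma relabel_inverse:
  assumes "bij f"
  shows "relabel f (relabel (inv f) x) = x" "relabel (inv f) (relabel f y) = y"
  using assms by (auto simp: vec_eq_iff bij_is_inj surj_f_inv_f[OF bij_is_surj])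

lemma relabel_image_eq_vimage:
  assumes "bij f"
  shows "relabel f ` X = relabel (inv f) -` X"
  using relabel_inverse[OF assms] by (auto simp: image_iff) metis

lemma borel_measurable_relabel [measurable]:
  "relabel (f :: 'm::finite \<Rightarrow> 'n::finite) \<in> borel_measurable borel"
  using linear_continuous_on[OF bounded_linear_relabel[of f]]
  by (rule borel_measurable_continuous_onI)

lemma relabel_inner:
  fixes f :: "'m::finite \<Rightarrow> 'n::finite"
  assumes "bij f"
  shows "relabel f x \<bullet> relabel f y = x \<bullet> y"
  unfolding inner_vec_def using sum.reindex_bij_betw[OF assms, of "\<lambda>i. x $ i \<bullet> y $ i"] by simp

lemma relabel_image_box:
  assumes "bij f"
  shows "relabel f ` box a b = box (relabel f a) (relabel f b)"
    "relabel f ` cbox a b = cbox (relabel f a) (relabel f b)"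
proof -
  have all: "(\<forall>i. P i) \<longleftrightarrow> (\<forall>i. P (f i))" for P
    using assms by (metis bij_inv_eq_iff)
  show "relabel f ` box a b = box (relabel f a) (relabel f b)"
    unfolding relabel_image_eq_vimage[OF assms]
    by (simp add: set_eq_iff mem_box_cart)
       (subst all, simp add: inv_f_f[OF bij_is_inj[OF assms]])
  show "relabel f ` cbox a b = cbox (relabel f a) (relabel f b)"
    unfolding relabel_image_eq_vimage[OF assms]
    by (simp add: set_eq_iff mem_box_cart)
       (subst all, simp add: inv_f_f[OF bij_is_inj[OF assms]])
qed

lemma prod_Basis_cart: "(\<Prod>b\<in>Basis. (x :: real^'n) \<bullet> b) = (\<Prod>i\<in>UNIV. x $ i)"
  by (simp add: Basis_vec_def cart_eq_inner_axis axis_eq_axis prod.UNION_disjoint)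

lemma lborel_distr_relabel:
  fixes f :: "'m::finite \<Rightarrow> 'n::finite"
  assumes "bij f"
  shows "distr lborel borel (relabel f) = lborel"
proof (rule lborel_eqI[symmetric])
  fix l u :: "real^'m" assume le: "\<And>b. b \<in> Basis \<Longrightarrow> l \<bullet> b \<le> u \<bullet> b"
  have bi: "bij (inv f)" using assms by (rule bij_imp_bij_inv)
  have le': "\<forall>i. l $ i \<le> u $ i"
    using le by (auto simp: Basis_vec_def cart_eq_inner_axis)
  have "relabel f -` box l u = relabel (inv f) ` box l u"
    using relabel_image_eq_vimage[OF bi] by (simp add: inv_inv_eq[OF assms])
  then have "emeasure (distr lborel borel (relabel f)) (box l u)
      = emeasure lborel (box (relabel (inv f) l) (relabel (inv f) u))"
    by (simp add: emeasure_distr relabel_image_box[OF bi])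
  also have "\<dots> = (\<Prod>b\<in>Basis. (relabel (inv f) u - relabel (inv f) l) \<bullet> b)"
    using le' by (intro emeasure_lborel_box) (auto simp: Basis_vec_def cart_eq_inner_axis[symmetric])
  also have "(\<Prod>b\<in>Basis. (relabel (inv f) u - relabel (inv f) l) \<bullet> b) = (\<Prod>b\<in>Basis. (u - l) \<bullet> b)"
    using prod.reindex_bij_betw[OF bi, of "\<lambda>i. u $ i - l $ i"] by (simp add: prod_Basis_cart)
  finally show "emeasure (distr lborel borel (relabel f)) (box l u) = (\<Prod>b\<in>Basis. (u - l) \<bullet> b)" .
qed simp

lemma emeasure_relabel_image:
  fixes f :: "'m::finite \<Rightarrow> 'n::finite"
  assumes "bij f" "X \<in> sets borel"
  shows "relabel f ` X \<in> sets borel" "emeasure lborel (relabel f ` X) = emeasure lborel X"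
proof -
  have bi: "bij (inv f)" using assms(1) by (rule bij_imp_bij_inv)
  show "relabel f ` X \<in> sets borel"
    unfolding relabel_image_eq_vimage[OF assms(1)]
    using measurable_sets[OF borel_measurable_relabel assms(2), of "inv f"] by simp
  have "emeasure lborel X = emeasure (distr lborel borel (relabel (inv f))) X"
    by (simp add: lborel_distr_relabel[OF bi])
  also have "\<dots> = emeasure lborel (relabel f ` X)"
    using assms by (simp add: emeasure_distr relabel_image_eq_vimage)
  finally show "emeasure lborel (relabel f ` X) = emeasure lborel X" by simp
qed

text \<open>Conjugation by \<open>f\<close> is a sign-preserving bijection between the permutations
  of the two index types, which matches the Leibniz formulas term by term.\<close>

lemma det_relabel:
  fixes M :: "real^'n^'n" and f :: "'m::finite \<Rightarrow> 'n::finite"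
  assumes "bij f"
  shows "det (\<chi> i j. M $ f i $ f j) = det M"
proof -
  have inj: "inj f" using assms bij_is_inj by blast
  have "det M = (\<Sum>p | p permutes (UNIV :: 'm set). of_int (sign (map_permutation UNIV f p)) *
      (\<Prod>i\<in>UNIV. M $ i $ (map_permutation UNIV f p i)))"
    unfolding det_def
  proof (rule sum.reindex_bij_betw[symmetric])
    have bi: "bij (inv f)" using assms by (rule bij_imp_bij_inv)
    show "bij_betw (map_permutation UNIV f) {p. p permutes (UNIV :: 'm set)} {p. p permutes (UNIV :: 'n set)}"
    proof (rule bij_betw_byWitness[where f' = "map_permutation UNIV (inv f)"])
      show "\<forall>p\<in>{p. p permutes UNIV}. map_permutation UNIV (inv f) (map_permutation UNIV f p) = p"
        using assms by (auto simp: map_permutation_def fun_eq_iff bij_is_surj bij_is_inj bij_imp_bij_inv inv_inv_eq restrict_id_def surj_imp_inj_inv)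
      show "\<forall>p\<in>{p. p permutes UNIV}. map_permutation UNIV f (map_permutation UNIV (inv f) p) = p"
        using assms by (auto simp: map_permutation_def fun_eq_iff bij_is_surj bij_is_inj bij_imp_bij_inv inv_inv_eq restrict_id_def surj_f_inv_f)
      show "map_permutation UNIV f ` {p. p permutes UNIV} \<subseteq> {p. p permutes UNIV}"
        using assms by (auto intro!: map_permutation_permutes)
      show "map_permutation UNIV (inv f) ` {p. p permutes UNIV} \<subseteq> {p. p permutes UNIV}"
        using bi by (auto intro!: map_permutation_permutes)
    qed
  qed
  also have "\<dots> = (\<Sum>p | p permutes (UNIV :: 'm set). of_int (sign p) * (\<Prod>i\<in>UNIV. M $ f i $ f (p i)))"
  proof (rule sum.cong)
    fix p :: "'m \<Rightarrow> 'm" assume "p \<in> {p. p permutes UNIV}"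
    then have p: "p permutes UNIV" by simp
    have "(\<Prod>i\<in>UNIV. M $ i $ (map_permutation UNIV f p i))
        = (\<Prod>i\<in>UNIV. M $ f i $ (map_permutation UNIV f p (f i)))"
      using prod.reindex_bij_betw[OF assms, of "\<lambda>i. M $ i $ (map_permutation UNIV f p i)"] by simp
    also have "\<dots> = (\<Prod>i\<in>UNIV. M $ f i $ f (p i))"
      by (simp add: map_permutation_apply[OF inj])
    finally show "of_int (sign (map_permutation UNIV f p)) * (\<Prod>i\<in>UNIV. M $ i $ (map_permutation UNIV f p i))
        = of_int (sign p) * (\<Prod>i\<in>UNIV. M $ f i $ f (p i))"
      by (simp add: sign_map_permutation[OF inj p])
  qed simp
  also have "\<dots> = det (\<chi> i j. M $ f i $ f j)"
    by (simp add: det_def)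
  finally show ?thesis by simp
qed

text \<open>The substitution rule is applied over a box, so the integrand is first extended by zero
  to a box around the image of \<open>A\<close>.\<close>

lemma has_integral_relabel:
  fixes g :: "'m::finite \<Rightarrow> 'n::finite" and F :: "real^'m \<Rightarrow> real"
  assumes g: "bij g" and F: "(F has_integral i) (relabel g ` A)" and "bounded A"
  shows "((\<lambda>x. F (relabel g x)) has_integral i) A"
proof -
  have bi: "bij (inv g)" using g by (rule bij_imp_bij_inv)
  have "bounded (relabel g ` A)"
    by (rule bounded_linear_image[OF \<open>bounded A\<close> bounded_linear_relabel])
  then obtain a b where ab: "relabel g ` A \<subseteq> cbox a b"
    using bounded_subset_cbox_symmetric by blast
  define F' where "F' y = (if y \<in> relabel g ` A then F y else 0)" for y
  have "(F' has_integral i) (cbox a b)"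
    unfolding F'_def has_integral_restrict[OF ab] by (rule F)
  have "((\<lambda>x. F' (relabel g x)) has_integral (1 / 1) *\<^sub>R i) (relabel (inv g) ` cbox a b)"
  proof (rule has_integral_twiddle)
    show "(F' has_integral i) (cbox a b)" by fact
    show "measure lborel (relabel g ` cbox u v) = 1 * measure lborel (cbox u v)" for u v
      using emeasure_relabel_image(2)[OF g, of "cbox u v"]
      by (simp add: measure_def)
    show "continuous (at x) (relabel g)" for x
      by (rule linear_continuous_at[OF bounded_linear_relabel])
    show "\<exists>w z. relabel g ` cbox u v = cbox w z" for u v
      using relabel_image_box(2)[OF g, of u v] by (intro exI)
    show "\<exists>w z. relabel (inv g) ` cbox u v = cbox w z" for u v
      using relabel_image_box(2)[OF bi, of u v] by (intro exI)
  qed (simp_all add: relabel_inverse[OF g])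
  moreover have "(relabel g x \<in> relabel g ` A) = (x \<in> A)" for x
    by (simp add: relabel_image_eq_vimage[OF g] relabel_inverse[OF g])
  ultimately have "((\<lambda>x. if x \<in> A then F (relabel g x) else 0) has_integral i) (relabel (inv g) ` cbox a b)"
    by (simp add: F'_def)
  moreover have sub: "A \<subseteq> relabel (inv g) ` cbox a b"
    using ab by (auto simp: relabel_image_eq_vimage[OF bi] inv_inv_eq[OF g])
  ultimately show ?thesis
    unfolding has_integral_restrict[OF sub] by simp
qed

text \<open>Renaming coordinates conjugates \<open>G\<close> to a map over the ordered copy; the
  measure of the image and the determinant of the derivative are invariant under renaming.\<close>

lemma has_integral_det_derivative:
  fixes G :: "real^'n \<Rightarrow> real^'n"
  assumes A: "open A" "bounded A" "inj_on G A"
    and GA: "G ` A \<in> sets borel" "bounded (G ` A)"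
    and deriv: "\<And>x. x \<in> A \<Longrightarrow> (G has_derivative (\<lambda>h. H x *v h)) (at x)"
  shows "((\<lambda>x. \<bar>det (H x)\<bar>) has_integral measure lebesgue (G ` A)) A"
proof -
  let ?r = "Rep_ordered_copy :: 'n ordered_copy \<Rightarrow> 'n"
  let ?T = "relabel ?r" and ?S = "relabel (inv ?r)"
  note b = bij_Rep_ordered_copy[where 'a='n]
  note inv = relabel_inverse[OF b]
  define G' where "G' = ?T \<circ> G \<circ> ?S"
  define H' where "H' y = (\<chi> i j. H (?S y) $ ?r i $ ?r j)" for y :: "real^('n ordered_copy)"
  have vec: "H' y *v h = ?T (H (?S y) *v ?S h)" for y h
  proof -
    have "(\<Sum>j\<in>UNIV. H (?S y) $ ?r i $ ?r j * h $ j) = (\<Sum>k\<in>UNIV. H (?S y) $ ?r i $ k * h $ inv ?r k)" for i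
      using sum.reindex_bij_betw[OF b, of "\<lambda>k. H (?S y) $ ?r i $ k * h $ inv ?r k"]
      by (simp add: inv_f_f[OF bij_is_inj[OF b]])
    then show ?thesis by (simp add: vec_eq_iff matrix_vector_mult_def H'_def)
  qed
  have S: "?S y \<in> A \<longleftrightarrow> y \<in> ?T ` A" for y
    using relabel_image_eq_vimage[OF b, of A] by simp
  have image: "G' ` (?T ` A) = ?T ` (G ` A)"
    by (simp add: G'_def image_comp o_def inv)
  have "open (?T ` A)"
    unfolding relabel_image_eq_vimage[OF b]
    by (rule open_vimage[OF A(1) linear_continuous_on[OF bounded_linear_relabel]])
  then have "?T ` A \<in> sets lebesgue" by simp
  moreover have "(G' has_derivative (\<lambda>h. H' y *v h)) (at y within ?T ` A)" if y: "y \<in> ?T ` A" for y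
  proof (rule has_derivative_at_withinI)
    have "(G has_derivative (\<lambda>h. H (?S y) *v h)) (at (?S y))" using deriv S y by blast
    moreover have "(?S has_derivative ?S) (at y)" "(?T has_derivative ?T) (at (G (?S y)))"
      by (simp_all add: bounded_linear_imp_has_derivative bounded_linear_relabel)
    ultimately have "(G' has_derivative (\<lambda>h. ?T (H (?S y) *v ?S h))) (at y)"
      unfolding G'_def o_def
      using has_derivative_compose[of ?S ?S y UNIV G] has_derivative_compose[of "\<lambda>y. G (?S y)" _ y UNIV ?T ?T]
      by blast
    then show "(G' has_derivative (\<lambda>h. H' y *v h)) (at y)" by (simp add: vec)
  qed
  moreover have "inj_on G' (?T ` A)"
    using A(3) inv unfolding G'_def inj_on_def by (auto simp: inv) (metis inv(2))
  \<comment> \<open>The criterion is an equivalence. Measurability of the image is known beforehand,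
    from the Borel property and boundedness, and is what yields the integral.\<close>
  ultimately have iff: "G' ` (?T ` A) \<in> lmeasurable \<and> measure lebesgue (G' ` (?T ` A)) = m
     \<longleftrightarrow> ((\<lambda>y. \<bar>det (matrix (\<lambda>h. H' y *v h))\<bar>) has_integral m) (?T ` A)" for m
    by (rule has_measure_differentiable_image)
  have borel: "?T ` (G ` A) \<in> sets borel" and em: "emeasure lborel (?T ` (G ` A)) = emeasure lborel (G ` A)"
    using emeasure_relabel_image[OF b GA(1)] by auto
  have "bounded (?T ` (G ` A))"
    by (rule bounded_linear_image[OF GA(2) bounded_linear_relabel])
  then have "G' ` (?T ` A) \<in> lmeasurable"
    unfolding image by (rule bounded_set_imp_lmeasurable) (use borel in simp)
  moreover have "measure lebesgue (G' ` (?T ` A)) = measure lebesgue (G ` A)"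
    unfolding image using em borel GA(1) by (simp add: measure_def)
  ultimately have "((\<lambda>y. \<bar>det (H' y)\<bar>) has_integral measure lebesgue (G ` A)) (?T ` A)"
    using iff[of "measure lebesgue (G ` A)"] by simp
  from has_integral_relabel[OF b this A(2)] show ?thesis
    by (simp add: H'_def inv det_relabel[OF b])
qed

text \<open>Conjugated to the ordered copy, the inverse map stays orthogonal and preserves the
  measure of a box; renaming back gives the values of the distribution on boxes, which characterize
  \<open>lborel\<close>.\<close>

lemma lborel_distr_orthogonal:
  fixes f :: "real^'n \<Rightarrow> real^'n"
  assumes "orthogonal_transformation f"
  shows "distr lborel borel f = lborel"
proof (rule lborel_eqI[symmetric])
  let ?r = "Rep_ordered_copy :: 'n ordered_copy \<Rightarrow> 'n"
  let ?T = "relabel ?r" and ?S = "relabel (inv ?r)"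
  note b = bij_Rep_ordered_copy[where 'a='n]
  have bi: "bij (inv ?r)" using b by (rule bij_imp_bij_inv)
  note inv = relabel_inverse[OF b]
  fix l u :: "real^'n" assume le: "\<And>b. b \<in> Basis \<Longrightarrow> l \<bullet> b \<le> u \<bullet> b"
  define g where "g = inv f"
  have g: "orthogonal_transformation g" unfolding g_def by (rule orthogonal_transformation_inv[OF assms])
  have bf: "bij f" by (rule orthogonal_transformation_bij[OF assms])
  have fm: "f \<in> borel_measurable borel"
    using assms by (intro borel_measurable_continuous_onI linear_continuous_on)
      (simp add: orthogonal_transformation_linear linear_conv_bounded_linear[symmetric])
  define X where "X = f -` box l u"
  have Xg: "X = g ` box l u" unfolding X_def g_def using bf by (simp add: bij_vimage_eq_inv_image)
  have X: "X \<in> sets borel" unfolding X_def using measurable_sets[OF fm, of "box l u"] by simp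
  have "orthogonal_transformation (?T \<circ> g \<circ> ?S)"
    using g by (simp add: orthogonal_transformation_def relabel_inner[OF b] relabel_inner[OF bi]
        linear_compose linear_relabel)
  then have "measure lebesgue ((?T \<circ> g \<circ> ?S) ` (?T ` box l u)) = measure lebesgue (?T ` box l u)"
       and lm: "(?T \<circ> g \<circ> ?S) ` (?T ` box l u) \<in> lmeasurable"
    by (rule measure_orthogonal_image measurable_orthogonal_image; simp add: relabel_image_box[OF b])+
  moreover have "(?T \<circ> g \<circ> ?S) ` (?T ` box l u) = ?T ` X"
    by (simp add: Xg image_comp o_def inv)
  ultimately have "emeasure lebesgue (?T ` X) = emeasure lebesgue (?T ` box l u)"
    by (simp add: emeasure_eq_measure2 relabel_image_box[OF b] del: emeasure_completion)
  then have "emeasure lborel X = emeasure lborel (box l u)"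
    using emeasure_relabel_image[OF b X] emeasure_relabel_image[OF b, of "box l u"] by simp
  then show "emeasure (distr lborel borel f) (box l u) = (\<Prod>b\<in>Basis. (u - l) \<bullet> b)"
    using fm le by (simp add: emeasure_distr X_def)
qed simp

section \<open>Weak continuity of the Monge--Ampere measure\<close>

context open_convex_function
begin

text \<open>Upper semicontinuity: if \<open>p\<close> is a slope of \<open>v N\<close> in
  \<open>K\<close> for infinitely many \<open>N\<close>, then \<open>u\<close> has slope
  \<open>p\<close> at a limit of the corresponding base points.\<close>

lemma frequently_gradient_image_imp:
  assumes v: "\<And>N. convex_on \<Omega> (v N)"
    and unif: "\<And>C. compact C \<Longrightarrow> C \<subseteq> \<Omega> \<Longrightarrow> uniform_limit C v u sequentially"
    and K: "compact K" "K \<subseteq> \<Omega>"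
    and freq: "\<not> eventually (\<lambda>N. p \<notin> gradient_image \<Omega> (v N) K) sequentially"
  shows "p \<in> T K"
proof -
  obtain r :: "nat \<Rightarrow> nat" where r: "strict_mono r" "\<And>n. p \<in> gradient_image \<Omega> (v (r n)) K"
    using not_eventually_sequentiallyD[OF freq] by blast
  then have "\<forall>n. \<exists>x. x \<in> K \<and> p \<in> subdifferential \<Omega> (v (r n)) x"
    by (simp add: gradient_image_def Bex_def)
  from choice[OF this] obtain x
    where x: "\<And>n. x n \<in> K" "\<And>n. p \<in> subdifferential \<Omega> (v (r n)) (x n)" by blast
  obtain y s where y: "y \<in> K" "strict_mono s" "(x \<circ> s) \<longlonglongrightarrow> y"
    by (rule seq_compactE[OF compact_imp_seq_compact[OF K(1)], of x]) (use x(1) in blast)+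
  have yO: "y \<in> \<Omega>" using y K by blast
  have ux: "(\<lambda>n. u ((x \<circ> s) n)) \<longlonglongrightarrow> u y"
  proof (rule continuous_on_tendsto_compose[OF continuous_on y(3) yO])
    show "\<forall>\<^sub>F n in sequentially. (x \<circ> s) n \<in> \<Omega>"
      using x(1) K(2) by (intro always_eventually) auto
  qed
  have rs: "strict_mono (r \<circ> s)" using r(1) y(2) by (simp add: strict_mono_o)
  have pt: "(\<lambda>n. v (r (s n)) z) \<longlonglongrightarrow> u z" if "z \<in> \<Omega>" for z
  proof -
    have "(\<lambda>n. v n z) \<longlonglongrightarrow> u z"
      using unif[of "{z}"] that by (auto intro: tendsto_uniform_limitI)
    from LIMSEQ_subseq_LIMSEQ[OF this rs] show ?thesis by (simp add: o_def)
  qed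
  \<comment> \<open>Convergence along moving base points combines uniform convergence on
    \<open>K\<close> with continuity of \<open>u\<close>.\<close>
  have vx: "(\<lambda>n. v (r (s n)) (x (s n))) \<longlonglongrightarrow> u y"
  proof -
    have "(\<lambda>n. v (r (s n)) (x (s n)) - u (x (s n))) \<longlonglongrightarrow> 0"
    proof (rule LIMSEQ_I)
      fix e :: real assume "e > 0"
      then have "\<forall>\<^sub>F N in sequentially. \<forall>z\<in>K. dist (v N z) (u z) < e"
        using unif[OF K] by (auto simp: uniform_limit_iff)
      then obtain N0 where N0: "\<And>N z. N \<ge> N0 \<Longrightarrow> z \<in> K \<Longrightarrow> dist (v N z) (u z) < e"
        by (auto simp: eventually_sequentially)
      have "norm (v (r (s n)) (x (s n)) - u (x (s n)) - 0) < e" if "n \<ge> N0" for n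
      proof -
        have "N0 \<le> r (s n)" using seq_suble[OF rs, of n] that by simp
        from N0[OF this x(1)] show ?thesis by (simp add: dist_norm)
      qed
      then show "\<exists>no. \<forall>n\<ge>no. norm (v (r (s n)) (x (s n)) - u (x (s n)) - 0) < e" by blast
    qed
    from tendsto_add[OF this ux] show ?thesis by (simp add: o_def)
  qed
  have "p \<in> subdifferential \<Omega> u y"
    unfolding subdifferential_def
  proof clarify
    fix z assume z: "z \<in> \<Omega>"
    have "(\<lambda>n. v (r (s n)) (x (s n)) + p \<bullet> (z - (x \<circ> s) n)) \<longlonglongrightarrow> u y + p \<bullet> (z - y)"
      by (intro tendsto_intros vx y)
    moreover have "v (r (s n)) (x (s n)) + p \<bullet> (z - (x \<circ> s) n) \<le> v (r (s n)) z" for n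
      using subdifferentialD[OF x(2) z] by simp
    ultimately show "u y + p \<bullet> (z - y) \<le> u z"
      using pt[OF z] by (intro LIMSEQ_le) auto
  qed
  then show ?thesis using y(1) by (auto simp: gradient_image_def)
qed

text \<open>Lower semicontinuity. Off the overlap the affine function with slope \<open>p\<close>
  touches \<open>u\<close> only at \<open>x\<close>, which leaves a positive gap on a small sphere.
  For large \<open>N\<close> the minimum of \<open>v N z - p \<bullet> z\<close> over the closed
  ball is then attained inside, and a local minimum gives a subgradient.\<close>

lemma eventually_in_gradient_image:
  assumes v: "\<And>N. convex_on \<Omega> (v N)"
    and unif: "\<And>C. compact C \<Longrightarrow> C \<subseteq> \<Omega> \<Longrightarrow> uniform_limit C v u sequentially"
    and A: "open A" "A \<subseteq> \<Omega>"
    and p: "p \<in> T A" "p \<notin> gradient_overlap \<Omega> u"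
  shows "eventually (\<lambda>N. p \<in> gradient_image \<Omega> (v N) A) sequentially"
proof -
  obtain x where x: "x \<in> A" "p \<in> subdifferential \<Omega> u x" using p(1) by (auto simp: gradient_image_def)
  obtain \<delta> where d: "\<delta> > 0" "cball x \<delta> \<subseteq> A"
    using A(1) x(1) open_contains_cball_eq by blast
  have dO: "cball x \<delta> \<subseteq> \<Omega>" using d A by blast
  define g where "g z = u z - u x - p \<bullet> (z - x)" for z
  have gpos: "g z > 0" if z: "z \<in> \<Omega>" "z \<noteq> x" for z
  proof (rule ccontr)
    assume "\<not> g z > 0"
    then have eq: "u z = u x + p \<bullet> (z - x)"
      using subdifferentialD[OF x(2) z(1)] by (simp add: g_def)
    have "p \<in> subdifferential \<Omega> u z"
      unfolding subdifferential_def
    proof clarify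
      fix w assume "w \<in> \<Omega>"
      from subdifferentialD[OF x(2) this] show "u z + p \<bullet> (w - z) \<le> u w"
        by (simp add: eq inner_diff_right)
    qed
    then show False using p(2) x A z by (auto simp: gradient_overlap_def)
  qed
  have sph: "sphere x \<delta> \<subseteq> \<Omega>" using dO by auto
  have "continuous_on (sphere x \<delta>) g"
    unfolding g_def by (intro continuous_intros continuous_on_subset[OF continuous_on sph])
  moreover have "sphere x \<delta> \<noteq> {}" using d(1) by simp
  ultimately obtain z0 where z0: "z0 \<in> sphere x \<delta>" "\<And>z. z \<in> sphere x \<delta> \<Longrightarrow> g z0 \<le> g z"
    using continuous_attains_inf[of "sphere x \<delta>" g] by auto
  \<comment> \<open>Half of the gap: the values at \<open>y\<close> and at \<open>x\<close> may each
    be off by less than \<open>m\<close>.\<close>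
  define m where "m = g z0 / 2"
  have "m > 0" using gpos[of z0] z0(1) sph d(1) by (auto simp: m_def)
  then have "\<forall>\<^sub>F N in sequentially. \<forall>z\<in>cball x \<delta>. dist (v N z) (u z) < m"
    using unif[OF compact_cball dO] by (auto simp: uniform_limit_iff)
  then show ?thesis
  proof eventually_elim
    case (elim N)
    have "continuous_on (cball x \<delta>) (\<lambda>z. v N z - p \<bullet> z)"
      by (intro continuous_intros continuous_on_subset[OF convex_on_continuous[OF open_dom v] dO])
    then obtain y where y: "y \<in> cball x \<delta>" "\<And>z. z \<in> cball x \<delta> \<Longrightarrow> v N y - p \<bullet> y \<le> v N z - p \<bullet> z"
      using continuous_attains_inf[of "cball x \<delta>" "\<lambda>z. v N z - p \<bullet> z"] d(1) by auto
    have "y \<notin> sphere x \<delta>"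
    proof
      assume ys: "y \<in> sphere x \<delta>"
      have "2 * m \<le> g y" using z0(2)[OF ys] by (simp add: m_def)
      moreover have "\<bar>v N y - u y\<bar> < m" "\<bar>v N x - u x\<bar> < m"
        using elim y(1) d(1) by (auto simp: dist_norm)
      moreover have "v N y - p \<bullet> y \<le> v N x - p \<bullet> x" using y(2)[of x] d(1) by simp
      ultimately show False by (simp add: g_def inner_diff_right)
    qed
    then have yb: "dist x y < \<delta>" using y(1) by auto
    have "p \<in> subdifferential \<Omega> (v N) y"
    proof (rule subdifferential_local[OF v])
      show "y \<in> \<Omega>" using y(1) dO by blast
      show "0 < \<delta> - dist x y" using yb by simp
      fix z assume "z \<in> \<Omega>" "dist y z < \<delta> - dist x y"
      then have "z \<in> cball x \<delta>" using dist_triangle[of x z y] by simp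
      from y(2)[OF this] show "v N y + p \<bullet> (z - y) \<le> v N z" by (simp add: inner_diff_right)
    qed
    then show ?case using y(1) d(2) by (auto simp: gradient_image_def)
  qed
qed

text \<open>Provides the ball whose indicator dominates in \<open>monge_ampere_convergence\<close>;
  a uniform bound for \<open>v N\<close> near \<open>K\<close> is inherited from
  \<open>u\<close>.\<close>

lemma eventually_gradient_image_bounded:
  assumes unif: "\<And>C. compact C \<Longrightarrow> C \<subseteq> \<Omega> \<Longrightarrow> uniform_limit C v u sequentially"
    and K: "compact K" "K \<subseteq> \<Omega>"
  obtains B where "eventually (\<lambda>N. gradient_image \<Omega> (v N) K \<subseteq> cball 0 B) sequentially"
proof -
  obtain \<delta> where d: "\<delta> > 0" "compact (\<Union>x\<in>K. cball x \<delta>)" "(\<Union>x\<in>K. cball x \<delta>) \<subseteq> \<Omega>"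
    using compact_cball_neighbourhood[OF K open_dom] by blast
  have "compact (u ` (\<Union>x\<in>K. cball x \<delta>))"
    using compact_continuous_image[OF continuous_on_subset[OF continuous_on d(3)] d(2)] .
  then have "bounded (u ` (\<Union>x\<in>K. cball x \<delta>))" by (rule compact_imp_bounded)
  then obtain M where M: "\<And>z. z \<in> (\<Union>x\<in>K. cball x \<delta>) \<Longrightarrow> \<bar>u z\<bar> \<le> M"
    unfolding bounded_iff by force
  have "\<forall>\<^sub>F N in sequentially. \<forall>z\<in>(\<Union>x\<in>K. cball x \<delta>). dist (v N z) (u z) < 1"
    using uniform_limitD[OF unif[OF d(2,3)], of 1] by simp
  then have "eventually (\<lambda>N. gradient_image \<Omega> (v N) K \<subseteq> cball 0 (2 * (M + 1) / \<delta>)) sequentially"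
  proof eventually_elim
    case (elim N)
    show ?case
    proof
      fix p assume "p \<in> gradient_image \<Omega> (v N) K"
      then obtain x where x: "x \<in> K" "p \<in> subdifferential \<Omega> (v N) x" by (auto simp: gradient_image_def)
      have "norm p \<le> 2 * (M + 1) / \<delta>"
      proof (rule subdifferential_norm_bound[OF x(2) d(1)])
        show "cball x \<delta> \<subseteq> \<Omega>" using d(3) x(1) by blast
        fix z assume "z \<in> cball x \<delta>"
        then have z: "z \<in> (\<Union>x\<in>K. cball x \<delta>)" using x(1) by blast
        then have "dist (v N z) (u z) < 1" using elim by blast
        then show "\<bar>v N z\<bar> \<le> M + 1" using M[OF z] by (simp add: dist_norm)
      qed
      then show "p \<in> cball 0 (2 * (M + 1) / \<delta>)" by simp
    qed
  qed
  then show thesis by (rule that)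
qed

text \<open>The indicators of the slope sets converge off \<open>Bad\<close>: lower semicontinuity
  covers \<open>T A\<close>, upper semicontinuity the complement of \<open>T (closure A)\<close>,
  and what remains lies in the null set \<open>T (frontier A)\<close>. Dominated convergence
  finishes.\<close>

lemma monge_ampere_convergence:
  assumes v: "\<And>N. convex_on \<Omega> (v N)"
    and unif: "\<And>C. compact C \<Longrightarrow> C \<subseteq> \<Omega> \<Longrightarrow> uniform_limit C v u sequentially"
    and A: "open A" "compact (closure A)" "closure A \<subseteq> \<Omega>"
    and null: "emeasure ma_measure (frontier A) = 0"
  shows "(\<lambda>N. enn2real (monge_ampere \<Omega> (v N) A)) \<longlonglongrightarrow> enn2real (monge_ampere \<Omega> u A)"
proof -
  let ?L = "lebesgue :: 'a measure"
  let ?TN = "\<lambda>N. gradient_image \<Omega> (v N) A"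
  have AO: "A \<subseteq> \<Omega>" using A(3) closure_subset by blast
  have frO: "frontier A \<subseteq> \<Omega>" using A(3) by (auto simp: frontier_def)
  obtain B where B: "eventually (\<lambda>N. gradient_image \<Omega> (v N) (closure A) \<subseteq> cball 0 B) sequentially"
    using eventually_gradient_image_bounded[OF unif A(2,3)] by blast
  have mono: "gradient_image \<Omega> w A \<subseteq> gradient_image \<Omega> w (closure A)" for w
    using closure_subset by (auto simp: gradient_image_def)
  have meas: "?TN N \<in> sets ?L" for N
  proof -
    interpret w: open_convex_function \<Omega> "v N" by unfold_locales (use open_dom v in auto)
    show ?thesis using w.gradient_image_open_borel[OF A(1) AO] by simp
  qed
  have measT: "T A \<in> sets ?L" using gradient_image_open_borel[OF A(1) AO] by simp
  define Bad where "Bad = gradient_overlap \<Omega> u \<union> T (frontier A)"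
  have "T (frontier A) \<in> null_sets ?L"
  proof (rule null_setsI)
    have "monge_ampere \<Omega> u (frontier A) = 0"
      using monge_ampere_eq[of "frontier A"] null frO by simp
    then show "emeasure ?L (T (frontier A)) = 0" by (simp add: monge_ampere_def gradient_image_def)
    show "T (frontier A) \<in> sets ?L"
      using gradient_image_measurable[of "frontier A"] frO by (simp add: Int_absorb2)
  qed
  then have bad: "AE p in ?L. p \<notin> Bad"
    using null_gradient_overlap unfolding Bad_def by (intro AE_not_in null_sets.Un)
  obtain N0 where N0: "\<And>N. N \<ge> N0 \<Longrightarrow> ?TN N \<subseteq> cball 0 B"
    using B mono unfolding eventually_sequentially by (meson order_trans)
  \<comment> \<open>The shift by \<open>N0\<close> makes the bound valid for all indices, as
    dominated convergence requires.\<close>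
  let ?f = "\<lambda>N p. indicator (?TN (N + N0)) p :: real"
  have lim: "(\<lambda>N. ?f N p) \<longlonglongrightarrow> indicator (T A) p" if "p \<notin> Bad" for p
  proof (cases "p \<in> T A")
    case True
    have "eventually (\<lambda>N. p \<in> ?TN N) sequentially"
      using eventually_in_gradient_image[OF v unif A(1) AO True] that by (simp add: Bad_def)
    then have "eventually (\<lambda>N. p \<in> ?TN (N + N0)) sequentially"
      using eventually_sequentially_seg[of "\<lambda>N. p \<in> ?TN N" N0] by blast
    then show ?thesis using True
      by (intro tendsto_eventually) (auto elim: eventually_mono)
  next
    case False
    have "p \<notin> T (closure A)"
      using False that A(1) by (auto simp: Bad_def gradient_image_def closure_Un_frontier)
    then have "eventually (\<lambda>N. p \<notin> gradient_image \<Omega> (v N) (closure A)) sequentially"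
      using frequently_gradient_image_imp[OF v unif A(2,3)] by blast
    then have "eventually (\<lambda>N. p \<notin> ?TN N) sequentially"
      using mono by (auto elim!: eventually_mono)
    then have "eventually (\<lambda>N. p \<notin> ?TN (N + N0)) sequentially"
      using eventually_sequentially_seg[of "\<lambda>N. p \<notin> ?TN N" N0] by blast
    then show ?thesis using False
      by (intro tendsto_eventually) (auto elim: eventually_mono)
  qed
  have "(\<lambda>N. integral\<^sup>L ?L (?f N)) \<longlonglongrightarrow> integral\<^sup>L ?L (indicator (T A))"
  proof (rule integral_dominated_convergence[where w = "indicator (cball 0 B)"])
    show "integrable ?L (indicator (cball 0 B) :: 'a \<Rightarrow> real)"
      using lmeasurable_cball[of "0::'a" B] by (simp add: fmeasurable_def del: emeasure_completion)
    show "AE p in ?L. (\<lambda>N. ?f N p) \<longlonglongrightarrow> indicator (T A) p"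
      by (rule AE_mp[OF bad AE_I2]) (use lim in blast)
    show "AE p in ?L. norm (?f N p) \<le> indicator (cball 0 B) p" for N
      using N0[of "N + N0"] by (intro AE_I2) (auto simp: indicator_def)
  qed (use meas measT in auto)
  then have "(\<lambda>N. measure ?L (?TN (N + N0))) \<longlonglongrightarrow> measure ?L (T A)"
    using meas measT by simp
  then have "(\<lambda>N. measure ?L (?TN N)) \<longlonglongrightarrow> measure ?L (T A)"
    by (rule LIMSEQ_offset)
  then show ?thesis by (simp add: measure_def monge_ampere_def gradient_image_def)
qed

end

section \<open>Approximation by regular convex functions\<close>

text \<open>Gradient and Hessian are carried along as data. The last clause makes the gradient
  injective, and \<open>gram\<close> makes its Jacobian determinant non-negative; both enter the
  change of variables.\<close>

definition regular_convex ::
    "(real^'n \<Rightarrow> real) \<Rightarrow> (real^'n \<Rightarrow> real^'n) \<Rightarrow> (real^'n \<Rightarrow> real^'n^'n) \<Rightarrow> bool" where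
  "regular_convex f G H \<longleftrightarrow>
     (\<forall>x z. f x + G x \<bullet> (z - x) \<le> f z) \<and>
     (\<forall>x. (G has_derivative (\<lambda>h. H x *v h)) (at x)) \<and>
     (\<forall>x. gram (H x)) \<and>
     (\<forall>x y. x \<noteq> y \<longrightarrow> 0 < (G x - G y) \<bullet> (x - y))"

lemma subdifferential_eq_gradient:
  assumes sub: "\<And>x z. f x + G x \<bullet> (z - x) \<le> f z"
    and G: "isCont G x" and \<Omega>: "open \<Omega>" "x \<in> \<Omega>"
  shows "subdifferential \<Omega> f x = {G x}"
proof
  show "{G x} \<subseteq> subdifferential \<Omega> f x"
    using sub by (auto simp: subdifferential_def)
  show "subdifferential \<Omega> f x \<subseteq> {G x}"
  proof
    fix p assume p: "p \<in> subdifferential \<Omega> f x"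
    \<comment> \<open>In this direction monotonicity bounds \<open>p \<bullet> h\<close> by the
      value of \<open>G\<close> at \<open>x\<close> plus \<open>t\<close> times \<open>h\<close>,
      paired with \<open>h\<close>; letting \<open>t\<close> tend to 0 leaves
      \<open>h \<bullet> h \<le> 0\<close>.\<close>
    define h where "h = p - G x"
    have tend: "((\<lambda>t. x + t *\<^sub>R h) \<longlongrightarrow> x) (at_right 0)"
      by (auto intro!: tendsto_eq_intros)
    have "eventually (\<lambda>t. x + t *\<^sub>R h \<in> \<Omega>) (at_right (0::real))"
      using topological_tendstoD[OF tend \<Omega>] .
    moreover have "eventually (\<lambda>t. t > 0) (at_right (0::real))"
      by (rule eventually_at_right_less)
    ultimately have "eventually (\<lambda>t. p \<bullet> h \<le> G (x + t *\<^sub>R h) \<bullet> h) (at_right (0::real))"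
    proof eventually_elim
      case (elim t)
      have "f x + p \<bullet> (t *\<^sub>R h) \<le> f (x + t *\<^sub>R h)"
        using subdifferentialD[OF p elim(1)] by simp
      moreover have "f (x + t *\<^sub>R h) + G (x + t *\<^sub>R h) \<bullet> (- (t *\<^sub>R h)) \<le> f x"
        using sub[of "x + t *\<^sub>R h" x] by simp
      ultimately have "t * (p \<bullet> h) \<le> t * (G (x + t *\<^sub>R h) \<bullet> h)" by simp
      then show ?case using elim(2) by simp
    qed
    moreover have "((\<lambda>t. G (x + t *\<^sub>R h) \<bullet> h) \<longlongrightarrow> G x \<bullet> h) (at_right 0)"
      by (intro tendsto_intros isCont_tendsto_compose[OF G tend])
    ultimately have "p \<bullet> h \<le> G x \<bullet> h"
      by (intro tendsto_lowerbound) auto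
    then have "h \<bullet> h \<le> 0" by (simp add: h_def inner_diff_left)
    then have "h = 0" by (metis antisym inner_eq_zero_iff inner_ge_zero)
    then show "p \<in> {G x}" by (simp add: h_def)
  qed
qed

lemma regular_convex_isCont:
  assumes "regular_convex f G H"
  shows "isCont G x"
  using assms unfolding regular_convex_def by (blast intro: has_derivative_continuous)

lemma regular_convex_convex_on:
  assumes "regular_convex f G H" "convex \<Omega>"
  shows "convex_on \<Omega> f"
proof (rule convex_on_if_subdifferential_nonempty[OF assms(2)])
  fix x have "G x \<in> subdifferential \<Omega> f x" using assms(1) by (auto simp: subdifferential_def regular_convex_def)
  then show "subdifferential \<Omega> f x \<noteq> {}" by blast
qed

lemma matrix_sum_mult_vec: "(\<Sum>i\<in>I. A i) *v x = (\<Sum>i\<in>I. A i *v (x :: real^'n))"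
  by (induction I rule: infinite_finite_induct) (simp_all add: matrix_vector_mult_add_rdistrib)

text \<open>One positive coefficient is demanded because the zero combination does not inherit
  strict monotonicity of the gradient.\<close>

lemma regular_convex_combination:
  fixes f :: "nat \<Rightarrow> real^'n \<Rightarrow> real"
  assumes reg: "\<And>i. i < m \<Longrightarrow> regular_convex (f i) (G i) (H i)"
    and c: "\<And>i. i < m \<Longrightarrow> 0 \<le> c i" and ex: "i0 < m" "0 < c i0"
  shows "regular_convex (\<lambda>x. \<Sum>i<m. c i * f i x) (\<lambda>x. \<Sum>i<m. c i *\<^sub>R G i x) (\<lambda>x. \<Sum>i<m. c i *\<^sub>R H i x)"
  unfolding regular_convex_def
proof (intro conjI allI impI)
  fix x z
  have "(\<Sum>i<m. c i * (f i x + G i x \<bullet> (z - x))) \<le> (\<Sum>i<m. c i * f i z)"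
    using reg c by (intro sum_mono mult_left_mono) (auto simp: regular_convex_def)
  then show "(\<Sum>i<m. c i * f i x) + (\<Sum>i<m. c i *\<^sub>R G i x) \<bullet> (z - x) \<le> (\<Sum>i<m. c i * f i z)"
    by (simp add: inner_sum_left distrib_left sum.distrib)
next
  fix x
  have "((\<lambda>x. \<Sum>i<m. c i *\<^sub>R G i x) has_derivative (\<lambda>h. \<Sum>i<m. c i *\<^sub>R (H i x *v h))) (at x)"
    using reg by (intro has_derivative_sum has_derivative_scaleR_right) (auto simp: regular_convex_def)
  moreover have "(\<Sum>i<m. c i *\<^sub>R (H i x *v h)) = (\<Sum>i<m. c i *\<^sub>R H i x) *v h" for h
    by (simp add: matrix_sum_mult_vec scaleR_matrix_vector_assoc)
  ultimately show "((\<lambda>x. \<Sum>i<m. c i *\<^sub>R G i x) has_derivative (\<lambda>h. (\<Sum>i<m. c i *\<^sub>R H i x) *v h)) (at x)"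
    by simp
  show "gram (\<Sum>i<m. c i *\<^sub>R H i x)"
    using reg c by (intro gram_sum gram_scale) (auto simp: regular_convex_def)
next
  fix x y :: "real^'n" assume xy: "x \<noteq> y"
  have ge: "0 \<le> (G i x - G i y) \<bullet> (x - y)" if "i < m" for i
    using reg[OF that] xy by (auto simp: regular_convex_def less_imp_le)
  have "0 < (\<Sum>i<m. c i * ((G i x - G i y) \<bullet> (x - y)))"
  proof (rule sum_pos2[of _ i0])
    show "0 < c i0 * ((G i0 x - G i0 y) \<bullet> (x - y))"
      using reg[OF ex(1)] xy ex by (auto simp: regular_convex_def)
  qed (use ge c ex in auto)
  also have "\<dots> = ((\<Sum>i<m. c i *\<^sub>R G i x) - (\<Sum>i<m. c i *\<^sub>R G i y)) \<bullet> (x - y)"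
    by (simp add: inner_sum_left inner_diff_left right_diff_distrib sum_subtractf)
  finally show "0 < ((\<Sum>i<m. c i *\<^sub>R G i x) - (\<Sum>i<m. c i *\<^sub>R G i y)) \<bullet> (x - y)" .
qed

lemma regular_convex_has_integral:
  fixes f :: "real^'n \<Rightarrow> real"
  assumes reg: "regular_convex f G H" and \<Omega>: "open \<Omega>" "convex \<Omega>"
    and A: "open A" "bounded A" "A \<subseteq> \<Omega>"
  shows "((\<lambda>x. det (H x)) has_integral enn2real (monge_ampere \<Omega> f A)) A"
proof -
  interpret open_convex_function \<Omega> f
    by unfold_locales (use \<Omega> regular_convex_convex_on[OF reg] in auto)
  have "subdifferential \<Omega> f x = {G x}" if "x \<in> A" for x
    using subdifferential_eq_gradient[OF _ regular_convex_isCont[OF reg] \<Omega>(1)] reg that A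
    by (auto simp: regular_convex_def)
  then have T: "(\<Union>x\<in>A. subdifferential \<Omega> f x) = G ` A" by auto
  have "inj_on G A"
  proof (rule inj_onI, rule ccontr)
    fix x y assume "G x = G y" "x \<noteq> y"
    moreover have "0 < (G x - G y) \<bullet> (x - y)"
      using reg \<open>x \<noteq> y\<close> unfolding regular_convex_def by blast
    ultimately show False by simp
  qed
  moreover have "G ` A \<in> sets borel"
    using gradient_image_open_borel[OF A(1,3)] T by (simp add: gradient_image_def)
  moreover have "bounded (G ` A)"
  proof -
    have "compact (G ` closure A)"
      using A(2) regular_convex_isCont[OF reg]
      by (intro compact_continuous_image continuous_at_imp_continuous_on) (auto simp: compact_closure)
    then show ?thesis
      using compact_imp_bounded bounded_subset closure_subset by (metis image_mono)
  qed
  moreover have "(G has_derivative (\<lambda>h. H x *v h)) (at x)" for x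
    using reg by (auto simp: regular_convex_def)
  ultimately have "((\<lambda>x. \<bar>det (H x)\<bar>) has_integral measure lebesgue (G ` A)) A"
    using has_integral_det_derivative[OF A(1,2)] by blast
  moreover have "\<bar>det (H x)\<bar> = det (H x)" for x
    using gram_det_nonneg[of "H x"] reg by (auto simp: regular_convex_def)
  ultimately show ?thesis
    by (simp add: monge_ampere_def T measure_def)
qed

lemma combination_has_integral:
  fixes f :: "nat \<Rightarrow> real^'n \<Rightarrow> real"
  assumes reg: "\<And>i. i < m \<Longrightarrow> regular_convex (f i) (G i) (H i)"
    and c: "\<And>i. i < m \<Longrightarrow> 0 \<le> c i"
    and \<Omega>: "open \<Omega>" "convex \<Omega>" and A: "open A" "bounded A" "A \<subseteq> \<Omega>"
  shows "((\<lambda>x. det (\<Sum>i<m. c i *\<^sub>R H i x)) has_integral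
    enn2real (monge_ampere \<Omega> (\<lambda>x. \<Sum>i<m. c i * f i x) A)) A"
proof (cases "\<exists>i<m. 0 < c i")
  case True
  then obtain i0 where "i0 < m" "0 < c i0" by blast
  then have "regular_convex (\<lambda>x. \<Sum>i<m. c i * f i x) (\<lambda>x. \<Sum>i<m. c i *\<^sub>R G i x) (\<lambda>x. \<Sum>i<m. c i *\<^sub>R H i x)"
    using regular_convex_combination[where f=f and G=G and H=H and c=c and m=m] reg c by blast
  from regular_convex_has_integral[OF this \<Omega> A] show ?thesis .
next
  \<comment> \<open>The zero function has a gradient that is not injective, but its measure and the
    determinant both vanish.\<close>
  case False
  then have c0: "c i = 0" if "i < m" for i using c[OF that] that by force
  have "subdifferential \<Omega> (\<lambda>_. 0) x = {0}" if "x \<in> A" for x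
    using subdifferential_eq_gradient[of "\<lambda>_. 0" "\<lambda>_. 0" x \<Omega>] \<Omega> A that by auto
  then have "(\<Union>x\<in>A. subdifferential \<Omega> (\<lambda>_. 0) x) \<subseteq> {0}" by auto
  then have "(\<Union>x\<in>A. subdifferential \<Omega> (\<lambda>_. 0) x) \<in> null_sets lebesgue"
    using null_sets_completion_subset[of _ "{0}" lborel] by (simp add: null_sets_def)
  then have "monge_ampere \<Omega> (\<lambda>_. 0) A = 0" by (simp add: monge_ampere_def null_sets_def)
  moreover have "det (0 :: real^'n^'n) = 0" by (simp add: det_def zero_vec_def prod_zero_iff power_0_left)
  ultimately show ?thesis using c0 by simp
qed

section \<open>Log-sum-exp regularization\<close>

lemma outer_mult_vec: "(\<chi> i j. v $ i * v $ j) *v h = (v \<bullet> h) *\<^sub>R (v :: real^'n)"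
  by (simp add: vec_eq_iff matrix_vector_mult_def inner_vec_def sum_distrib_left mult_ac)

lemma gram_mat_1: "gram (mat 1 :: real^'n^'n)"
proof -
  have "(mat 1 :: real^'n^'n) = (\<Sum>k\<in>UNIV. \<chi> i j. axis k (1::real) $ i * axis k 1 $ j)"
    by (simp add: vec_eq_iff mat_def axis_def if_distrib[of "\<lambda>x. x * _"] cong: if_cong)
  moreover have "gram (\<Sum>k\<in>(UNIV :: 'n set). \<chi> i j. axis k (1::real) $ i * axis k 1 $ j)"
    by (intro gram_sum gram_outer)
  ultimately show ?thesis by simp
qed

text \<open>\<open>w\<close> are the softmax weights, \<open>m\<close> is the weighted mean of the
  slopes \<open>a k\<close>, and \<open>H\<close> is \<open>\<beta>\<close> times their weighted
  covariance matrix plus \<open>\<epsilon>\<close> times the identity. The covariance form exhibits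
  \<open>H\<close> as a sum of rank-one matrices.\<close>

lemma regular_convex_log_sum_exp:
  fixes a :: "'b \<Rightarrow> real^'n" and b :: "'b \<Rightarrow> real"
  assumes Y: "finite Y" "Y \<noteq> {}" and \<beta>: "\<beta> > 0" and \<epsilon>: "\<epsilon> > 0"
  shows "\<exists>G H. regular_convex (\<lambda>x. ln (\<Sum>k\<in>Y. exp (\<beta> * (a k \<bullet> x + b k))) / \<beta> + \<epsilon> / 2 * (x \<bullet> x)) G H"
proof -
  define e where "e k x = exp (\<beta> * (a k \<bullet> x + b k))" for k x
  define Z where "Z x = (\<Sum>k\<in>Y. e k x)" for x
  define w where "w k x = e k x / Z x" for k x
  define m where "m x = (\<Sum>k\<in>Y. w k x *\<^sub>R a k)" for x
  have epos: "e k x > 0" for k x by (simp add: e_def)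
  have Zpos: "Z x > 0" for x unfolding Z_def using Y epos by (intro sum_pos) auto
  have wpos: "w k x \<ge> 0" for k x using epos Zpos by (simp add: w_def less_imp_le)
  have wsum: "(\<Sum>k\<in>Y. w k x) = 1" for x
    using Zpos[of x] by (simp add: w_def Z_def flip: sum_divide_distrib)
  define G where "G x = m x + \<epsilon> *\<^sub>R x" for x
  define H where "H x = (\<Sum>k\<in>Y. (\<beta> * w k x) *\<^sub>R (\<chi> i j. (a k - m x) $ i * (a k - m x) $ j)) + \<epsilon> *\<^sub>R mat 1" for x
  have lse: "ln (Z x) / \<beta> + m x \<bullet> (z - x) \<le> ln (Z z) / \<beta>" for x z
  proof -
    define s where "s k = \<beta> * (a k \<bullet> (z - x))" for k
    define t where "t = (\<Sum>k\<in>Y. w k x * s k)"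
    have ez: "e k z = e k x * exp (s k)" for k
      by (simp add: e_def s_def inner_diff_right algebra_simps flip: exp_add)
    \<comment> \<open>Jensen's inequality for the exponential function: \<open>exp (s k)\<close> is
      bounded below by the tangent at the mean \<open>t\<close>, whose linear part averages to
      0.\<close>
    have "exp t = (\<Sum>k\<in>Y. w k x * (exp t * (1 + (s k - t))))"
    proof -
      have "(\<Sum>k\<in>Y. w k x * (exp t * (1 + (s k - t)))) =
          exp t * ((\<Sum>k\<in>Y. w k x) + (\<Sum>k\<in>Y. w k x * s k) - (\<Sum>k\<in>Y. w k x) * t)"
        by (simp add: algebra_simps sum.distrib sum_subtractf sum_distrib_left sum_distrib_right)
      then show ?thesis by (simp add: wsum flip: t_def)
    qed
    also have "\<dots> \<le> (\<Sum>k\<in>Y. w k x * exp (s k))"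
    proof (intro sum_mono mult_left_mono wpos)
      fix k
      have "exp t * (1 + (s k - t)) \<le> exp t * exp (s k - t)"
        by (intro mult_left_mono exp_ge_add_one_self) simp
      then show "exp t * (1 + (s k - t)) \<le> exp (s k)" by (simp flip: exp_add)
    qed
    also have "\<dots> = Z z / Z x"
      by (simp add: w_def Z_def[of z] ez flip: sum_divide_distrib)
    finally have "t \<le> ln (Z z / Z x)"
      using Zpos by (subst ln_ge_iff) auto
    then have "t \<le> ln (Z z) - ln (Z x)" using Zpos[of x] Zpos[of z] by (simp add: ln_div)
    moreover have "t = \<beta> * (m x \<bullet> (z - x))"
      by (simp add: t_def m_def s_def inner_sum_left sum_distrib_left mult_ac)
    ultimately have "\<beta> * (m x \<bullet> (z - x)) \<le> ln (Z z) - ln (Z x)" by simp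
    then have "m x \<bullet> (z - x) \<le> (ln (Z z) - ln (Z x)) / \<beta>"
      using \<beta> by (simp add: pos_le_divide_eq mult.commute)
    then show ?thesis by (simp add: diff_divide_distrib)
  qed
  have "regular_convex (\<lambda>x. ln (Z x) / \<beta> + \<epsilon> / 2 * (x \<bullet> x)) G H"
    unfolding regular_convex_def
  proof (intro conjI allI impI)
    fix x z :: "real^'n"
    have "0 \<le> (z - x) \<bullet> (z - x)" by simp
    then have "x \<bullet> x + 2 * (x \<bullet> (z - x)) \<le> z \<bullet> z"
      by (simp add: inner_diff_left inner_diff_right inner_commute)
    then have "\<epsilon> / 2 * (x \<bullet> x + 2 * (x \<bullet> (z - x))) \<le> \<epsilon> / 2 * (z \<bullet> z)"
      using \<epsilon> by (intro mult_left_mono) auto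
    then show "ln (Z x) / \<beta> + \<epsilon> / 2 * (x \<bullet> x) + G x \<bullet> (z - x) \<le> ln (Z z) / \<beta> + \<epsilon> / 2 * (z \<bullet> z)"
      using lse[of x z] by (simp add: G_def inner_add_left algebra_simps)
  next
    fix x :: "real^'n"
    have de: "(e k has_derivative (\<lambda>h. e k x * (\<beta> * (a k \<bullet> h)))) (at x)" for k
      unfolding e_def[abs_def] by (auto intro!: derivative_eq_intros)
    have dZ: "(Z has_derivative (\<lambda>h. \<Sum>k\<in>Y. e k x * (\<beta> * (a k \<bullet> h)))) (at x)"
      unfolding Z_def[abs_def] by (intro has_derivative_sum de)
    have dw: "(w k has_derivative (\<lambda>h. \<beta> * w k x * ((a k - m x) \<bullet> h))) (at x)" for k
    proof -
      have "(w k has_derivative (\<lambda>h. (e k x * (\<beta> * (a k \<bullet> h)) * Z x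
          - e k x * (\<Sum>k\<in>Y. e k x * (\<beta> * (a k \<bullet> h)))) / (Z x * Z x))) (at x)"
        unfolding w_def[abs_def] using Zpos[of x] by (intro has_derivative_divide' de dZ) auto
      moreover have "(e k x * (\<beta> * (a k \<bullet> h)) * Z x - e k x * (\<Sum>k\<in>Y. e k x * (\<beta> * (a k \<bullet> h)))) / (Z x * Z x)
          = \<beta> * w k x * ((a k - m x) \<bullet> h)" for h
      proof -
        have "(\<Sum>k\<in>Y. e k x * (\<beta> * (a k \<bullet> h))) = \<beta> * Z x * (m x \<bullet> h)"
          using Zpos[of x] by (simp add: m_def w_def inner_sum_left sum_distrib_left mult_ac)
        then show ?thesis
          using Zpos[of x] by (simp add: w_def inner_diff_left field_simps)
      qed
      ultimately show ?thesis by simp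
    qed
    have "(G has_derivative (\<lambda>h. (\<Sum>k\<in>Y. (\<beta> * w k x * ((a k - m x) \<bullet> h)) *\<^sub>R a k) + \<epsilon> *\<^sub>R h)) (at x)"
      unfolding G_def[abs_def] m_def[abs_def]
      by (intro has_derivative_add has_derivative_sum has_derivative_scaleR_left
          has_derivative_scaleR_right has_derivative_ident dw[unfolded m_def])
    \<comment> \<open>The derivatives of the weights sum to 0, so \<open>a k\<close> may be replaced
      by the centred \<open>a k - m x\<close>, which produces the symmetric form.\<close>
    moreover have "(\<Sum>k\<in>Y. (\<beta> * w k x * ((a k - m x) \<bullet> h)) *\<^sub>R a k) + \<epsilon> *\<^sub>R h = H x *v h" for h
    proof -
      have "(\<Sum>k\<in>Y. w k x * ((a k - m x) \<bullet> h)) = (\<Sum>k\<in>Y. w k x * (a k \<bullet> h)) - (\<Sum>k\<in>Y. w k x) * (m x \<bullet> h)"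
        by (simp add: inner_diff_left right_diff_distrib sum_subtractf sum_distrib_right)
      also have "\<dots> = 0" unfolding wsum by (simp add: m_def inner_sum_left)
      finally have "(\<Sum>k\<in>Y. (\<beta> * w k x * ((a k - m x) \<bullet> h)) *\<^sub>R m x) = 0"
        by (simp add: mult.assoc flip: scaleR_left.sum sum_distrib_left)
      moreover have "H x *v h = (\<Sum>k\<in>Y. (\<beta> * w k x * ((a k - m x) \<bullet> h)) *\<^sub>R (a k - m x)) + \<epsilon> *\<^sub>R h"
        unfolding H_def
        by (simp only: matrix_vector_mult_add_rdistrib matrix_sum_mult_vec
            scaleR_matrix_vector_assoc[symmetric] outer_mult_vec matrix_vector_mul_lid scaleR_scaleR)
      ultimately show ?thesis
        by (simp add: scaleR_diff_right sum_subtractf)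
    qed
    ultimately show "(G has_derivative (\<lambda>h. H x *v h)) (at x)" by simp
    show "gram (H x)"
      unfolding H_def using wpos \<beta> \<epsilon>
      by (intro gram_add gram_sum gram_scale gram_outer gram_mat_1) auto
  next
    fix x y :: "real^'n" assume "x \<noteq> y"
    then have "0 < \<epsilon> * ((x - y) \<bullet> (x - y))" using \<epsilon> by simp
    moreover have "0 \<le> (m x - m y) \<bullet> (x - y)"
      using lse[of x y] lse[of y x] by (simp add: inner_diff_left inner_diff_right)
    ultimately show "0 < (G x - G y) \<bullet> (x - y)"
      by (simp add: G_def inner_diff_left inner_diff_right inner_add_left algebra_simps)
  qed
  then show ?thesis unfolding Z_def e_def by blast
qed

text \<open>The sum of exponentials lies between any one of its terms and \<open>card Y\<close>
  times an upper bound of the terms.\<close>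

lemma log_sum_exp_bounds:
  fixes l :: "'b \<Rightarrow> real"
  assumes "finite Y" "\<beta> > 0" "k0 \<in> Y" "\<And>k. k \<in> Y \<Longrightarrow> l k \<le> M"
  shows "l k0 \<le> ln (\<Sum>k\<in>Y. exp (\<beta> * l k)) / \<beta>" "ln (\<Sum>k\<in>Y. exp (\<beta> * l k)) / \<beta> \<le> M + ln (card Y) / \<beta>"
proof -
  have pos: "0 < (\<Sum>k\<in>Y. exp (\<beta> * l k))" using assms by (intro sum_pos) auto
  have "exp (\<beta> * l k0) \<le> (\<Sum>k\<in>Y. exp (\<beta> * l k))"
    using assms by (intro member_le_sum) auto
  then have "\<beta> * l k0 \<le> ln (\<Sum>k\<in>Y. exp (\<beta> * l k))" using pos by (simp add: ln_ge_iff)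
  then show "l k0 \<le> ln (\<Sum>k\<in>Y. exp (\<beta> * l k)) / \<beta>" using assms(2) by (simp add: field_simps)
  have "(\<Sum>k\<in>Y. exp (\<beta> * l k)) \<le> (\<Sum>k\<in>Y. exp (\<beta> * M))"
    using assms by (intro sum_mono) auto
  then have "(\<Sum>k\<in>Y. exp (\<beta> * l k)) \<le> card Y * exp (\<beta> * M)" by simp
  moreover have cpos: "0 < real (card Y)" using assms by (auto simp: card_gt_0_iff)
  ultimately have "ln (\<Sum>k\<in>Y. exp (\<beta> * l k)) \<le> ln (card Y * exp (\<beta> * M))"
    using pos by simp
  also have "\<dots> = ln (card Y) + \<beta> * M" using cpos by (simp add: ln_mult)
  finally show "ln (\<Sum>k\<in>Y. exp (\<beta> * l k)) / \<beta> \<le> M + ln (card Y) / \<beta>"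
    using assms(2) by (simp add: field_simps)
qed

text \<open>By compactness, finitely many supporting affine functions come within
  \<open>d / 4\<close> of \<open>u\<close> on \<open>C\<close>. Smoothing their maximum and adding
  the quadratic term cost at most another \<open>d / 4\<close> each.\<close>

lemma regular_convex_approximation:
  fixes u :: "real^'n \<Rightarrow> real"
  assumes \<Omega>: "open \<Omega>" and u: "convex_on \<Omega> u" and C: "compact C" "C \<subseteq> \<Omega>" and d: "d > 0"
  shows "\<exists>f G H. regular_convex f G H \<and> (\<forall>x\<in>C. \<bar>f x - u x\<bar> < d)"
proof -
  have cont: "continuous_on \<Omega> u" by (rule convex_on_continuous[OF \<Omega> u])
  have "\<forall>y. \<exists>p. y \<in> \<Omega> \<longrightarrow> p \<in> subdifferential \<Omega> u y"
    using subdifferential_nonempty[OF \<Omega> u] by blast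
  from choice[OF this] obtain p where p: "\<And>y. y \<in> \<Omega> \<Longrightarrow> p y \<in> subdifferential \<Omega> u y" by blast
  define l where "l y x = p y \<bullet> x + (u y - p y \<bullet> y)" for y x
  have le: "l y x \<le> u x" if "y \<in> \<Omega>" "x \<in> \<Omega>" for x y
    using subdifferentialD[OF p[OF that(1)] that(2)] by (simp add: l_def inner_diff_right)
  define U where "U y = {x \<in> \<Omega>. u x - l y x < d / 4}" for y
  have "open (U y)" for y
  proof -
    have "continuous_on \<Omega> (\<lambda>x. u x - l y x)"
      unfolding l_def by (intro continuous_intros cont)
    from continuous_open_preimage[OF this \<Omega>, of "{..<d/4}"] show ?thesis
      by (simp add: U_def vimage_def Int_def Collect_conj_eq[symmetric])
  qed
  moreover have "C \<subseteq> (\<Union>y\<in>C. U y)"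
    using C d by (auto simp: U_def l_def)
  ultimately obtain Y0 where Y0: "Y0 \<subseteq> C" "finite Y0" "C \<subseteq> (\<Union>y\<in>Y0. U y)"
    using compactE_image[OF C(1), of C U] by metis
  show ?thesis
  proof (cases "Y0 = {}")
    case True
    then have "C = {}" using Y0 by auto
    moreover obtain G H where "regular_convex (\<lambda>x. ln (\<Sum>k\<in>{0::nat}. exp (1 * ((0::real^'n) \<bullet> x + 0))) / 1 + 1 / 2 * (x \<bullet> x)) G H"
      using regular_convex_log_sum_exp[of "{0::nat}" 1 1 "\<lambda>_. 0" "\<lambda>_. 0"] by auto
    ultimately show ?thesis by blast
  next
    case False
    obtain B where B: "\<And>x. x \<in> C \<Longrightarrow> norm x \<le> B" "B > 0"
      using compact_imp_bounded[OF C(1)] unfolding bounded_pos by blast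
    \<comment> \<open>The \<open>1\<close> keeps \<open>\<beta>\<close> positive when there is only
      one affine function; the smoothing error \<open>ln (card Y0) / \<beta>\<close> is at most
      \<open>d / 4\<close>.\<close>
    define \<beta> where "\<beta> = 4 * (ln (card Y0) + 1) / d"
    have lnpos: "0 \<le> ln (real (card Y0))" using False Y0(2) by (simp add: Suc_leI card_gt_0_iff)
    have \<beta>: "\<beta> > 0" using lnpos d by (simp add: \<beta>_def)
    have lb: "ln (card Y0) / \<beta> \<le> d / 4"
    proof -
      have "ln (card Y0) \<le> d / 4 * \<beta>" using d by (simp add: \<beta>_def)
      then show ?thesis using \<beta> by (simp add: pos_divide_le_eq)
    qed
    \<comment> \<open>Chosen so that \<open>\<epsilon> / 2 * B\<^sup>2 = d / 4\<close>.\<close>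
    define \<epsilon> where "\<epsilon> = d / (2 * B\<^sup>2)"
    have \<epsilon>: "\<epsilon> > 0" using d B by (simp add: \<epsilon>_def)
    define f where "f x = ln (\<Sum>k\<in>Y0. exp (\<beta> * (p k \<bullet> x + (u k - p k \<bullet> k)))) / \<beta> + \<epsilon> / 2 * (x \<bullet> x)" for x
    have "\<exists>G H. regular_convex f G H"
      unfolding f_def using regular_convex_log_sum_exp[OF Y0(2) False \<beta> \<epsilon>, of p "\<lambda>k. u k - p k \<bullet> k"] .
    moreover have "\<bar>f x - u x\<bar> < d" if x: "x \<in> C" for x
    proof -
      obtain k0 where k0: "k0 \<in> Y0" "x \<in> U k0" using Y0(3) x by blast
      have lx: "l k x \<le> u x" if "k \<in> Y0" for k using le that Y0(1) C(2) x by blast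
      have "l k0 x \<le> ln (\<Sum>k\<in>Y0. exp (\<beta> * l k x)) / \<beta>"
        "ln (\<Sum>k\<in>Y0. exp (\<beta> * l k x)) / \<beta> \<le> u x + ln (card Y0) / \<beta>"
        using log_sum_exp_bounds[of Y0 \<beta> k0 "\<lambda>k. l k x" "u x"] Y0(2) \<beta> k0(1) lx by auto
      moreover have "u x - l k0 x < d / 4" using k0(2) by (simp add: U_def)
      moreover have "0 \<le> \<epsilon> / 2 * (x \<bullet> x)" using \<epsilon> by simp
      moreover have "\<epsilon> / 2 * (x \<bullet> x) \<le> d / 4"
      proof -
        have "x \<bullet> x \<le> B\<^sup>2"
          using B(1)[OF x] by (simp add: power_mono flip: power2_norm_eq_inner)
        then have "\<epsilon> / 2 * (x \<bullet> x) \<le> \<epsilon> / 2 * B\<^sup>2" using \<epsilon> by (intro mult_left_mono) auto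
        also have "\<dots> = d / 4" using B(2) by (simp add: \<epsilon>_def)
        finally show ?thesis .
      qed
      moreover have "f x = ln (\<Sum>k\<in>Y0. exp (\<beta> * l k x)) / \<beta> + \<epsilon> / 2 * (x \<bullet> x)"
        by (simp add: f_def l_def)
      ultimately show ?thesis using lb d by linarith
    qed
    ultimately show ?thesis by blast
  qed
qed

section \<open>Linear inequalities between Monge--Ampere measures\<close>

text \<open>Only finitely many of the disjoint level sets can have mass above
  \<open>1 / Suc n\<close>, since the total mass is finite.\<close>

lemma countable_nonnull_levels:
  fixes f :: "'a \<Rightarrow> real"
  assumes "finite_measure M" and f: "f \<in> borel_measurable M"
  shows "countable {r. emeasure M {x \<in> space M. f x = r} \<noteq> 0}"
proof -
  interpret finite_measure M by fact
  let ?S = "\<lambda>r. {x \<in> space M. f x = r}"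
  have meas: "?S r \<in> sets M" for r using f by measurable
  define E where "E n = {r. measure M (?S r) > 1 / real (Suc n)}" for n
  have fin: "finite (E n)" for n
  proof (rule ccontr)
    assume inf: "infinite (E n)"
    obtain k :: nat where k: "measure M (space M) * real (Suc n) < real k" using reals_Archimedean2 by blast
    obtain F where F: "F \<subseteq> E n" "finite F" "card F = k"
      using infinite_arbitrarily_large[OF inf] by metis
    have "real k * (1 / real (Suc n)) = (\<Sum>r\<in>F. 1 / real (Suc n))" using F by simp
    also have "\<dots> \<le> (\<Sum>r\<in>F. measure M (?S r))"
      using F(1) by (intro sum_mono) (auto simp: E_def less_imp_le)
    also have "\<dots> = measure M (\<Union>r\<in>F. ?S r)"
      using F(2) meas by (intro finite_measure_finite_Union[symmetric]) (auto simp: disjoint_family_on_def)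
    also have "\<dots> \<le> measure M (space M)" by (rule bounded_measure)
    finally show False using k by (simp add: field_simps)
  qed
  have sub: "{r. emeasure M (?S r) \<noteq> 0} \<subseteq> (\<Union>n. E n)"
  proof
    fix r assume "r \<in> {r. emeasure M (?S r) \<noteq> 0}"
    then have "measure M (?S r) > 0"
      by (simp add: emeasure_eq_measure zero_less_measure_iff)
    then obtain n where "1 / real (Suc n) < measure M (?S r)"
      using nat_approx_posE by (metis of_nat_Suc)
    then show "r \<in> (\<Union>n. E n)" by (auto simp: E_def)
  qed
  have "countable (\<Union>n. E n)"
    by (rule countable_UN[OF countableI_type countable_finite[OF fin]])
  from countable_subset[OF sub this] show ?thesis .
qed

lemma exists_null_level:
  fixes f :: "'a \<Rightarrow> real"
  assumes "finite L" and M: "\<And>l. l \<in> L \<Longrightarrow> finite_measure (M l)" "\<And>l. l \<in> L \<Longrightarrow> f \<in> borel_measurable (M l)"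
    and "a < b"
  shows "\<exists>r. a < r \<and> r < b \<and> (\<forall>l\<in>L. emeasure (M l) {x \<in> space (M l). f x = r} = 0)"
proof (rule ccontr)
  assume "\<not> ?thesis"
  then have "{a<..<b} \<subseteq> (\<Union>l\<in>L. {r. emeasure (M l) {x \<in> space (M l). f x = r} \<noteq> 0})" by auto
  moreover have "countable (\<Union>l\<in>L. {r. emeasure (M l) {x \<in> space (M l). f x = r} \<noteq> 0})"
    by (rule countable_UN[OF countable_finite[OF \<open>finite L\<close>]]) (rule countable_nonnull_levels[OF M])
  ultimately show False
    using uncountable_open_interval[of a b] \<open>a < b\<close> countable_subset by blast
qed

text \<open>A compact set is approached by the neighbourhoods \<open>infdist x K < r\<close> for
  radii whose level sets are null for every measure involved; inner regularity then reaches Borel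
  sets. As the weights may have both signs, each approximation has to work for all measures
  simultaneously.\<close>

lemma signed_measure_nonneg:
  fixes M :: "'l \<Rightarrow> 'a::euclidean_space measure" and w :: "'l \<Rightarrow> real"
  assumes L: "finite L" and M: "\<And>l. l \<in> L \<Longrightarrow> finite_measure (M l)" "\<And>l. l \<in> L \<Longrightarrow> sets (M l) = sets borel"
    and U: "open U"
    and good: "\<And>A. open A \<Longrightarrow> compact (closure A) \<Longrightarrow> closure A \<subseteq> U \<Longrightarrow>
      (\<And>l. l \<in> L \<Longrightarrow> emeasure (M l) (frontier A) = 0) \<Longrightarrow> 0 \<le> (\<Sum>l\<in>L. w l * measure (M l) A)"
    and B: "B \<in> sets borel" "B \<subseteq> U"
  shows "0 \<le> (\<Sum>l\<in>L. w l * measure (M l) B)"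
proof -
  have compact_case: "0 \<le> (\<Sum>l\<in>L. w l * measure (M l) K)" if K: "compact K" "K \<subseteq> U" for K
  proof (cases "K = {}")
    case True then show ?thesis by simp
  next
    case False
    obtain \<delta> where d: "\<delta> > 0" "compact (\<Union>x\<in>K. cball x \<delta>)" "(\<Union>x\<in>K. cball x \<delta>) \<subseteq> U"
      using compact_cball_neighbourhood[OF K U] by blast
    let ?f = "\<lambda>x. infdist x K"
    have cont: "continuous_on UNIV ?f" by (intro continuous_intros)
    have near: "x \<in> (\<Union>x\<in>K. cball x \<delta>)" if x: "?f x \<le> \<delta>" for x
    proof -
      obtain y where "y \<in> K" "infdist x K = dist x y"
        using infdist_attains_inf[OF compact_imp_closed[OF K(1)] False] by blast
      then show ?thesis using x by (auto simp: dist_commute)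
    qed
    have "\<exists>r. 0 < r \<and> r < \<delta> / real (Suc n) \<and> (\<forall>l\<in>L. emeasure (M l) {x \<in> space (M l). ?f x = r} = 0)" for n
    proof (rule exists_null_level[OF L M(1)])
      show "?f \<in> borel_measurable (M l)" if "l \<in> L" for l
        using borel_measurable_continuous_onI[OF cont] measurable_cong_sets[OF M(2)[OF that] refl] by blast
    qed (use d in auto)
    then obtain r where r: "\<And>n. 0 < r n" "\<And>n. r n < \<delta> / real (Suc n)"
      "\<And>n l. l \<in> L \<Longrightarrow> emeasure (M l) {x \<in> space (M l). ?f x = r n} = 0"
      by metis
    define A where "A n = {x. ?f x < r n}" for n
    define D where "D n = {x. ?f x < \<delta> / real (Suc n)}" for n
    have oA: "open (A n)" and oD: "open (D n)" for n
      unfolding A_def D_def by (auto intro!: open_Collect_less cont continuous_on_const)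
    have nonneg: "0 \<le> (\<Sum>l\<in>L. w l * measure (M l) (A n))" for n
    proof (rule good[OF oA])
      have "closed {x. ?f x \<le> r n}" by (auto intro!: closed_Collect_le cont continuous_on_const)
      then have cl: "closure (A n) \<subseteq> {x. ?f x \<le> r n}"
        by (intro closure_minimal) (auto simp: A_def)
      have "r n \<le> \<delta>"
      proof -
        have "\<delta> / real (Suc n) \<le> \<delta> / 1" using d(1) by (intro divide_left_mono) auto
        then show ?thesis using r(2)[of n] by simp
      qed
      then have sub: "closure (A n) \<subseteq> (\<Union>x\<in>K. cball x \<delta>)" using near cl by fastforce
      then show "closure (A n) \<subseteq> U" using d(3) by blast
      have "closure (A n) = (\<Union>x\<in>K. cball x \<delta>) \<inter> closure (A n)" using sub by blast
      then show "compact (closure (A n))"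
        using compact_Int_closed[OF d(2) closed_closure[of "A n"]] by simp
      show "emeasure (M l) (frontier (A n)) = 0" if l: "l \<in> L" for l
      proof -
        have sp: "space (M l) = UNIV" using sets_eq_imp_space_eq[OF M(2)[OF l]] by simp
        have "frontier (A n) \<subseteq> {x \<in> space (M l). ?f x = r n}"
          using cl oA[of n] by (auto simp: frontier_def interior_open sp A_def)
        moreover have "{x \<in> space (M l). ?f x = r n} \<in> sets (M l)"
          unfolding M(2)[OF l] sp using closed_Collect_eq[OF cont continuous_on_const] by simp
        ultimately show ?thesis using r(3)[OF l, of n] emeasure_mono by (metis le_zero_eq)
      qed
    qed
    have lim: "(\<lambda>n. measure (M l) (A n)) \<longlonglongrightarrow> measure (M l) K" if l: "l \<in> L" for l
    proof -
      interpret finite_measure "M l" by (rule M(1)[OF l])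
      have sp: "space (M l) = UNIV" using sets_eq_imp_space_eq[OF M(2)[OF l]] by simp
      have Dm: "D n \<in> sets (M l)" and Am: "A n \<in> sets (M l)" and Km: "K \<in> sets (M l)" for n
        using oA oD K(1) M(2)[OF l] by (auto simp: borel_compact)
      have K0: "?f x = 0 \<longleftrightarrow> x \<in> K" for x
        using in_closed_iff_infdist_zero[OF compact_imp_closed[OF K(1)] False] by blast
      have "decseq D"
      proof (rule decseq_SucI)
        fix n
        have "\<delta> / real (Suc (Suc n)) \<le> \<delta> / real (Suc n)" using d(1) by (intro divide_left_mono) auto
        then show "D (Suc n) \<subseteq> D n" by (auto simp: D_def)
      qed
      moreover have "(\<Inter>n. D n) = K"
      proof
        show "K \<subseteq> (\<Inter>n. D n)" using K0 d(1) by (auto simp: D_def)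
        show "(\<Inter>n. D n) \<subseteq> K"
        proof
          fix x assume x: "x \<in> (\<Inter>n. D n)"
          have "(\<lambda>n. \<delta> / real (Suc n)) \<longlonglongrightarrow> 0"
            using LIMSEQ_Suc[OF lim_const_over_n[of \<delta>]] by simp
          then have "?f x \<le> 0"
            by (rule LIMSEQ_le_const) (use x in \<open>auto simp: D_def less_imp_le\<close>)
          then show "x \<in> K" using K0 infdist_nonneg[of x K] by (simp add: antisym)
        qed
      qed
      ultimately have lD: "(\<lambda>n. measure (M l) (D n)) \<longlonglongrightarrow> measure (M l) K"
        using finite_Lim_measure_decseq[of D] Dm by auto
      \<comment> \<open>The sets \<open>A n\<close> need not decrease, hence the comparison with the
        decreasing sets \<open>D n\<close>.\<close>
      have sandwich: "measure (M l) K \<le> measure (M l) (A n)" "measure (M l) (A n) \<le> measure (M l) (D n)" for n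
        using K0 r(1,2)[of n] Am Dm by (auto intro!: finite_measure_mono simp: A_def D_def)
      show ?thesis
        by (rule tendsto_sandwich[OF _ _ tendsto_const lD]) (use sandwich in \<open>auto intro!: always_eventually\<close>)
    qed
    have "(\<lambda>n. \<Sum>l\<in>L. w l * measure (M l) (A n)) \<longlonglongrightarrow> (\<Sum>l\<in>L. w l * measure (M l) K)"
      by (intro tendsto_sum tendsto_mult_left lim)
    then show ?thesis
      by (rule LIMSEQ_le_const) (use nonneg in auto)
  qed
  show ?thesis
  proof (rule field_le_epsilon)
    fix e :: real assume e: "e > 0"
    \<comment> \<open>Bounds the total error caused by an error \<open>e / W\<close> in each
      measure; the \<open>1\<close> keeps \<open>W\<close> positive when all weights vanish.\<close>
    define W where "W = (\<Sum>l\<in>L. \<bar>w l\<bar>) + 1"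
    have W: "W > 0" unfolding W_def by (intro add_nonneg_pos sum_nonneg) auto
    have "\<exists>K. compact K \<and> K \<subseteq> B \<and> measure (M l) B \<le> measure (M l) K + e / W" if l: "l \<in> L" for l
    proof -
      interpret finite_measure "M l" by (rule M(1)[OF l])
      have SUP: "emeasure (M l) B = (SUP K\<in>{K. K \<subseteq> B \<and> compact K}. emeasure (M l) K)"
        using inner_regular[of "M l" B] M(2)[OF l] B(1) emeasure_finite by simp
      show ?thesis
      proof (cases "measure (M l) B \<le> e / W")
        case True
        then show ?thesis by (intro exI[of _ "{}"]) auto
      next
        case False
        then have "ennreal (measure (M l) B - e / W) < emeasure (M l) B"
          using e W by (simp add: emeasure_eq_measure ennreal_less_iff)
        then obtain K where K: "K \<subseteq> B" "compact K" "ennreal (measure (M l) B - e / W) < emeasure (M l) K"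
          unfolding SUP less_SUP_iff by blast
        then have "measure (M l) B - e / W < measure (M l) K"
          using False by (simp add: emeasure_eq_measure ennreal_less_iff)
        with K show ?thesis by (intro exI[of _ K]) auto
      qed
    qed
    then obtain K where K: "\<And>l. l \<in> L \<Longrightarrow> compact (K l)" "\<And>l. l \<in> L \<Longrightarrow> K l \<subseteq> B"
      "\<And>l. l \<in> L \<Longrightarrow> measure (M l) B \<le> measure (M l) (K l) + e / W" by metis
    \<comment> \<open>The union is an inner approximation for all measures at once.\<close>
    define KK where "KK = (\<Union>l\<in>L. K l)"
    have KK: "compact KK" "KK \<subseteq> B" using L K by (auto simp: KK_def)
    have bound: "w l * (measure (M l) KK - measure (M l) B) \<le> \<bar>w l\<bar> * (e / W)" if l: "l \<in> L" for l
    proof -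
      interpret finite_measure "M l" by (rule M(1)[OF l])
      have "measure (M l) (K l) \<le> measure (M l) KK"
        using l KK(1) M(2)[OF l] by (intro finite_measure_mono) (auto simp: KK_def borel_compact)
      moreover have "measure (M l) KK \<le> measure (M l) B"
        using KK B(1) M(2)[OF l] by (intro finite_measure_mono) auto
      ultimately have "\<bar>measure (M l) KK - measure (M l) B\<bar> \<le> e / W" using K(3)[OF l] by linarith
      then have "\<bar>w l\<bar> * \<bar>measure (M l) KK - measure (M l) B\<bar> \<le> \<bar>w l\<bar> * (e / W)"
        by (intro mult_left_mono) auto
      then show ?thesis
        using abs_ge_self[of "w l * (measure (M l) KK - measure (M l) B)"] unfolding abs_mult by linarith
    qed
    have "0 \<le> (\<Sum>l\<in>L. w l * measure (M l) KK)"
      using compact_case[OF KK(1)] KK(2) B(2) by blast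
    also have "\<dots> = (\<Sum>l\<in>L. w l * measure (M l) B) + (\<Sum>l\<in>L. w l * (measure (M l) KK - measure (M l) B))"
      by (simp add: algebra_simps sum.distrib sum_subtractf)
    also have "(\<Sum>l\<in>L. w l * (measure (M l) KK - measure (M l) B)) \<le> (\<Sum>l\<in>L. \<bar>w l\<bar> * (e / W))"
      by (intro sum_mono bound)
    also have "\<dots> = (W - 1) * (e / W)" by (simp add: W_def sum_distrib_right sum_divide_distrib)
    also have "\<dots> \<le> e" using W e by (simp add: field_simps)
    finally show "0 \<le> (\<Sum>l\<in>L. w l * measure (M l) B) + e" by simp
  qed
qed

section \<open>From determinants to Monge-Ampere measures\<close>

definition lincomb :: "nat \<Rightarrow> (nat \<Rightarrow> real) \<Rightarrow> (nat \<Rightarrow> 'a \<Rightarrow> real) \<Rightarrow> 'a \<Rightarrow> real" where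
  "lincomb m c u = (\<lambda>x. \<Sum>i<m. c i * u i x)"

lemma convex_on_lincomb:
  assumes "convex \<Omega>" "\<And>i. i < m \<Longrightarrow> convex_on \<Omega> (u i)" "\<And>i. i < m \<Longrightarrow> 0 \<le> c i"
  shows "convex_on \<Omega> (lincomb m c u)"
  unfolding lincomb_def using assms(2,3)
proof (induction m)
  case 0 then show ?case using assms(1) by (simp add: convex_on_def)
next
  case (Suc m)
  then show ?case by (auto intro!: convex_on_add convex_on_cmul)
qed

lemma uniform_limit_lincomb:
  assumes "\<And>i. i < m \<Longrightarrow> uniform_limit S (\<lambda>N. f N i) (u i) X"
  shows "uniform_limit S (\<lambda>N. lincomb m c (f N)) (lincomb m c u) X"
  unfolding lincomb_def using assms
proof (induction m)
  case 0 then show ?case by (simp add: uniform_limit_const)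
next
  case (Suc m)
  then have "uniform_limit S (\<lambda>N x. \<Sum>i<m. c i * f N i x) (\<lambda>x. \<Sum>i<m. c i * u i x) X" by simp
  moreover have "uniform_limit S (\<lambda>N x. c m * f N m x) (\<lambda>x. c m * u m x) X"
    using Suc.prems[of m] by (intro bounded_linear.uniform_limit[OF bounded_linear_mult_right]) simp
  ultimately show ?case unfolding sum.lessThan_Suc by (rule uniform_limit_add)
qed

text \<open>The \<open>N\<close>-th function is within \<open>1 / Suc N\<close> of
  \<open>u i\<close> on the \<open>N\<close>-th set of a compact exhaustion, and these sets
  eventually contain any given compact set.\<close>

lemma regular_convex_sequence:
  fixes u :: "nat \<Rightarrow> real^'n \<Rightarrow> real"
  assumes \<Omega>: "open \<Omega>" and u: "\<And>i. i < m \<Longrightarrow> convex_on \<Omega> (u i)"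
  shows "\<exists>F G H. (\<forall>N. \<forall>i<m. regular_convex (F N i) (G N i) (H N i)) \<and>
    (\<forall>C. \<forall>i<m. compact C \<longrightarrow> C \<subseteq> \<Omega> \<longrightarrow> uniform_limit C (\<lambda>N. F N i) (u i) sequentially)"
proof -
  obtain C :: "nat \<Rightarrow> (real^'n) set" where C: "\<And>n. compact (C n)" "\<And>n. C n \<subseteq> \<Omega>"
    "\<And>K. compact K \<Longrightarrow> K \<subseteq> \<Omega> \<Longrightarrow> \<exists>N. \<forall>n\<ge>N. K \<subseteq> C n"
    using open_Union_compact_subsets[OF \<Omega>] by metis
  have "\<forall>q. \<exists>t. snd q < m \<longrightarrow> regular_convex (fst t) (fst (snd t)) (snd (snd t)) \<and>
      (\<forall>x\<in>C (fst q). \<bar>fst t x - u (snd q) x\<bar> < 1 / real (Suc (fst q)))"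
  proof
    fix q :: "nat \<times> nat"
    show "\<exists>t. snd q < m \<longrightarrow> regular_convex (fst t) (fst (snd t)) (snd (snd t)) \<and>
      (\<forall>x\<in>C (fst q). \<bar>fst t x - u (snd q) x\<bar> < 1 / real (Suc (fst q)))"
    proof (cases "snd q < m")
      case True
      obtain f G H where "regular_convex f G H" "\<forall>x\<in>C (fst q). \<bar>f x - u (snd q) x\<bar> < 1 / real (Suc (fst q))"
        using regular_convex_approximation[OF \<Omega> u[OF True] C(1,2), of "1 / real (Suc (fst q))"]
        by (metis of_nat_0_less_iff zero_less_Suc zero_less_divide_1_iff)
      then show ?thesis by (intro exI[of _ "(f, G, H)"]) simp
    qed simp
  qed
  from choice[OF this] obtain t where t: "\<And>N i. i < m \<Longrightarrow> regular_convex (fst (t (N, i))) (fst (snd (t (N, i)))) (snd (snd (t (N, i))))"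
    "\<And>N i x. i < m \<Longrightarrow> x \<in> C N \<Longrightarrow> \<bar>fst (t (N, i)) x - u i x\<bar> < 1 / real (Suc N)" by force
  show ?thesis
  proof (rule exI[of _ "\<lambda>N i. fst (t (N, i))"], rule exI[of _ "\<lambda>N i. fst (snd (t (N, i)))"],
      rule exI[of _ "\<lambda>N i. snd (snd (t (N, i)))"], intro conjI allI impI)
    fix K i assume i: "i < m" and K: "compact K" "K \<subseteq> \<Omega>"
    obtain N0 where N0: "\<And>N. N \<ge> N0 \<Longrightarrow> K \<subseteq> C N" using C(3)[OF K] by blast
    show "uniform_limit K (\<lambda>N. fst (t (N, i))) (u i) sequentially"
    proof (rule uniform_limitI)
      fix e :: real assume "e > 0"
      then obtain N1 where N1: "1 / real (Suc N1) < e" using nat_approx_posE by (metis of_nat_Suc)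
      have "\<forall>x\<in>K. dist (fst (t (N, i)) x) (u i x) < e" if "N \<ge> max N0 N1" for N
      proof
        fix x assume "x \<in> K"
        then have "\<bar>fst (t (N, i)) x - u i x\<bar> < 1 / real (Suc N)" using t(2)[OF i] N0 that by fastforce
        also have "\<dots> \<le> 1 / real (Suc N1)" using that by (intro divide_left_mono) auto
        finally show "dist (fst (t (N, i)) x) (u i x) < e" using N1 by (simp add: dist_norm)
      qed
      then show "\<forall>\<^sub>F N in sequentially. \<forall>x\<in>K. dist (fst (t (N, i)) x) (u i x) < e"
        unfolding eventually_sequentially by blast
    qed
  qed (use t(1) in auto)
qed

text \<open>For regular functions the determinant inequality at the Hessians is integrated over
  \<open>A\<close>; weak continuity carries the result to \<open>u\<close>, because
  \<open>frontier A\<close> is null for each combination.\<close>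

lemma monge_ampere_linear_inequality_open:
  fixes u :: "nat \<Rightarrow> real^'n \<Rightarrow> real" and c :: "'l \<Rightarrow> nat \<Rightarrow> real"
  assumes \<Omega>: "open \<Omega>" "convex \<Omega>" and u: "\<And>i. i < m \<Longrightarrow> convex_on \<Omega> (u i)"
    and L: "finite L" and c: "\<And>l i. l \<in> L \<Longrightarrow> i < m \<Longrightarrow> 0 \<le> c l i"
    and det: "\<And>H :: nat \<Rightarrow> real^'n^'n. (\<And>i. i < m \<Longrightarrow> gram (H i)) \<Longrightarrow>
      0 \<le> (\<Sum>l\<in>L. w l * det (\<Sum>i<m. c l i *\<^sub>R H i))"
    and A: "open A" "compact (closure A)" "closure A \<subseteq> \<Omega>"
    and null: "\<And>l. l \<in> L \<Longrightarrow> monge_ampere \<Omega> (lincomb m (c l) u) (frontier A) = 0"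
  shows "0 \<le> (\<Sum>l\<in>L. w l * enn2real (monge_ampere \<Omega> (lincomb m (c l) u) A))"
proof -
  have "\<exists>F G H. (\<forall>N. \<forall>i<m. regular_convex (F N i) (G N i) (H N i)) \<and>
      (\<forall>C. \<forall>i<m. compact C \<longrightarrow> C \<subseteq> \<Omega> \<longrightarrow> uniform_limit C (\<lambda>N. F N i) (u i) sequentially)"
    by (rule regular_convex_sequence[OF \<Omega>(1)]) (rule u)
  then obtain F G H
    where FGH: "\<forall>N. \<forall>i<m. regular_convex (F N i) (G N i) (H N i)"
      "\<forall>C. \<forall>i<m. compact C \<longrightarrow> C \<subseteq> \<Omega> \<longrightarrow> uniform_limit C (\<lambda>N. F N i) (u i) sequentially"
    by (elim exE conjE)
  have reg: "regular_convex (F N i) (G N i) (H N i)" if "i < m" for N i using FGH(1) that by simp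
  have unif: "uniform_limit C (\<lambda>N. F N i) (u i) sequentially" if "i < m" "compact C" "C \<subseteq> \<Omega>" for C i
    using FGH(2) that by simp
  have AO: "A \<subseteq> \<Omega>" "bounded A"
    using A(3) closure_subset[of A] bounded_subset[OF compact_imp_bounded[OF A(2)] closure_subset] by auto
  have pos: "0 \<le> (\<Sum>l\<in>L. w l * enn2real (monge_ampere \<Omega> (lincomb m (c l) (F N)) A))" for N
  proof -
    have "((\<lambda>x. \<Sum>l\<in>L. w l * det (\<Sum>i<m. c l i *\<^sub>R H N i x)) has_integral
        (\<Sum>l\<in>L. w l * enn2real (monge_ampere \<Omega> (lincomb m (c l) (F N)) A))) A"
    proof (rule has_integral_sum[OF L], rule has_integral_mult_right)
      fix l assume l: "l \<in> L"
      show "((\<lambda>x. det (\<Sum>i<m. c l i *\<^sub>R H N i x)) has_integral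
          enn2real (monge_ampere \<Omega> (lincomb m (c l) (F N)) A)) A"
        unfolding lincomb_def
      proof (rule combination_has_integral[where G = "G N"])
        show "regular_convex (F N i) (G N i) (H N i)" if "i < m" for i using reg that .
        show "0 \<le> c l i" if "i < m" for i using c l that .
        show "open \<Omega>" "convex \<Omega>" "open A" "bounded A" "A \<subseteq> \<Omega>" using \<Omega> A(1) AO by auto
      qed
    qed
    then show ?thesis
    proof (rule has_integral_nonneg)
      fix x show "0 \<le> (\<Sum>l\<in>L. w l * det (\<Sum>i<m. c l i *\<^sub>R H N i x))"
        by (rule det) (use reg in \<open>auto simp: regular_convex_def\<close>)
    qed
  qed
  have "(\<lambda>N. enn2real (monge_ampere \<Omega> (lincomb m (c l) (F N)) A))
      \<longlonglongrightarrow> enn2real (monge_ampere \<Omega> (lincomb m (c l) u) A)" if l: "l \<in> L" for l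
  proof -
    interpret open_convex_function \<Omega> "lincomb m (c l) u"
      by unfold_locales (use \<Omega> u c l in \<open>auto intro!: convex_on_lincomb\<close>)
    show ?thesis
    proof (rule monge_ampere_convergence[OF _ _ A])
      show "convex_on \<Omega> (lincomb m (c l) (F N))" for N
      proof (rule convex_on_lincomb[OF \<Omega>(2)])
        show "convex_on \<Omega> (F N i)" if "i < m" for i
          by (rule regular_convex_convex_on[OF reg[OF that] \<Omega>(2)])
      qed (use c[OF l] in auto)
      show "uniform_limit C (\<lambda>N. lincomb m (c l) (F N)) (lincomb m (c l) u) sequentially"
        if C: "compact C" "C \<subseteq> \<Omega>" for C
        using unif[OF _ C] by (rule uniform_limit_lincomb)
      show "emeasure ma_measure (frontier A) = 0"
        using monge_ampere_eq[of "frontier A"] null[OF l] A(3) by (simp add: frontier_def) blast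
    qed
  qed
  then have "(\<lambda>N. \<Sum>l\<in>L. w l * enn2real (monge_ampere \<Omega> (lincomb m (c l) (F N)) A))
      \<longlonglongrightarrow> (\<Sum>l\<in>L. w l * enn2real (monge_ampere \<Omega> (lincomb m (c l) u) A))"
    by (intro tendsto_sum tendsto_mult_left)
  then show ?thesis by (rule LIMSEQ_le_const) (use pos in auto)
qed

theorem monge_ampere_linear_inequality:
  fixes u :: "nat \<Rightarrow> real^'n \<Rightarrow> real" and c :: "'l \<Rightarrow> nat \<Rightarrow> real"
  assumes \<Omega>: "open \<Omega>" "convex \<Omega>" and u: "\<And>i. i < m \<Longrightarrow> convex_on \<Omega> (u i)"
    and L: "finite L" and c: "\<And>l i. l \<in> L \<Longrightarrow> i < m \<Longrightarrow> 0 \<le> c l i"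
    and det: "\<And>H :: nat \<Rightarrow> real^'n^'n. (\<And>i. i < m \<Longrightarrow> gram (H i)) \<Longrightarrow>
      0 \<le> (\<Sum>l\<in>L. w l * det (\<Sum>i<m. c l i *\<^sub>R H i))"
    and B: "B \<in> sets borel" "B \<subseteq> K" "compact K" "K \<subseteq> \<Omega>"
  shows "0 \<le> (\<Sum>l\<in>L. w l * enn2real (monge_ampere \<Omega> (lincomb m (c l) u) B))"
proof -
  obtain \<delta> where d: "\<delta> > 0" "compact (\<Union>x\<in>K. cball x \<delta>)" "(\<Union>x\<in>K. cball x \<delta>) \<subseteq> \<Omega>"
    using compact_cball_neighbourhood[OF B(3,4) \<Omega>(1)] by blast
  define K' where "K' = (\<Union>x\<in>K. cball x \<delta>)"
  define U where "U = (\<Union>x\<in>K. ball x \<delta>)"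
  define \<nu> where "\<nu> l = open_convex_function.ma_measure \<Omega> (lincomb m (c l) u)" for l
  have ocf: "open_convex_function \<Omega> (lincomb m (c l) u)" if "l \<in> L" for l
    by unfold_locales (use \<Omega> u c that in \<open>auto intro!: convex_on_lincomb\<close>)
  have K': "compact K'" "K' \<subseteq> \<Omega>" using d by (auto simp: K'_def)
  then have K'b: "K' \<in> sets borel" by (simp add: borel_compact)
  have U: "open U" "U \<subseteq> K'" "K \<subseteq> U" using d(1) by (auto simp: U_def K'_def)
  \<comment> \<open>Cutting off at the compact \<open>K'\<close> makes the measures finite; test
    sets with closure in the open set \<open>U\<close> do not notice the cut.\<close>
  define M where "M l = density (\<nu> l) (indicator K')" for l
  have em: "emeasure (M l) X = monge_ampere \<Omega> (lincomb m (c l) u) X"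
    if "l \<in> L" "X \<in> sets borel" "X \<subseteq> K'" for l X
  proof -
    interpret open_convex_function \<Omega> "lincomb m (c l) u" by (rule ocf[OF that(1)])
    have "emeasure (M l) X = emeasure (\<nu> l) (K' \<inter> X)"
      unfolding M_def \<nu>_def using K'b that by (subst emeasure_density) (auto simp flip: indicator_inter_arith)
    also have "K' \<inter> X = X" using that by blast
    also have "emeasure (\<nu> l) X = monge_ampere \<Omega> (lincomb m (c l) u) X"
      unfolding \<nu>_def using that K'(2) by (intro monge_ampere_eq[symmetric]) auto
    finally show ?thesis .
  qed
  have fin: "finite_measure (M l)" and sets: "sets (M l) = sets borel" if l: "l \<in> L" for l
  proof -
    interpret open_convex_function \<Omega> "lincomb m (c l) u" by (rule ocf[OF l])
    show "sets (M l) = sets borel" by (simp add: M_def \<nu>_def)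
    have "emeasure (M l) UNIV = emeasure (\<nu> l) K'"
      unfolding M_def \<nu>_def using K'b by (subst emeasure_density) auto
    also have "\<dots> < \<infinity>" unfolding \<nu>_def by (rule ma_measure_compact_finite[OF K'])
    finally show "finite_measure (M l)"
      by (intro finite_measureI) (simp add: M_def \<nu>_def)
  qed
  have meas: "measure (M l) X = enn2real (monge_ampere \<Omega> (lincomb m (c l) u) X)"
    if "l \<in> L" "X \<in> sets borel" "X \<subseteq> K'" for l X
    using em[OF that] by (simp add: measure_def)
  have "0 \<le> (\<Sum>l\<in>L. w l * measure (M l) B)"
  proof (rule signed_measure_nonneg)
    show "finite L" "open U" "B \<in> sets borel" using L U(1) B(1) by auto
    show "B \<subseteq> U" using B(2) U(3) by blast
    show "finite_measure (M l)" "sets (M l) = sets borel" if "l \<in> L" for l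
      using fin sets that by auto
  next
    fix A assume A: "open A" "compact (closure A)" "closure A \<subseteq> U"
      and null: "\<And>l. l \<in> L \<Longrightarrow> emeasure (M l) (frontier A) = 0"
    have sub: "closure A \<subseteq> K'" "A \<subseteq> K'" "frontier A \<subseteq> K'"
      using A(3) U(2) closure_subset[of A] by (auto simp: frontier_def)
    have "0 \<le> (\<Sum>l\<in>L. w l * enn2real (monge_ampere \<Omega> (lincomb m (c l) u) A))"
    proof (rule monge_ampere_linear_inequality_open[OF \<Omega>])
      show "convex_on \<Omega> (u i)" if "i < m" for i using u that .
      show "finite L" "open A" "compact (closure A)" using L A by auto
      show "0 \<le> c l i" if "l \<in> L" "i < m" for l i using c that .
      show "0 \<le> (\<Sum>l\<in>L. w l * det (\<Sum>i<m. c l i *\<^sub>R H i))"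
        if "\<And>i. i < m \<Longrightarrow> gram (H i)" for H :: "nat \<Rightarrow> real^'n^'n"
        using det that .
      show "closure A \<subseteq> \<Omega>" using sub K'(2) by blast
      show "monge_ampere \<Omega> (lincomb m (c l) u) (frontier A) = 0" if "l \<in> L" for l
        using null[OF that] em[OF that _ sub(3)] by simp
    qed
    then show "0 \<le> (\<Sum>l\<in>L. w l * measure (M l) A)"
      using meas A(1) sub(2) by simp
  qed
  moreover have "B \<subseteq> K'" using B(2) U by blast
  ultimately show ?thesis using meas[OF _ B(1)] by simp
qed

section \<open>The mixed Monge--Ampere measure\<close>

abbreviation ind :: "nat set \<Rightarrow> nat \<Rightarrow> real" where
  "ind S j \<equiv> (if j \<in> S then 1 else 0)"

text \<open>Real-valued because polarization subtracts. The value is meaningful on Borel sets inside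
  a compact subset of \<Omega>, where the measures are finite and \<open>enn2real\<close> loses
  nothing.\<close>

definition mixed_ma :: "(real^'n) set \<Rightarrow> (real^'n \<Rightarrow> real) list \<Rightarrow> (real^'n) set \<Rightarrow> real" where
  "mixed_ma \<Omega> us B = polarization CARD('n)
     (\<lambda>S. enn2real (monge_ampere \<Omega> (lincomb CARD('n) (ind S) ((!) us)) B))"

text \<open>The transfer principle with the polarization weights; the determinant inequality it asks
  for is the non-negativity of mixed discriminants.\<close>

lemma mixed_ma_nonneg:
  fixes us :: "(real^'n \<Rightarrow> real) list"
  assumes \<Omega>: "open \<Omega>" "convex \<Omega>" and us: "length us = CARD('n)" "\<And>u. u \<in> set us \<Longrightarrow> convex_on \<Omega> u"
    and B: "B \<in> sets borel" "B \<subseteq> K" "compact K" "K \<subseteq> \<Omega>"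
  shows "0 \<le> mixed_ma \<Omega> us B"
proof -
  have "0 \<le> (\<Sum>S\<in>Pow {..<CARD('n)}. ((-1) ^ (CARD('n) - card S) / fact CARD('n)) *
      enn2real (monge_ampere \<Omega> (lincomb CARD('n) (ind S) ((!) us)) B))"
  proof (rule monge_ampere_linear_inequality[OF \<Omega>])
    show "convex_on \<Omega> (us ! i)" if "i < CARD('n)" for i using us that by simp
    show "B \<in> sets borel" "B \<subseteq> K" "compact K" "K \<subseteq> \<Omega>" by fact+
    fix H :: "nat \<Rightarrow> real^'n^'n" assume "\<And>i. i < CARD('n) \<Longrightarrow> gram (H i)"
    then have "0 \<le> mixed_disc H" by (rule mixed_disc_nonneg)
    then show "0 \<le> (\<Sum>S\<in>Pow {..<CARD('n)}. ((-1) ^ (CARD('n) - card S) / fact CARD('n)) *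
        det (\<Sum>i<CARD('n). ind S i *\<^sub>R H i))"
      by (simp add: mixed_disc_def polarization_def sum_divide_distrib)
  qed auto
  then show ?thesis by (simp add: mixed_ma_def polarization_def sum_divide_distrib)
qed

text \<open>A sum over list positions becomes a combination of the \<open>f i\<close>, each
  collecting the coefficients of the positions that point to \<open>i\<close>. Thus all tuples drawn
  from \<open>u\<close> fit into one family of coefficient vectors.\<close>

lemma sum_select:
  fixes f :: "nat \<Rightarrow> 'v::real_vector"
  assumes "\<And>j. j < n \<Longrightarrow> g j < (m::nat)"
  shows "(\<Sum>i<m. (\<Sum>j<n. a j * (if g j = i then 1 else 0)) *\<^sub>R f i) = (\<Sum>j<n. a j *\<^sub>R f (g j))"
proof -
  have "(\<Sum>i<m. (\<Sum>j<n. a j * (if g j = i then 1 else 0)) *\<^sub>R f i)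
      = (\<Sum>j<n. \<Sum>i<m. (a j * (if g j = i then 1 else 0)) *\<^sub>R f i)"
    unfolding scaleR_sum_left by (rule sum.swap)
  also have "\<dots> = (\<Sum>j<n. \<Sum>i<m. if g j = i then a j *\<^sub>R f i else 0)"
    by (intro sum.cong refl) auto
  also have "\<dots> = (\<Sum>j<n. a j *\<^sub>R f (g j))"
    using assms by (intro sum.cong refl) simp
  finally show ?thesis .
qed

text \<open>The expansion is one signed relation between measures of combinations of
  \<open>u\<close>: in \<open>L\<close>, \<open>None\<close> stands for the left side and
  \<open>Some (is, S)\<close> for the terms of the polarized right side. For determinants the
  relation is an equality, so both signs \<open>s\<close> are admissible.\<close>

lemma monge_ampere_lincomb:
  fixes u :: "nat \<Rightarrow> real^'n \<Rightarrow> real"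
  assumes \<Omega>: "open \<Omega>" "convex \<Omega>" and u: "\<And>i. i < m \<Longrightarrow> convex_on \<Omega> (u i)"
    and c: "\<And>i. i < m \<Longrightarrow> 0 \<le> c i"
    and B: "B \<in> sets borel" "B \<subseteq> K" "compact K" "K \<subseteq> \<Omega>"
  shows "enn2real (monge_ampere \<Omega> (lincomb m c u) B)
    = (\<Sum>is\<in>tuples CARD('n) {..<m}. prod_list (map c is) * mixed_ma \<Omega> (map u is) B)"
proof -
  let ?n = "CARD('n)"
  define L where "L = insert None (Some ` (tuples ?n {..<m} \<times> Pow {..<?n}))"
  define cc where "cc l = (case l of None \<Rightarrow> c
    | Some (is, S) \<Rightarrow> \<lambda>i. \<Sum>j<?n. ind S j * (if is ! j = i then 1 else 0))"
    for l :: "(nat list \<times> nat set) option"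
  define w where "w s l = (case l of None \<Rightarrow> s
    | Some (is, S) \<Rightarrow> - s * prod_list (map c is) * ((-1) ^ (?n - card S) / fact ?n))"
    for s :: real and l :: "(nat list \<times> nat set) option"
  have finL: "finite L" by (simp add: L_def)
  have sumL: "(\<Sum>l\<in>L. w s l * f l) = s * (f None - (\<Sum>is\<in>tuples ?n {..<m}. prod_list (map c is) *
      polarization ?n (\<lambda>S. f (Some (is, S)))))" for s and f :: "(nat list \<times> nat set) option \<Rightarrow> real"
  proof -
    have "(\<Sum>l\<in>L. w s l * f l) = s * f None +
        (\<Sum>q\<in>tuples ?n {..<m} \<times> Pow {..<?n}. w s (Some q) * f (Some q))"
      unfolding L_def by (subst sum.insert) (auto simp: sum.reindex w_def)
    also have "(\<Sum>q\<in>tuples ?n {..<m} \<times> Pow {..<?n}. w s (Some q) * f (Some q))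
        = (\<Sum>is\<in>tuples ?n {..<m}. \<Sum>S\<in>Pow {..<?n}. w s (Some (is, S)) * f (Some (is, S)))"
      by (simp add: sum.cartesian_product split_def)
    also have "\<dots> = - s * (\<Sum>is\<in>tuples ?n {..<m}. prod_list (map c is) * polarization ?n (\<lambda>S. f (Some (is, S))))"
      by (simp add: w_def polarization_def sum_distrib_left sum_divide_distrib mult_ac sum_negf)
    finally show ?thesis by (simp add: right_diff_distrib)
  qed
  have less: "is ! j < m" if "is \<in> tuples ?n {..<m}" "j < ?n" for "is" j
  proof -
    have "is ! j \<in> set is" using that by (intro nth_mem) (simp add: tuples_def)
    then show ?thesis using that(1) by (auto simp: tuples_def)
  qed
  have nonneg: "0 \<le> (\<Sum>l\<in>L. w s l * enn2real (monge_ampere \<Omega> (lincomb m (cc l) u) B))" for s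
  proof (rule monge_ampere_linear_inequality[OF \<Omega>])
    show "convex_on \<Omega> (u i)" if "i < m" for i using u that .
    show "B \<in> sets borel" "B \<subseteq> K" "compact K" "K \<subseteq> \<Omega>" by fact+
    show "finite L" by fact
    show "0 \<le> cc l i" if "l \<in> L" "i < m" for l i
      using c that by (auto simp: cc_def intro!: sum_nonneg split: option.splits)
    fix H :: "nat \<Rightarrow> real^'n^'n"
    have "polarization ?n (\<lambda>S. det (\<Sum>i<m. cc (Some (is, S)) i *\<^sub>R H i)) = mixed_disc (\<lambda>j. H (is ! j))"
      if "is \<in> tuples ?n {..<m}" for "is"
    proof -
      have "(\<Sum>i<m. cc (Some (is, S)) i *\<^sub>R H i) = (\<Sum>j<?n. ind S j *\<^sub>R H (is ! j))" for S
        unfolding cc_def option.case prod.case by (rule sum_select) (rule less[OF that])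
      then show ?thesis by (simp add: mixed_disc_def)
    qed
    then have "(\<Sum>l\<in>L. w s l * det (\<Sum>i<m. cc l i *\<^sub>R H i)) = 0"
      unfolding sumL by (simp add: cc_def det_eq_sum_mixed_disc[of c H m])
    then show "0 \<le> (\<Sum>l\<in>L. w s l * det (\<Sum>i<m. cc l i *\<^sub>R H i))" by simp
  qed
  have "polarization ?n (\<lambda>S. enn2real (monge_ampere \<Omega> (lincomb m (cc (Some (is, S))) u) B))
      = mixed_ma \<Omega> (map u is) B" if "is \<in> tuples ?n {..<m}" for "is"
  proof -
    have "lincomb m (cc (Some (is, S))) u = lincomb ?n (ind S) ((!) (map u is))" for S
    proof
      fix x
      have "lincomb m (cc (Some (is, S))) u x = (\<Sum>j<?n. ind S j * u (is ! j) x)"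
        unfolding lincomb_def cc_def option.case prod.case
        using sum_select[of ?n "(!) is" m "ind S" "\<lambda>i. u i x"] less[OF that] by simp
      also have "\<dots> = lincomb ?n (ind S) ((!) (map u is)) x"
        using that by (auto simp: lincomb_def tuples_def intro!: sum.cong)
      finally show "lincomb m (cc (Some (is, S))) u x = lincomb ?n (ind S) ((!) (map u is)) x" .
    qed
    then show ?thesis by (simp add: mixed_ma_def)
  qed
  then have "(\<Sum>l\<in>L. w s l * enn2real (monge_ampere \<Omega> (lincomb m (cc l) u) B))
      = s * (enn2real (monge_ampere \<Omega> (lincomb m c u) B)
        - (\<Sum>is\<in>tuples ?n {..<m}. prod_list (map c is) * mixed_ma \<Omega> (map u is) B))" for s
    unfolding sumL by (simp add: cc_def)
  from nonneg[of 1, unfolded this] nonneg[of "-1", unfolded this] show ?thesis by simp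
qed

text \<open>Rearranging the entries acts on the index sets \<open>S\<close> by a bijection that
  preserves cardinality, hence permutes the terms of the polarization.\<close>

lemma mixed_ma_symmetric:
  fixes us vs :: "(real^'n \<Rightarrow> real) list"
  assumes "mset us = mset vs" "length vs = CARD('n)"
  shows "mixed_ma \<Omega> us = mixed_ma \<Omega> vs"
proof
  fix B
  let ?n = "CARD('n)"
  obtain f where f: "f permutes {..<length vs}" "permute_list f vs = us"
    using mset_eq_permutation[OF assms(1)] by blast
  have fn: "f permutes {..<?n}" using f assms by simp
  note finv = permutes_inverses[OF fn]
  have nth: "us ! j = vs ! f j" if "j < ?n" for j
    using f(2) that assms(2) permute_list_nth[OF f(1)] by metis
  have lin: "lincomb ?n (ind S) ((!) us) = lincomb ?n (ind (f ` S)) ((!) vs)" for S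
  proof
    fix x
    have "lincomb ?n (ind S) ((!) us) x = (\<Sum>j<?n. ind (f ` S) (f j) * (vs ! f j) x)"
      unfolding lincomb_def using permutes_inj[OF fn] by (intro sum.cong refl) (auto simp: nth inj_image_mem_iff)
    also have "\<dots> = lincomb ?n (ind (f ` S)) ((!) vs) x"
      unfolding lincomb_def
      using sum.permute[OF fn, of "\<lambda>j. ind (f ` S) j * (vs ! j) x"] by (simp add: o_def)
    finally show "lincomb ?n (ind S) ((!) us) x = lincomb ?n (ind (f ` S)) ((!) vs) x" .
  qed
  have "(\<Sum>S\<in>Pow {..<?n}. (-1) ^ (?n - card S) * enn2real (monge_ampere \<Omega> (lincomb ?n (ind S) ((!) us)) B))
      = (\<Sum>S\<in>Pow {..<?n}. (-1) ^ (?n - card (f ` S)) * enn2real (monge_ampere \<Omega> (lincomb ?n (ind (f ` S)) ((!) vs)) B))"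
    by (simp add: lin card_image permutes_inj_on[OF fn])
  also have "\<dots> = (\<Sum>S\<in>Pow {..<?n}. (-1) ^ (?n - card S) * enn2real (monge_ampere \<Omega> (lincomb ?n (ind S) ((!) vs)) B))"
  proof (rule sum.reindex_bij_betw[of "(`) f"])
    show "bij_betw ((`) f) (Pow {..<?n}) (Pow {..<?n})"
      using bij_betw_Pow[OF permutes_imp_bij[OF fn]] .
  qed
  finally show "mixed_ma \<Omega> us B = mixed_ma \<Omega> vs B"
    by (simp add: mixed_ma_def polarization_def)
qed

section \<open>Countable additivity and extension to a Radon measure\<close>

lemma (in open_convex_function) monge_ampere_sums:
  assumes A: "\<And>i::nat. A i \<in> sets borel" "disjoint_family A" and K: "(\<Union>i. A i) \<subseteq> K" "compact K" "K \<subseteq> \<Omega>"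
  shows "(\<lambda>i. enn2real (monge_ampere \<Omega> u (A i))) sums enn2real (monge_ampere \<Omega> u (\<Union>i. A i))"
proof -
  have AO: "A i \<subseteq> \<Omega>" "(\<Union>i. A i) \<subseteq> \<Omega>" for i using K by auto
  have "emeasure ma_measure (\<Union>i. A i) \<le> emeasure ma_measure K"
    using K by (intro emeasure_mono) (auto simp: borel_compact)
  then have "emeasure ma_measure (\<Union>i. A i) \<noteq> \<infinity>"
    using ma_measure_compact_finite[OF K(2,3)] by (auto simp: top_unique)
  then have "(\<lambda>i. measure ma_measure (A i)) sums measure ma_measure (\<Union>i. A i)"
    using A by (intro measure_UNION) auto
  then show ?thesis using A AO by (simp add: measure_def monge_ampere_eq)
qed

lemma monge_ampere_empty [simp]: "monge_ampere \<Omega> u {} = 0"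
  by (simp add: monge_ampere_def)

lemma mixed_ma_empty [simp]: "mixed_ma \<Omega> us {} = 0"
  by (simp add: mixed_ma_def polarization_def)

lemma mixed_ma_sums:
  fixes us :: "(real^'n \<Rightarrow> real) list"
  assumes \<Omega>: "open \<Omega>" "convex \<Omega>" and us: "length us = CARD('n)" "\<And>u. u \<in> set us \<Longrightarrow> convex_on \<Omega> u"
    and A: "\<And>i::nat. A i \<in> sets borel" "disjoint_family A" and K: "(\<Union>i. A i) \<subseteq> K" "compact K" "K \<subseteq> \<Omega>"
  shows "(\<lambda>i. mixed_ma \<Omega> us (A i)) sums mixed_ma \<Omega> us (\<Union>i. A i)"
proof -
  have "(\<lambda>i. enn2real (monge_ampere \<Omega> (lincomb CARD('n) (ind S) ((!) us)) (A i)))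
      sums enn2real (monge_ampere \<Omega> (lincomb CARD('n) (ind S) ((!) us)) (\<Union>i. A i))" for S
  proof -
    interpret open_convex_function \<Omega> "lincomb CARD('n) (ind S) ((!) us)"
      by unfold_locales (use \<Omega> us in \<open>auto intro!: convex_on_lincomb\<close>)
    show ?thesis using monge_ampere_sums[OF A K] .
  qed
  then show ?thesis
    unfolding mixed_ma_def polarization_def
    by (intro sums_divide sums_sum sums_mult)
qed

lemma mixed_ma_mono:
  fixes us :: "(real^'n \<Rightarrow> real) list"
  assumes \<Omega>: "open \<Omega>" "convex \<Omega>" and us: "length us = CARD('n)" "\<And>u. u \<in> set us \<Longrightarrow> convex_on \<Omega> u"
    and B: "B \<in> sets borel" "B' \<in> sets borel" "B \<subseteq> B'" "B' \<subseteq> K" "compact K" "K \<subseteq> \<Omega>"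
  shows "mixed_ma \<Omega> us B \<le> mixed_ma \<Omega> us B'"
proof -
  \<comment> \<open>Two-set additivity, obtained from countable additivity with empty tails.\<close>
  define A where "A i = (if i = 0 then B else if i = 1 then B' - B else {})" for i :: nat
  have sub: "A i \<subseteq> B'" and bor: "A i \<in> sets borel" for i
    using B(1-3) by (auto simp: A_def)
  have un: "(\<Union>i. A i) = B'"
  proof
    have "A 0 \<union> A 1 = B'" using B(3) by (auto simp: A_def)
    then show "B' \<subseteq> (\<Union>i. A i)" by blast
    show "(\<Union>i. A i) \<subseteq> B'" using sub by blast
  qed
  have dis: "disjoint_family A" by (auto simp: disjoint_family_on_def A_def)
  have "(\<Union>i. A i) \<subseteq> K" unfolding un by (rule B(4))
  note sums = mixed_ma_sums[OF \<Omega> us bor dis this B(5,6)]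
  have "(\<lambda>i. mixed_ma \<Omega> us (A i)) sums mixed_ma \<Omega> us (\<Union>i. A i)"
    by (rule sums)
  moreover have "(\<lambda>i. mixed_ma \<Omega> us (A i)) sums (\<Sum>i\<in>{0,1}. mixed_ma \<Omega> us (A i))"
    by (rule sums_finite) (auto simp: A_def)
  ultimately have "mixed_ma \<Omega> us (\<Union>i. A i) = (\<Sum>i\<in>{0,1}. mixed_ma \<Omega> us (A i))"
    by (rule sums_unique2)
  then have "mixed_ma \<Omega> us B' = mixed_ma \<Omega> us B + mixed_ma \<Omega> us (B' - B)"
    unfolding un by (simp add: A_def)
  moreover have "0 \<le> mixed_ma \<Omega> us (B' - B)"
    by (rule mixed_ma_nonneg[OF \<Omega> us _ _ B(5,6)]) (use B in auto)
  ultimately show ?thesis by simp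
qed

lemma radon_measure_eqI:
  fixes \<Omega> :: "'a::euclidean_space set"
  assumes \<Omega>: "open \<Omega>" and sets: "sets M = sets (restrict_space borel \<Omega>)" "sets N = sets (restrict_space borel \<Omega>)"
    and eq: "\<And>B K. B \<in> sets borel \<Longrightarrow> B \<subseteq> K \<Longrightarrow> compact K \<Longrightarrow> K \<subseteq> \<Omega> \<Longrightarrow> emeasure M B = emeasure N B"
  shows "M = N"
proof (rule measure_eqI)
  show "sets M = sets N" using sets by simp
  fix X assume "X \<in> sets M"
  then have X: "X \<in> sets borel" "X \<subseteq> \<Omega>"
    using sets \<Omega> by (auto simp: sets_restrict_space_iff)
  obtain C :: "nat \<Rightarrow> 'a set" where C: "\<And>n. compact (C n)" "\<And>n. C n \<subseteq> \<Omega>" "\<And>n. C n \<subseteq> interior (C (Suc n))" "\<Union>(range C) = \<Omega>"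
    using open_Union_compact_subsets[OF \<Omega>] by metis
  have "incseq C" using C(3) interior_subset by (intro incseq_SucI) blast
  then have inc: "incseq (\<lambda>n. X \<inter> C n)" by (auto simp: incseq_def)
  have un: "(\<Union>n. X \<inter> C n) = X" using C(4) X(2) by auto
  have m: "X \<inter> C n \<in> sets borel" "X \<inter> C n \<subseteq> \<Omega>" for n using X C by (auto simp: borel_compact)
  have "X \<inter> C n \<in> sets (restrict_space borel \<Omega>)" for n
    using m \<Omega> by (simp add: sets_restrict_space_iff)
  then have r: "range (\<lambda>n. X \<inter> C n) \<subseteq> sets (restrict_space borel \<Omega>)" by blast
  have "(\<lambda>n. emeasure M (X \<inter> C n)) \<longlonglongrightarrow> emeasure M X"
    using Lim_emeasure_incseq[OF _ inc, of M] r un unfolding sets(1) by simp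
  moreover have "(\<lambda>n. emeasure N (X \<inter> C n)) \<longlonglongrightarrow> emeasure N X"
    using Lim_emeasure_incseq[OF _ inc, of N] r un unfolding sets(2) by simp
  moreover have "emeasure M (X \<inter> C n) = emeasure N (X \<inter> C n)" for n
    by (rule eq[OF m(1) _ C(1,2)]) auto
  ultimately show "emeasure M X = emeasure N X" by (simp add: LIMSEQ_unique)
qed

text \<open>Control of \<open>mixed_ma\<close> is confined to compact sets, so the measure is the
  supremum along a compact exhaustion. Monotonicity of the set function allows the supremum to be
  exchanged with the series.\<close>

lemma mixed_ma_measure_exists:
  fixes us :: "(real^'n \<Rightarrow> real) list"
  assumes \<Omega>: "open \<Omega>" "convex \<Omega>" and us: "length us = CARD('n)" "\<And>u. u \<in> set us \<Longrightarrow> convex_on \<Omega> u"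
  shows "\<exists>\<nu>. radon_measure_on \<Omega> \<nu> \<and>
    (\<forall>B K. B \<in> sets borel \<and> B \<subseteq> K \<and> compact K \<and> K \<subseteq> \<Omega> \<longrightarrow> emeasure \<nu> B = ennreal (mixed_ma \<Omega> us B))"
proof -
  obtain C :: "nat \<Rightarrow> (real^'n) set" where C: "\<And>n. compact (C n)" "\<And>n. C n \<subseteq> \<Omega>" "\<And>n. C n \<subseteq> interior (C (Suc n))"
    "\<Union>(range C) = \<Omega>" "\<And>K. compact K \<Longrightarrow> K \<subseteq> \<Omega> \<Longrightarrow> \<exists>N. \<forall>n\<ge>N. K \<subseteq> C n"
    using open_Union_compact_subsets[OF \<Omega>(1)] by metis
  have incC: "incseq C" using C(3) interior_subset by (intro incseq_SucI) blast
  let ?P = "mixed_ma \<Omega> us"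
  let ?S = "sets (restrict_space borel \<Omega>)"
  have S: "X \<in> ?S \<longleftrightarrow> X \<in> sets borel \<and> X \<subseteq> \<Omega>" for X :: "(real^'n) set"
    using \<Omega> by (auto simp: sets_restrict_space_iff)
  have BC: "X \<inter> C n \<in> sets borel" if "X \<in> ?S" for X n
    using that S borel_compact[OF C(1)] by (intro sets.Int) auto
  have inc: "incseq (\<lambda>n. ennreal (?P (X \<inter> C n)))" if X: "X \<in> ?S" for X
  proof (rule incseq_SucI, rule ennreal_leI)
    fix n show "?P (X \<inter> C n) \<le> ?P (X \<inter> C (Suc n))"
      using incC by (intro mixed_ma_mono[OF \<Omega> us BC[OF X] BC[OF X] _ _ C(1)[of "Suc n"] C(2)])
        (auto simp: incseq_Suc_iff)
  qed
  define E where "E X = (SUP n. ennreal (?P (X \<inter> C n)))" for X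
  define \<nu> where "\<nu> = measure_of \<Omega> ?S E"
  have sp: "space (restrict_space borel \<Omega>) = \<Omega>" by (simp add: space_restrict_space)
  have sa: "sigma_algebra \<Omega> ?S"
    using sets.sigma_algebra_axioms[of "restrict_space borel \<Omega>"] by (simp add: sp)
  have "positive ?S E" by (simp add: positive_def E_def)
  moreover have "countably_additive ?S E"
  proof (rule countably_additiveI)
    fix A :: "nat \<Rightarrow> (real^'n) set"
    assume A: "range A \<subseteq> ?S" "disjoint_family A" "(\<Union>i. A i) \<in> ?S"
    then have Ai: "A i \<in> ?S" for i by auto
    have "(\<Sum>i. E (A i)) = (SUP n. \<Sum>i. ennreal (?P (A i \<inter> C n)))"
      unfolding E_def by (rule ennreal_suminf_SUP_eq[OF inc[OF Ai]])
    also have "\<dots> = (SUP n. ennreal (?P ((\<Union>i. A i) \<inter> C n)))"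
    proof (rule SUP_cong[OF refl])
      fix n
      have "(\<lambda>i. ?P (A i \<inter> C n)) sums ?P (\<Union>i. A i \<inter> C n)"
      proof (rule mixed_ma_sums[OF \<Omega> us BC[OF Ai] _ _ C(1)[of n] C(2)])
        show "disjoint_family (\<lambda>i. A i \<inter> C n)" using A(2) by (auto simp: disjoint_family_on_def)
      qed auto
      moreover have "0 \<le> ?P (A i \<inter> C n)" for i
        by (rule mixed_ma_nonneg[OF \<Omega> us BC[OF Ai] _ C(1)[of n] C(2)]) auto
      ultimately show "(\<Sum>i. ennreal (?P (A i \<inter> C n))) = ennreal (?P ((\<Union>i. A i) \<inter> C n))"
        by (subst suminf_ennreal2) (auto simp: sums_iff)
    qed
    finally show "(\<Sum>i. E (A i)) = E (\<Union>i. A i)" by (simp add: E_def)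
  qed
  ultimately have em: "emeasure \<nu> X = E X" if "X \<in> ?S" for X
    unfolding \<nu>_def using emeasure_measure_of_sigma[OF sa _ _ that] by blast
  have sets: "sets \<nu> = ?S"
    unfolding \<nu>_def using sigma_algebra.sets_measure_of_eq[OF sa] by simp
  have val: "emeasure \<nu> B = ennreal (?P B)" if B: "B \<in> sets borel" "B \<subseteq> K" "compact K" "K \<subseteq> \<Omega>" for B K
  proof -
    have BS: "B \<in> ?S" using B S by auto
    obtain N where N: "\<And>n. n \<ge> N \<Longrightarrow> K \<subseteq> C n" using C(5)[OF B(3,4)] by blast
    have "(\<lambda>n. ennreal (?P (B \<inter> C n))) \<longlonglongrightarrow> E B"
      unfolding E_def by (rule LIMSEQ_SUP[OF inc[OF BS]])
    moreover have "eventually (\<lambda>n. ennreal (?P (B \<inter> C n)) = ennreal (?P B)) sequentially"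
      unfolding eventually_sequentially using N B(2) by (intro exI[of _ N]) (auto simp: Int_absorb2 subset_trans)
    then have "(\<lambda>n. ennreal (?P (B \<inter> C n))) \<longlonglongrightarrow> ennreal (?P B)" by (rule tendsto_eventually)
    ultimately show ?thesis using em[OF BS] LIMSEQ_unique by metis
  qed
  have "radon_measure_on \<Omega> \<nu>"
    unfolding radon_measure_on_def
  proof (intro conjI allI impI sets)
    fix K assume K: "compact K \<and> K \<subseteq> \<Omega>"
    then have "emeasure \<nu> K = ennreal (?P K)" by (intro val[of K K] borel_compact) auto
    then show "emeasure \<nu> K < \<infinity>" by simp
  qed
  then show ?thesis using val by blast
qed

text \<open>Total in \<open>us\<close>, as a functional must be. The choice depends on
  \<open>us\<close> only through \<open>mixed_ma \<Omega> us\<close>, so symmetry of the set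
  function passes directly to the measure.\<close>

definition mixed_ma_measure :: "(real^'n) set \<Rightarrow> (real^'n \<Rightarrow> real) list \<Rightarrow> (real^'n) measure" where
  "mixed_ma_measure \<Omega> us = (SOME \<nu>. radon_measure_on \<Omega> \<nu> \<and>
    (\<forall>B K. B \<in> sets borel \<and> B \<subseteq> K \<and> compact K \<and> K \<subseteq> \<Omega> \<longrightarrow> emeasure \<nu> B = ennreal (mixed_ma \<Omega> us B)))"

lemma
  fixes us :: "(real^'n \<Rightarrow> real) list"
  assumes \<Omega>: "open \<Omega>" "convex \<Omega>" and us: "length us = CARD('n)" "\<And>u. u \<in> set us \<Longrightarrow> convex_on \<Omega> u"
  shows radon_mixed_ma_measure: "radon_measure_on \<Omega> (mixed_ma_measure \<Omega> us)"
    and emeasure_mixed_ma_measure: "\<And>B K. B \<in> sets borel \<Longrightarrow> B \<subseteq> K \<Longrightarrow> compact K \<Longrightarrow> K \<subseteq> \<Omega> \<Longrightarrow>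
      emeasure (mixed_ma_measure \<Omega> us) B = ennreal (mixed_ma \<Omega> us B)"
  using someI_ex[OF mixed_ma_measure_exists[OF \<Omega> us]] unfolding mixed_ma_measure_def by blast+

text \<open>The expansion formula is known in the reals for sets inside a compact set. On a general
  Borel set both sides are increasing limits along an exhaustion, so the identity persists even with
  infinite values.\<close>

lemma mixed_monge_ampere_functional_exists:
  fixes \<Omega> :: "(real^'n) set"
  assumes \<Omega>: "open \<Omega>" "convex \<Omega>"
  shows "mixed_monge_ampere_functional \<Omega> (mixed_ma_measure \<Omega>)"
  unfolding mixed_monge_ampere_functional_def
proof (intro conjI allI impI)
  fix us :: "(real^'n \<Rightarrow> real) list"
  assume "length us = DIM(real^'n) \<and> (\<forall>u\<in>set us. convex_on \<Omega> u)"
  then show "radon_measure_on \<Omega> (mixed_ma_measure \<Omega> us)"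
    by (intro radon_mixed_ma_measure[OF \<Omega>]) auto
next
  fix us vs :: "(real^'n \<Rightarrow> real) list"
  assume "length us = DIM(real^'n) \<and> (\<forall>u\<in>set us. convex_on \<Omega> u) \<and> mset us = mset vs"
  then have "mset us = mset vs" "length vs = CARD('n)" using mset_eq_length[of us vs] by auto
  from mixed_ma_symmetric[OF this]
  show "mixed_ma_measure \<Omega> us = mixed_ma_measure \<Omega> vs" by (simp add: mixed_ma_measure_def)
next
  fix m and u :: "nat \<Rightarrow> real^'n \<Rightarrow> real" and c :: "nat \<Rightarrow> real" and B
  assume "(\<forall>i<m. convex_on \<Omega> (u i)) \<and> (\<forall>i<m. 0 \<le> c i) \<and> B \<in> sets borel \<and> B \<subseteq> \<Omega>"
  then have u: "\<And>i. i < m \<Longrightarrow> convex_on \<Omega> (u i)" and c: "\<And>i. i < m \<Longrightarrow> 0 \<le> c i"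
    and B: "B \<in> sets borel" "B \<subseteq> \<Omega>" by auto
  interpret open_convex_function \<Omega> "lincomb m c u"
    by unfold_locales (use \<Omega> u c in \<open>auto intro!: convex_on_lincomb\<close>)
  obtain C :: "nat \<Rightarrow> (real^'n) set" where C: "\<And>n. compact (C n)" "\<And>n. C n \<subseteq> \<Omega>" "\<And>n. C n \<subseteq> interior (C (Suc n))" "\<Union>(range C) = \<Omega>"
    using open_Union_compact_subsets[OF \<Omega>(1)] by metis
  have "incseq C" using C(3) interior_subset by (intro incseq_SucI) blast
  then have inc: "incseq (\<lambda>n. B \<inter> C n)" by (auto simp: incseq_def)
  have un: "(\<Union>n. B \<inter> C n) = B" using C(4) B(2) by auto
  have m: "B \<inter> C n \<in> sets borel" "B \<inter> C n \<subseteq> \<Omega>" "B \<inter> C n \<subseteq> C n" for n using B C by (auto simp: borel_compact)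
  have "B \<inter> C n \<in> sets (restrict_space borel \<Omega>)" for n
    using m \<Omega> by (simp add: sets_restrict_space_iff)
  then have r: "range (\<lambda>n. B \<inter> C n) \<subseteq> sets (restrict_space borel \<Omega>)" by blast
  let ?L = "tuples CARD('n) {..<m}" and ?M = "mixed_ma_measure \<Omega>"
  have valid: "length (map u is) = CARD('n)" "\<And>v. v \<in> set (map u is) \<Longrightarrow> convex_on \<Omega> v"
    if "is \<in> ?L" for "is" using that u by (auto simp: tuples_def)
  have prod0: "0 \<le> prod_list (map c is)" if "is \<in> ?L" for "is"
    using that c by (intro prod_list_nonneg) (auto simp: tuples_def)
  have step: "monge_ampere \<Omega> (lincomb m c u) (B \<inter> C n) =
      (\<Sum>is\<in>?L. ennreal (prod_list (map c is)) * emeasure (?M (map u is)) (B \<inter> C n))" for n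
  proof -
    have "monge_ampere \<Omega> (lincomb m c u) (B \<inter> C n) \<le> emeasure ma_measure (C n)"
      unfolding monge_ampere_eq[OF m(1,2)] using C(1) by (intro emeasure_mono) (auto simp: borel_compact)
    then have "monge_ampere \<Omega> (lincomb m c u) (B \<inter> C n) < top"
      using ma_measure_compact_finite[OF C(1,2), of n] by (simp add: le_less_trans)
    moreover have "enn2real (monge_ampere \<Omega> (lincomb m c u) (B \<inter> C n)) =
        (\<Sum>is\<in>?L. prod_list (map c is) * mixed_ma \<Omega> (map u is) (B \<inter> C n))"
      by (rule monge_ampere_lincomb[OF \<Omega> _ _ m(1,3) C(1,2)]) (use u c in auto)
    ultimately have "monge_ampere \<Omega> (lincomb m c u) (B \<inter> C n) =
        ennreal (\<Sum>is\<in>?L. prod_list (map c is) * mixed_ma \<Omega> (map u is) (B \<inter> C n))"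
      by (metis ennreal_enn2real)
    also have "\<dots> = (\<Sum>is\<in>?L. ennreal (prod_list (map c is) * mixed_ma \<Omega> (map u is) (B \<inter> C n)))"
      using prod0 mixed_ma_nonneg[OF \<Omega> valid m(1,3) C(1,2)]
      by (intro sum_ennreal[symmetric] mult_nonneg_nonneg) auto
    also have "\<dots> = (\<Sum>is\<in>?L. ennreal (prod_list (map c is)) * emeasure (?M (map u is)) (B \<inter> C n))"
      using prod0 emeasure_mixed_ma_measure[OF \<Omega> valid m(1,3) C(1,2)] mixed_ma_nonneg[OF \<Omega> valid m(1,3) C(1,2)]
      by (intro sum.cong refl) (simp add: ennreal_mult)
    finally show ?thesis .
  qed
  have "(\<lambda>n. monge_ampere \<Omega> (lincomb m c u) (B \<inter> C n)) \<longlonglongrightarrow> monge_ampere \<Omega> (lincomb m c u) B"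
    using Lim_emeasure_incseq[OF _ inc, of ma_measure] m un B by (auto simp: monge_ampere_eq)
  moreover have "(\<lambda>n. \<Sum>is\<in>?L. ennreal (prod_list (map c is)) * emeasure (?M (map u is)) (B \<inter> C n))
      \<longlonglongrightarrow> (\<Sum>is\<in>?L. ennreal (prod_list (map c is)) * emeasure (?M (map u is)) B)"
  proof (intro tendsto_sum ennreal_tendsto_cmult)
    fix "is" assume "is \<in> ?L"
    from radon_mixed_ma_measure[OF \<Omega> valid[OF this]]
    have "sets (?M (map u is)) = sets (restrict_space borel \<Omega>)" by (simp add: radon_measure_on_def)
    then show "(\<lambda>n. emeasure (?M (map u is)) (B \<inter> C n)) \<longlonglongrightarrow> emeasure (?M (map u is)) B"
      using Lim_emeasure_incseq[OF _ inc, of "?M (map u is)"] r un by simp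
  qed auto
  ultimately have "monge_ampere \<Omega> (lincomb m c u) B =
      (\<Sum>is\<in>?L. ennreal (prod_list (map c is)) * emeasure (?M (map u is)) B)"
    unfolding step by (rule LIMSEQ_unique)
  then show "monge_ampere \<Omega> (\<lambda>x. \<Sum>i<m. c i * u i x) B =
      (\<Sum>is\<in>{is. length is = DIM(real^'n) \<and> set is \<subseteq> {..<m}}. ennreal (prod_list (map c is)) * emeasure (?M (map u is)) B)"
    by (simp add: lincomb_def tuples_def)
qed

text \<open>Coefficients 0 and 1 in the expansion formula give the values that polarization needs,
  and symmetry makes all surviving permutation terms equal to that of \<open>M us\<close>. The
  subtraction takes place on sets inside compact sets, where everything is finite.\<close>

lemma mixed_monge_ampere_functional_unique:
  fixes us :: "(real^'n \<Rightarrow> real) list"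
  assumes \<Omega>: "open \<Omega>" "convex \<Omega>" and M: "mixed_monge_ampere_functional \<Omega> M"
    and us: "length us = CARD('n)" "\<And>u. u \<in> set us \<Longrightarrow> convex_on \<Omega> u"
  shows "M us = mixed_ma_measure \<Omega> us"
proof (rule radon_measure_eqI[OF \<Omega>(1)])
  let ?n = "CARD('n)"
  have radon: "radon_measure_on \<Omega> (M vs)" if "length vs = ?n" "\<And>u. u \<in> set vs \<Longrightarrow> convex_on \<Omega> u" for vs
  proof -
    have "length vs = DIM(real^'n) \<and> (\<forall>u\<in>set vs. convex_on \<Omega> u)" using that by simp
    then show ?thesis
      using M[unfolded mixed_monge_ampere_functional_def, THEN conjunct1] by blast
  qed
  have sym: "M vs = M us" if "mset us = mset vs" for vs
  proof -
    have "length us = DIM(real^'n) \<and> (\<forall>u\<in>set us. convex_on \<Omega> u) \<and> mset us = mset vs"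
      using that us by simp
    moreover have "\<forall>us vs. length us = DIM(real^'n) \<and> (\<forall>u\<in>set us. convex_on \<Omega> u) \<and> mset us = mset vs \<longrightarrow> M us = M vs"
      using M[unfolded mixed_monge_ampere_functional_def, THEN conjunct2, THEN conjunct1] .
    ultimately have "M us = M vs" by blast
    then show ?thesis by simp
  qed
  show "sets (M us) = sets (restrict_space borel \<Omega>)"
    using radon[OF us] by (simp add: radon_measure_on_def)
  show "sets (mixed_ma_measure \<Omega> us) = sets (restrict_space borel \<Omega>)"
    using radon_mixed_ma_measure[OF \<Omega> us] by (simp add: radon_measure_on_def)
  fix B K assume B: "B \<in> sets borel" "B \<subseteq> K" "compact K" "K \<subseteq> \<Omega>"
  have fin: "emeasure (M vs) B < \<infinity>" if "length vs = ?n" "\<And>u. u \<in> set vs \<Longrightarrow> convex_on \<Omega> u" for vs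
  proof -
    have "emeasure (M vs) B \<le> emeasure (M vs) K"
      using radon[OF that] B \<Omega> by (intro emeasure_mono) (auto simp: radon_measure_on_def sets_restrict_space_iff borel_compact)
    also have "\<dots> < \<infinity>" using radon[OF that] B by (simp add: radon_measure_on_def)
    finally show ?thesis .
  qed
  have "enn2real (monge_ampere \<Omega> (lincomb ?n (ind S) ((!) us)) B)
      = (\<Sum>is\<in>tuples ?n S. measure (M (map ((!) us) is)) B)" if S: "S \<subseteq> {..<?n}" for S
  proof -
    have valid: "length (map ((!) us) is) = ?n" "\<And>v. v \<in> set (map ((!) us) is) \<Longrightarrow> convex_on \<Omega> v"
      if "is \<in> tuples ?n {..<?n}" for "is" using that us by (auto simp: tuples_def)
    have pos: "0 \<le> prod_list (map (ind S) is)" for "is" by (intro prod_list_nonneg) auto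
    have "monge_ampere \<Omega> (lincomb ?n (ind S) ((!) us)) B
        = (\<Sum>is\<in>tuples ?n {..<?n}. ennreal (prod_list (map (ind S) is)) * emeasure (M (map ((!) us) is)) B)"
    proof -
      have "(\<forall>i<?n. convex_on \<Omega> (us ! i)) \<and> (\<forall>i<?n. 0 \<le> ind S i) \<and> B \<in> sets borel \<and> B \<subseteq> \<Omega>"
        using us B by auto
      from M[unfolded mixed_monge_ampere_functional_def, THEN conjunct2, THEN conjunct2, rule_format, OF this]
      show ?thesis by (simp add: lincomb_def tuples_def)
    qed
    also have "\<dots> = (\<Sum>is\<in>tuples ?n {..<?n}. ennreal (prod_list (map (ind S) is) * measure (M (map ((!) us) is)) B))"
      using fin[OF valid] pos
      by (intro sum.cong refl) (simp add: ennreal_mult emeasure_eq_ennreal_measure top.not_eq_extremum)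
    also have "\<dots> = ennreal (\<Sum>is\<in>tuples ?n {..<?n}. prod_list (map (ind S) is) * measure (M (map ((!) us) is)) B)"
      using pos by (intro sum_ennreal) simp
    also have "(\<Sum>is\<in>tuples ?n {..<?n}. prod_list (map (ind S) is) * measure (M (map ((!) us) is)) B)
        = (\<Sum>is\<in>tuples ?n S. measure (M (map ((!) us) is)) B)"
      by (rule sum_tuples_indicator[OF S])
    finally show ?thesis by (simp add: sum_nonneg)
  qed
  then have "mixed_ma \<Omega> us B = polarization ?n (\<lambda>S. \<Sum>is\<in>tuples ?n S. measure (M (map ((!) us) is)) B)"
    by (simp add: mixed_ma_def polarization_def)
  also have "\<dots> = measure (M us) B"
  proof (rule polarization_tuples_symmetric)
    fix js assume "js \<in> permutations_of_set {..<?n}"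
    from sym[OF mset_map_nth_permutation[OF this us(1), symmetric]]
    show "measure (M (map ((!) us) js)) B = measure (M us) B" by simp
  qed
  finally have "emeasure (M us) B = ennreal (mixed_ma \<Omega> us B)"
    using fin[OF us] by (simp add: emeasure_eq_ennreal_measure top.not_eq_extremum)
  then show "emeasure (M us) B = emeasure (mixed_ma_measure \<Omega> us) B"
    using emeasure_mixed_ma_measure[OF \<Omega> us B] by simp
qed

theorem mixed_monge_ampere_eq:
  fixes us :: "(real^'n \<Rightarrow> real) list"
  assumes \<Omega>: "open \<Omega>" "convex \<Omega>" and us: "length us = CARD('n)" "\<And>u. u \<in> set us \<Longrightarrow> convex_on \<Omega> u"
  shows "mixed_monge_ampere \<Omega> us = mixed_ma_measure \<Omega> us"
  unfolding mixed_monge_ampere_def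
proof (rule the_equality)
  show "\<exists>M. mixed_monge_ampere_functional \<Omega> M \<and> M us = mixed_ma_measure \<Omega> us"
    using mixed_monge_ampere_functional_exists[OF \<Omega>] by blast
  show "\<nu> = mixed_ma_measure \<Omega> us" if "\<exists>M. mixed_monge_ampere_functional \<Omega> M \<and> M us = \<nu>" for \<nu>
    using that mixed_monge_ampere_functional_unique[OF \<Omega> _ us] by blast
qed

section \<open>Radially symmetric convex functions\<close>

text \<open>The real version of \<open>p_sup\<close>, faithful where that is finite: for radial
  convex functions at every \<open>r < R\<close>, and at \<open>R\<close> for the prescribed entries
  by hypothesis.\<close>

definition slope_sup :: "real \<Rightarrow> ('a::euclidean_space \<Rightarrow> real) \<Rightarrow> real \<Rightarrow> real" where
  "slope_sup R v r = enn2real (p_sup R v r)"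

lemma radially_symmetric_onD:
  "radially_symmetric_on D v \<Longrightarrow> x \<in> D \<Longrightarrow> y \<in> D \<Longrightarrow> norm x = norm y \<Longrightarrow> v x = v y"
  unfolding radially_symmetric_on_def by blast

text \<open>By symmetry \<open>z\<close> may be replaced by the point of equal norm in the direction
  of \<open>p\<close>, and Cauchy-Schwarz handles \<open>x\<close>. What results is the
  supporting-line inequality for the radial profile with slope \<open>norm p\<close>.\<close>

lemma radial_subgradient:
  assumes "radially_symmetric_on (ball 0 R) v" and p: "p \<in> subdifferential (ball 0 R) v x"
    and z: "z \<in> ball 0 R"
  shows "v x + norm p * (norm z - norm x) \<le> v z"
proof -
  define z' where "z' = (if p = 0 then z else (norm z / norm p) *\<^sub>R p)"
  have nz: "norm z' = norm z" by (simp add: z'_def)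
  have "z' \<in> ball 0 R" using z nz by simp
  then have "v x + p \<bullet> (z' - x) \<le> v z'" by (rule subdifferentialD[OF p])
  moreover have "v z' = v z"
    by (rule radially_symmetric_onD[OF assms(1) \<open>z' \<in> ball 0 R\<close> z nz])
  moreover have "p \<bullet> z' = norm p * norm z"
    by (simp add: z'_def power2_norm_eq_inner[symmetric] power2_eq_square)
  moreover have "p \<bullet> x \<le> norm p * norm x" by (rule norm_cauchy_schwarz)
  ultimately show ?thesis by (simp add: inner_diff_right right_diff_distrib)
qed

lemma radial_subgradient_norm_mono:
  assumes rad: "radially_symmetric_on (ball 0 R) v"
    and p: "p \<in> subdifferential (ball 0 R) v x" "x \<in> ball 0 R"
    and q: "q \<in> subdifferential (ball 0 R) v y" "y \<in> ball 0 R" and less: "norm x < norm y"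
  shows "norm p \<le> norm q"
proof -
  have "v x + norm p * (norm y - norm x) \<le> v y" by (rule radial_subgradient[OF rad p(1) q(2)])
  moreover have "v y + norm q * (norm x - norm y) \<le> v x" by (rule radial_subgradient[OF rad q(1) p(2)])
  ultimately have "norm p * (norm y - norm x) \<le> norm q * (norm y - norm x)"
    by (simp add: algebra_simps)
  then show ?thesis using less by simp
qed

lemma p_sup_upper:
  "p \<in> subdifferential (ball 0 R) v x \<Longrightarrow> norm x < r \<Longrightarrow> ennreal (norm p) \<le> p_sup R v r"
  unfolding p_sup_def by (rule SUP_upper) auto

lemma p_sup_le:
  assumes "radially_symmetric_on (ball 0 R) v" "q \<in> subdifferential (ball 0 R) v y" "y \<in> ball 0 R" "r \<le> norm y"
  shows "p_sup R v r \<le> ennreal (norm q)"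
  unfolding p_sup_def
proof (rule SUP_least)
  fix p assume "p \<in> (\<Union>x\<in>ball 0 r. subdifferential (ball 0 R) v x)"
  then obtain x where x: "norm x < r" "p \<in> subdifferential (ball 0 R) v x" by auto
  have "norm p \<le> norm q"
    by (rule radial_subgradient_norm_mono[OF assms(1) x(2) _ assms(2,3)]) (use x assms in auto)
  then show "ennreal (norm p) \<le> ennreal (norm q)" by (rule ennreal_leI)
qed

lemma p_sup_mono: "r \<le> s \<Longrightarrow> p_sup R v r \<le> p_sup R v s"
  unfolding p_sup_def by (rule SUP_subset_mono[OF UN_mono[OF subset_ball]]) auto

text \<open>The supremum runs over an open ball, each point of which already lies in some smaller
  \<open>ball 0 (s j)\<close>; this makes \<open>p_sup\<close> left continuous.\<close>

lemma p_sup_left_limit: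
  assumes "mono s" "s \<longlonglongrightarrow> r" "\<And>j. s j < (r::real)"
  shows "(\<lambda>j. p_sup R v (s j)) \<longlonglongrightarrow> p_sup R v r"
proof -
  have "p_sup R v r = (SUP j. p_sup R v (s j))"
  proof (rule antisym)
    show "p_sup R v r \<le> (SUP j. p_sup R v (s j))"
      unfolding p_sup_def[of R v r]
    proof (rule SUP_least)
      fix p assume "p \<in> (\<Union>x\<in>ball 0 r. subdifferential (ball 0 R) v x)"
      then obtain x where x: "norm x < r" "p \<in> subdifferential (ball 0 R) v x" by auto
      have "eventually (\<lambda>j. norm x < s j) sequentially"
        using order_tendstoD(1)[OF assms(2) x(1)] .
      then obtain j where "norm x < s j" by (auto simp: eventually_sequentially)
      then show "ennreal (norm p) \<le> (SUP j. p_sup R v (s j))"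
        using p_sup_upper[OF x(2)] by (meson SUP_upper2 UNIV_I)
    qed
    show "(SUP j. p_sup R v (s j)) \<le> p_sup R v r"
      using assms(3) by (intro SUP_least p_sup_mono less_imp_le)
  qed
  moreover have "incseq (\<lambda>j. p_sup R v (s j))"
    using assms(1) by (intro monoI p_sup_mono) (auto simp: mono_def)
  ultimately show ?thesis using LIMSEQ_SUP by metis
qed

section \<open>Subgradient images of centred balls\<close>

locale radial_convex =
  fixes R :: real and v :: "'a::euclidean_space \<Rightarrow> real"
  assumes R: "0 < R" and convex: "convex_on (ball 0 R) v" and radial: "radially_symmetric_on (ball 0 R) v"
begin

sublocale open_convex_function "ball 0 R" v
  by unfold_locales (use convex in auto)

lemma exists_subgradient:
  assumes "0 \<le> t" "t < R"
  obtains z q where "norm z = t" "z \<in> ball 0 R" "q \<in> subdifferential (ball 0 R) v z"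
proof -
  obtain z :: 'a where z: "norm z = t" using vector_choose_size[OF assms(1)] by blast
  then have zB: "z \<in> ball 0 R" using assms by simp
  from subdifferential_nonempty[OF open_dom convex zB] z zB show thesis using that by blast
qed

lemma p_sup_finite:
  assumes "r < R"
  shows "p_sup R v r < \<infinity>"
proof (cases "0 \<le> r")
  case True
  obtain z q where zq: "norm z = r" "z \<in> ball 0 R" "q \<in> subdifferential (ball 0 R) v z"
    using exists_subgradient[OF True assms] by blast
  have "p_sup R v r \<le> ennreal (norm q)" by (rule p_sup_le[OF radial zq(3,2)]) (use zq in simp)
  then show ?thesis by (simp add: le_less_trans)
next
  case False
  then have "ball (0::'a) r = {}" by simp
  then have "(\<Union>x\<in>ball (0::'a) r. subdifferential (ball 0 R) v x) = {}" by blast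
  then show ?thesis unfolding p_sup_def by (simp add: bot_ennreal)
qed

lemma ennreal_slope_sup: "r < R \<Longrightarrow> ennreal (slope_sup R v r) = p_sup R v r"
  using p_sup_finite by (simp add: slope_sup_def)

lemma slope_sup_nonneg: "0 \<le> slope_sup R v r"
  by (simp add: slope_sup_def)

lemma slope_sup_upper:
  assumes "p \<in> subdifferential (ball 0 R) v x" "norm x < r" "r < R"
  shows "norm p \<le> slope_sup R v r"
  using p_sup_upper[OF assms(1,2)] slope_sup_nonneg unfolding ennreal_slope_sup[OF assms(3), symmetric] by simp

lemma slope_sup_le:
  assumes "q \<in> subdifferential (ball 0 R) v y" "y \<in> ball 0 R" "r \<le> norm y"
  shows "slope_sup R v r \<le> norm q"
proof -
  have "r < R" using assms by simp
  then show ?thesis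
    using p_sup_le[OF radial assms] by (simp flip: ennreal_slope_sup)
qed

lemma slope_sup_least:
  assumes "r < R" "0 \<le> c" "\<And>p x. norm x < r \<Longrightarrow> p \<in> subdifferential (ball 0 R) v x \<Longrightarrow> norm p \<le> c"
  shows "slope_sup R v r \<le> c"
proof -
  have "p_sup R v r \<le> ennreal c"
    unfolding p_sup_def using assms(3) by (intro SUP_least ennreal_leI) auto
  then show ?thesis unfolding ennreal_slope_sup[OF assms(1), symmetric] using assms(2) by simp
qed

text \<open>For a slope \<open>q\<close> shorter than some subgradient \<open>p\<close> at a point
  \<open>x\<close> of the ball, \<open>v z - q \<bullet> z\<close> is minimized over the closed ball
  of radius \<open>norm x\<close>. Beyond that radius \<open>v\<close> grows at least at rate
  \<open>norm p\<close>, which exceeds \<open>norm q\<close>, so the minimum is global and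
  \<open>q\<close> is a subgradient there.\<close>

lemma ball_subset_gradient_image:
  assumes "r < R"
  shows "ball 0 (slope_sup R v r) \<subseteq> T (ball 0 r)"
proof
  fix q assume "q \<in> ball (0::'a) (slope_sup R v r)"
  then have q: "norm q < slope_sup R v r" by simp
  have "\<exists>p x. norm x < r \<and> p \<in> subdifferential (ball 0 R) v x \<and> norm q < norm p"
  proof (rule ccontr)
    assume "\<not> ?thesis"
    then have "norm p \<le> norm q" if "norm x < r" "p \<in> subdifferential (ball 0 R) v x" for p x
      using that by (meson not_less)
    then have "slope_sup R v r \<le> norm q"
      by (intro slope_sup_least[OF assms]) auto
    with q show False by simp
  qed
  then obtain p x where x: "norm x < r" "p \<in> subdifferential (ball 0 R) v x" "norm q < norm p" by blast
  have sub: "cball 0 (norm x) \<subseteq> ball (0::'a) R" using x(1) assms by auto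
  have "continuous_on (cball 0 (norm x)) (\<lambda>z. v z - q \<bullet> z)"
    by (intro continuous_intros continuous_on_subset[OF continuous_on sub])
  moreover have "cball (0::'a) (norm x) \<noteq> {}" by simp
  ultimately obtain y where y: "y \<in> cball 0 (norm x)" "\<And>z. z \<in> cball 0 (norm x) \<Longrightarrow> v y - q \<bullet> y \<le> v z - q \<bullet> z"
    using continuous_attains_inf[OF compact_cball, of 0 "norm x" "\<lambda>z. v z - q \<bullet> z"] by blast
  have "v y + q \<bullet> (z - y) \<le> v z" if z: "z \<in> ball 0 R" for z
  proof (cases "norm z \<le> norm x")
    case True
    then show ?thesis using y(2)[of z] by (simp add: inner_diff_right)
  next
    case False
    \<comment> \<open>On the sphere of radius \<open>norm x\<close> the function is smallest at the
      point in the direction of \<open>q\<close>.\<close>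
    define y' where "y' = (if q = 0 then x else (norm x / norm q) *\<^sub>R q)"
    have ny: "norm y' = norm x" by (simp add: y'_def)
    have qy: "q \<bullet> y' = norm q * norm x"
      by (simp add: y'_def power2_norm_eq_inner[symmetric] power2_eq_square)
    have "y' \<in> ball 0 R" "x \<in> ball 0 R" using sub ny by auto
    then have vy: "v y' = v x" by (rule radially_symmetric_onD[OF radial _ _ ny])
    have "v x + norm p * (norm z - norm x) \<le> v z" by (rule radial_subgradient[OF radial x(2) z])
    moreover have "norm q * (norm z - norm x) \<le> norm p * (norm z - norm x)"
      using x(3) False by (intro mult_right_mono) auto
    moreover have "q \<bullet> z \<le> norm q * norm z" by (rule norm_cauchy_schwarz)
    moreover have "v y - q \<bullet> y \<le> v y' - q \<bullet> y'" using y(2)[of y'] ny by simp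
    ultimately show ?thesis
      using vy qy by (simp add: inner_diff_right right_diff_distrib)
  qed
  then have "q \<in> subdifferential (ball 0 R) v y" by (auto simp: subdifferential_def)
  moreover have "norm y < r" using y(1) x(1) by simp
  ultimately show "q \<in> T (ball 0 r)" by (auto simp: gradient_image_def)
qed

lemma gradient_image_subset_cball:
  assumes "r < R"
  shows "T (ball 0 r) \<subseteq> cball 0 (slope_sup R v r)"
  using slope_sup_upper[OF _ _ assms] by (auto simp: gradient_image_def)

text \<open>The image lies between the open and the closed ball of radius
  \<open>slope_sup R v r\<close>, which have the same volume.\<close>

lemma monge_ampere_ball:
  assumes "r < R"
  shows "enn2real (monge_ampere (ball 0 R) v (ball 0 r)) = kappa TYPE('a) * slope_sup R v r ^ DIM('a)"
proof -
  let ?P = "slope_sup R v r"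
  have T: "T (ball 0 r) \<in> sets borel"
    using assms by (intro gradient_image_open_borel) auto
  have fin: "T (ball 0 r) \<in> lmeasurable"
    using T gradient_image_subset_cball[OF assms] bounded_subset[OF bounded_cball]
    by (intro bounded_set_imp_lmeasurable) auto
  have "measure lebesgue (ball (0::'a) ?P) \<le> measure lebesgue (T (ball 0 r))"
    by (rule measure_mono_fmeasurable[OF ball_subset_gradient_image[OF assms] _ fin]) simp
  moreover have "measure lebesgue (T (ball 0 r)) \<le> measure lebesgue (cball (0::'a) ?P)"
    by (rule measure_mono_fmeasurable[OF gradient_image_subset_cball[OF assms]]) (use T in auto)
  ultimately have "measure lebesgue (T (ball 0 r)) = kappa TYPE('a) * ?P ^ DIM('a)"
    using slope_sup_nonneg[of r] by (simp add: content_ball content_cball kappa_def)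
  then show ?thesis by (simp add: monge_ampere_def gradient_image_def measure_def)
qed

end

section \<open>Additivity of slopes and mixed measures of centred balls\<close>

lemma radially_symmetric_on_lincomb:
  "(\<And>i. i < m \<Longrightarrow> radially_symmetric_on D (u i)) \<Longrightarrow> radially_symmetric_on D (lincomb m c u)"
  unfolding radially_symmetric_on_def lincomb_def by (metis (no_types, lifting) lessThan_iff sum.cong)

lemma radial_convex_lincomb:
  assumes "\<And>i. i < m \<Longrightarrow> radial_convex R (u i)" "\<And>i. i < m \<Longrightarrow> 0 \<le> c i" "0 < R"
  shows "radial_convex R (lincomb m c u)"
  using assms unfolding radial_convex_def
  by (auto intro!: convex_on_lincomb radially_symmetric_on_lincomb)

text \<open>Slopes are compared with increments of the profile, which are additive. From above, the
  increment between \<open>norm x\<close> and a radius \<open>t < r\<close> suffices; from below,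
  radii are taken so close to \<open>r\<close> that the subgradients of each \<open>u i\<close>
  there have norm at least \<open>slope_sup R (u i) r - e'\<close>.\<close>

lemma slope_sup_lincomb:
  fixes u :: "nat \<Rightarrow> 'a::euclidean_space \<Rightarrow> real"
  assumes u: "\<And>i. i < m \<Longrightarrow> radial_convex R (u i)" and c: "\<And>i. i < m \<Longrightarrow> 0 \<le> c i" and r: "0 < r" "r < R"
  shows "slope_sup R (lincomb m c u) r = (\<Sum>i<m. c i * slope_sup R (u i) r)"
proof (rule antisym)
  interpret w: radial_convex R "lincomb m c u" by (rule radial_convex_lincomb[OF u c]) (use r in auto)
  let ?B = "ball (0::'a) R"
  show "slope_sup R (lincomb m c u) r \<le> (\<Sum>i<m. c i * slope_sup R (u i) r)"
  proof (rule w.slope_sup_least[OF r(2)])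
    show "0 \<le> (\<Sum>i<m. c i * slope_sup R (u i) r)"
      using c radial_convex.slope_sup_nonneg[OF u] by (intro sum_nonneg mult_nonneg_nonneg) auto
    fix p x :: 'a assume x: "norm x < r" and p: "p \<in> subdifferential ?B (lincomb m c u) x"
    define t where "t = (norm x + r) / 2"
    have t: "norm x < t" "t < r" "0 \<le> t" "t < R" using x r by (auto simp: t_def)
    obtain z :: 'a where z: "norm z = t" using vector_choose_size[OF t(3)] by blast
    have zB: "z \<in> ?B" and xB: "x \<in> ?B" using z t x r by auto
    have each: "u i z - u i x \<le> slope_sup R (u i) r * (t - norm x)" if i: "i < m" for i
    proof -
      interpret radial_convex R "u i" by (rule u[OF i])
      obtain q where q: "q \<in> subdifferential ?B (u i) z"
        using subdifferential_nonempty[OF open_dom convex zB] by blast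
      have "u i z + norm q * (norm x - norm z) \<le> u i x" by (rule radial_subgradient[OF radial q xB])
      moreover have "norm q * (t - norm x) \<le> slope_sup R (u i) r * (t - norm x)"
        using slope_sup_upper[OF q _ r(2)] z t by (intro mult_right_mono) auto
      ultimately show ?thesis using z by (simp add: right_diff_distrib)
    qed
    have "norm p * (t - norm x) \<le> lincomb m c u z - lincomb m c u x"
      using radial_subgradient[OF w.radial p zB] z by simp
    also have "\<dots> = (\<Sum>i<m. c i * (u i z - u i x))"
      by (simp add: lincomb_def right_diff_distrib sum_subtractf)
    also have "\<dots> \<le> (\<Sum>i<m. c i * (slope_sup R (u i) r * (t - norm x)))"
      using each c by (intro sum_mono mult_left_mono) auto
    also have "\<dots> = (\<Sum>i<m. c i * slope_sup R (u i) r) * (t - norm x)"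
      by (simp add: sum_distrib_right mult.assoc)
    finally show "norm p \<le> (\<Sum>i<m. c i * slope_sup R (u i) r)" using t(1) by simp
  qed
  show "(\<Sum>i<m. c i * slope_sup R (u i) r) \<le> slope_sup R (lincomb m c u) r"
  proof (rule field_le_epsilon)
    fix e :: real assume e: "e > 0"
    \<comment> \<open>The error \<open>e'\<close> is multiplied by the sum of the coefficients; the
      \<open>1\<close> guards against a zero sum.\<close>
    define e' where "e' = e / (1 + (\<Sum>i<m. c i))"
    have C: "0 \<le> (\<Sum>i<m. c i)" using c by (intro sum_nonneg) auto
    have e': "e' > 0" using e C by (simp add: e'_def)
    have "\<exists>s. 0 \<le> s \<and> s < r \<and> (\<forall>t y q. s < t \<longrightarrow> norm y = t \<longrightarrow> y \<in> ?B \<longrightarrow> q \<in> subdifferential ?B (u i) y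
        \<longrightarrow> slope_sup R (u i) r - e' \<le> norm q)" if i: "i < m" for i
    proof -
      interpret radial_convex R "u i" by (rule u[OF i])
      show ?thesis
      proof (cases "slope_sup R (u i) r \<le> e'")
        case True
        then show ?thesis using r(1) by (intro exI[of _ 0]) (auto intro: order_trans[OF _ norm_ge_zero])
      next
        case False
        have "\<exists>p x. norm x < r \<and> p \<in> subdifferential ?B (u i) x \<and> slope_sup R (u i) r - e' < norm p"
        proof (rule ccontr)
          assume "\<not> ?thesis"
          then have "norm p \<le> slope_sup R (u i) r - e'" if "norm x < r" "p \<in> subdifferential ?B (u i) x" for p x
            using that by (meson not_less)
          then have "slope_sup R (u i) r \<le> slope_sup R (u i) r - e'"
            using False by (intro slope_sup_least[OF r(2)]) auto
          with e' show False by simp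
        qed
        then obtain p x where px: "norm x < r" "p \<in> subdifferential ?B (u i) x" "slope_sup R (u i) r - e' < norm p" by blast
        have "slope_sup R (u i) r - e' \<le> norm q"
          if "norm x < t" "norm y = t" "y \<in> ?B" "q \<in> subdifferential ?B (u i) y" for t y q
          using radial_subgradient_norm_mono[OF radial px(2) _ that(4,3)] that px r by simp
        then show ?thesis using px(1) by (intro exI[of _ "norm x"]) auto
      qed
    qed
    then obtain s where s: "\<And>i. i < m \<Longrightarrow> 0 \<le> s i" "\<And>i. i < m \<Longrightarrow> s i < r"
      "\<And>i t y q. i < m \<Longrightarrow> s i < t \<Longrightarrow> norm y = t \<Longrightarrow> y \<in> ?B \<Longrightarrow> q \<in> subdifferential ?B (u i) y
        \<Longrightarrow> slope_sup R (u i) r - e' \<le> norm q" by metis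
    \<comment> \<open>Beyond the radius \<open>s0\<close> the lower bound holds for all
      \<open>u i\<close> together.\<close>
    define s0 where "s0 = Max (insert 0 (s ` {..<m}))"
    have s0: "0 \<le> s0" "s0 < r" "\<And>i. i < m \<Longrightarrow> s i \<le> s0"
      using s(2) r(1) by (auto simp: s0_def)
    define a b where "a = s0 + (r - s0) / 3" and "b = s0 + 2 * (r - s0) / 3"
    have ab: "s0 < a" "a < b" "b < r" "0 \<le> a" "0 \<le> b" using s0(1,2) by (auto simp: a_def b_def field_simps)
    obtain y :: 'a where y: "norm y = a" using vector_choose_size[OF ab(4)] by blast
    obtain z :: 'a where z: "norm z = b" using vector_choose_size[OF ab(5)] by blast
    have yB: "y \<in> ?B" and zB: "z \<in> ?B" using y z ab r by auto
    obtain p where p: "p \<in> subdifferential ?B (lincomb m c u) z"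
      using subdifferential_nonempty[OF w.open_dom w.convex zB] by blast
    have each: "(slope_sup R (u i) r - e') * (b - a) \<le> u i z - u i y" if i: "i < m" for i
    proof -
      interpret radial_convex R "u i" by (rule u[OF i])
      obtain q where q: "q \<in> subdifferential ?B (u i) y"
        using subdifferential_nonempty[OF open_dom convex yB] by blast
      have "slope_sup R (u i) r - e' \<le> norm q"
        using s(3)[OF i _ y yB q] s0(3)[OF i] ab(1) by simp
      then have "(slope_sup R (u i) r - e') * (b - a) \<le> norm q * (b - a)"
        using ab by (intro mult_right_mono) auto
      also have "\<dots> \<le> u i z - u i y" using radial_subgradient[OF radial q zB] y z by simp
      finally show ?thesis .
    qed
    have "(\<Sum>i<m. c i * (slope_sup R (u i) r - e')) * (b - a) = (\<Sum>i<m. c i * ((slope_sup R (u i) r - e') * (b - a)))"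
      by (simp add: sum_distrib_right mult.assoc)
    also have "\<dots> \<le> (\<Sum>i<m. c i * (u i z - u i y))"
      using each c by (intro sum_mono mult_left_mono) auto
    also have "\<dots> = lincomb m c u z - lincomb m c u y"
      by (simp add: lincomb_def right_diff_distrib sum_subtractf)
    also have "\<dots> \<le> norm p * (b - a)"
      using radial_subgradient[OF w.radial p yB] y z by (simp add: right_diff_distrib)
    finally have "(\<Sum>i<m. c i * (slope_sup R (u i) r - e')) \<le> norm p" using ab(2) by simp
    also have "\<dots> \<le> slope_sup R (lincomb m c u) r"
      using w.slope_sup_upper[OF p _ r(2)] z ab by simp
    finally have "(\<Sum>i<m. c i * slope_sup R (u i) r) \<le> slope_sup R (lincomb m c u) r + (\<Sum>i<m. c i) * e'"
      by (simp add: right_diff_distrib sum_subtractf sum_distrib_right)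
    also have "(\<Sum>i<m. c i) * e' \<le> e"
      using C e by (simp add: e'_def field_simps)
    finally show "(\<Sum>i<m. c i * slope_sup R (u i) r) \<le> slope_sup R (lincomb m c u) r + e" by simp
  qed
qed

lemma sum_power_tuples:
  fixes a :: "nat \<Rightarrow> real"
  assumes "finite I"
  shows "(\<Sum>i\<in>I. a i) ^ CARD('n::finite) = (\<Sum>is\<in>tuples CARD('n) I. prod_list (map a is))"
proof -
  have "(\<Sum>i\<in>I. a i) ^ CARD('n) = (\<Prod>j\<in>(UNIV :: 'n set). \<Sum>i\<in>I. a i)" by simp
  also have "\<dots> = (\<Sum>f\<in>(UNIV :: 'n set) \<rightarrow>\<^sub>E I. \<Prod>j\<in>UNIV. a (f j))"
    using assms by (intro prod_sum_PiE) auto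
  also have "\<dots> = (\<Sum>is\<in>tuples CARD('n) I. \<Prod>j\<in>(UNIV :: 'n set). a (is ! enum_index j))"
    using sum.reindex_bij_betw[OF bij_betw_tuples_functions[where 'n='n and A=I], of "\<lambda>f. \<Prod>j\<in>UNIV. a (f j)"] by simp
  also have "\<dots> = (\<Sum>is\<in>tuples CARD('n) I. prod_list (map a is))"
    by (intro sum.cong refl) (auto simp: tuples_def prod_list_enum[where 'n='n])
  finally show ?thesis .
qed

text \<open>Slopes are additive, so the mass of a combination is \<open>kappa\<close> times the
  \<open>n\<close>-th power of a linear form in the coefficients; the polarization of such a power
  is the product of the individual slopes.\<close>

lemma mixed_ma_ball:
  fixes us :: "(real^'n \<Rightarrow> real) list"
  assumes us: "length us = CARD('n)" "\<And>u. u \<in> set us \<Longrightarrow> radial_convex R u" and r: "0 < r" "r < R"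
  shows "mixed_ma (ball 0 R) us (ball 0 r)
    = kappa TYPE(real^'n) * prod_list (map (\<lambda>u. slope_sup R u r) us)"
proof -
  let ?n = "CARD('n)" and ?\<kappa> = "kappa TYPE(real^'n)"
  define P where "P j = slope_sup R (us ! j) r" for j
  have rc: "radial_convex R (us ! j)" if "j < ?n" for j using us that by simp
  have "enn2real (monge_ampere (ball 0 R) (lincomb ?n (ind S) ((!) us)) (ball 0 r))
      = (\<Sum>js\<in>tuples ?n S. ?\<kappa> * prod_list (map P js))" if S: "S \<subseteq> {..<?n}" for S
  proof -
    interpret radial_convex R "lincomb ?n (ind S) ((!) us)"
      by (rule radial_convex_lincomb) (use rc r in auto)
    have "slope_sup R (lincomb ?n (ind S) ((!) us)) r = (\<Sum>j<?n. ind S j * P j)"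
      unfolding P_def by (rule slope_sup_lincomb) (use rc r in auto)
    also have "\<dots> = (\<Sum>j<?n. if j \<in> S then P j else 0)" by (intro sum.cong) auto
    also have "\<dots> = (\<Sum>j\<in>S. P j)" using S by (simp add: sum.If_cases Int_absorb1)
    finally show ?thesis
      using monge_ampere_ball[OF r(2)] finite_subset[OF S]
      by (simp add: sum_power_tuples sum_distrib_left)
  qed
  then have "mixed_ma (ball 0 R) us (ball 0 r) = polarization ?n (\<lambda>S. \<Sum>js\<in>tuples ?n S. ?\<kappa> * prod_list (map P js))"
    by (simp add: mixed_ma_def polarization_def)
  also have "\<dots> = ?\<kappa> * (\<Prod>j<?n. P j)"
  proof (rule polarization_tuples_symmetric)
    fix js assume "js \<in> permutations_of_set {..<?n}"
    then have "set js = {..<?n}" "distinct js" by (auto simp: permutations_of_set_def)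
    then show "?\<kappa> * prod_list (map P js) = ?\<kappa> * (\<Prod>j<?n. P j)"
      using prod.distinct_set_conv_list[of js P] by simp
  qed
  also have "(\<Prod>j<?n. P j) = prod_list (map (\<lambda>u. slope_sup R u r) us)"
    using us(1) by (simp add: P_def prod.list_conv_set_nth lessThan_atLeast0)
  finally show ?thesis .
qed

section \<open>Orthogonal invariance\<close>

lemma subdifferential_orthogonal_image:
  fixes f :: "'a::euclidean_space \<Rightarrow> 'a"
  assumes f: "orthogonal_transformation f" and rad: "radially_symmetric_on (ball 0 R) v" and x: "x \<in> ball 0 R"
  shows "subdifferential (ball 0 R) v (f x) = f ` subdifferential (ball 0 R) v x"
proof -
  have inner: "f a \<bullet> f b = a \<bullet> b" for a b using f by (simp add: orthogonal_transformation_def)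
  have lin: "linear f" by (rule orthogonal_transformation_linear[OF f])
  have nf: "norm (f a) = norm a" for a by (rule orthogonal_transformation_norm[OF f])
  have val: "v (f a) = v a" if "a \<in> ball 0 R" for a
    by (rule radially_symmetric_onD[OF rad]) (use that nf in auto)
  have surj: "\<exists>a. b = f a" for b using orthogonal_transformation_surj[OF f] by (metis surjD)
  have iff: "f p \<in> subdifferential (ball 0 R) v (f x) \<longleftrightarrow> p \<in> subdifferential (ball 0 R) v x" for p
  proof -
    have e1: "(v (f x) + f p \<bullet> (f z - f x) \<le> v (f z)) = (v x + p \<bullet> (z - x) \<le> v z)" if "z \<in> ball 0 R" for z
      using val[OF that] val[OF x] by (simp add: inner linear_diff[OF lin, symmetric])
    have e2: "(\<forall>b\<in>ball 0 R. Q b) \<longleftrightarrow> (\<forall>z\<in>ball 0 R. Q (f z))" for Q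
    proof
      assume "\<forall>z\<in>ball 0 R. Q (f z)"
      show "\<forall>b\<in>ball 0 R. Q b"
      proof
        fix b :: 'a assume b: "b \<in> ball 0 R"
        obtain z where "b = f z" using surj by blast
        with b nf \<open>\<forall>z\<in>ball 0 R. Q (f z)\<close> show "Q b" by simp
      qed
    qed (simp add: nf)
    show ?thesis
      unfolding subdifferential_def mem_Collect_eq e2[of "\<lambda>b. v (f x) + f p \<bullet> (b - f x) \<le> v b"]
      by (intro ball_cong refl e1)
  qed
  show ?thesis
  proof (rule set_eqI)
    fix b
    obtain a where a: "b = f a" using surj by blast
    show "b \<in> subdifferential (ball 0 R) v (f x) \<longleftrightarrow> b \<in> f ` subdifferential (ball 0 R) v x"
      unfolding a iff using inj_image_mem_iff[OF orthogonal_transformation_inj[OF f]] by simp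
  qed
qed

text \<open>The set of slopes is moved by the same orthogonal map as the set of base points, and
  Lebesgue measure is invariant.\<close>

lemma monge_ampere_orthogonal_image:
  fixes f :: "real^'n \<Rightarrow> real^'n"
  assumes f: "orthogonal_transformation f" and v: "radial_convex R v"
    and A: "open A" "A \<subseteq> ball 0 R"
  shows "monge_ampere (ball 0 R) v (f ` A) = monge_ampere (ball 0 R) v A"
proof -
  interpret radial_convex R v by (rule v)
  let ?g = "inv f"
  have g: "orthogonal_transformation ?g" by (rule orthogonal_transformation_inv[OF f])
  have bf: "bij f" by (rule orthogonal_transformation_bij[OF f])
  have gm: "?g \<in> borel_measurable borel"
    using g by (intro borel_measurable_continuous_onI linear_continuous_on)
      (simp add: orthogonal_transformation_linear linear_conv_bounded_linear[symmetric])
  have TA: "T A \<in> sets borel" by (rule gradient_image_open_borel[OF A])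
  have "T (f ` A) = f ` T A"
  proof -
    have "subdifferential (ball 0 R) v (f x) = f ` subdifferential (ball 0 R) v x" if "x \<in> A" for x
      by (rule subdifferential_orthogonal_image[OF f radial]) (use A(2) that in blast)
    then show ?thesis by (simp add: gradient_image_def image_UN)
  qed
  also have "\<dots> = ?g -` T A" using bij_vimage_eq_inv_image[OF bij_imp_bij_inv[OF bf]] by (simp add: inv_inv_eq[OF bf])
  finally have img: "T (f ` A) = ?g -` T A" .
  then have TfA: "T (f ` A) \<in> sets borel" using measurable_sets[OF gm TA] by simp
  have "emeasure lborel (T A) = emeasure (distr lborel borel ?g) (T A)"
    by (simp add: lborel_distr_orthogonal[OF g])
  also have "\<dots> = emeasure lborel (T (f ` A))" using gm TA by (simp add: emeasure_distr img)
  finally have "emeasure lebesgue (T (f ` A)) = emeasure lebesgue (T A)"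
    using TA TfA by simp
  then show ?thesis by (simp add: monge_ampere_def gradient_image_def)
qed

lemma mixed_ma_orthogonal_image:
  fixes f :: "real^'n \<Rightarrow> real^'n" and us :: "(real^'n \<Rightarrow> real) list"
  assumes f: "orthogonal_transformation f" and us: "length us = CARD('n)" "\<And>u. u \<in> set us \<Longrightarrow> radial_convex R u"
    and R: "0 < R" and A: "open A" "A \<subseteq> ball 0 R"
  shows "mixed_ma (ball 0 R) us (f ` A) = mixed_ma (ball 0 R) us A"
proof -
  have "radial_convex R (lincomb CARD('n) (ind S) ((!) us))" for S
    by (rule radial_convex_lincomb) (use us R in auto)
  then show ?thesis
    unfolding mixed_ma_def using monge_ampere_orthogonal_image[OF f _ A] by simp
qed

section \<open>Rotationally invariant measures\<close>

definition rotation :: "(real^'n \<Rightarrow> real^'n) \<Rightarrow> bool" where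
  "rotation f \<longleftrightarrow> orthogonal_transformation f \<and> det (matrix f) = 1"

text \<open>Here dimension at least two enters: on the line the only rotation is the identity, which
  does not connect the two points of equal norm.\<close>

lemma rotation_exists:
  fixes x y :: "real^'n"
  assumes n: "2 \<le> CARD('n)" and eq: "norm x = norm y"
  shows "\<exists>f. rotation f \<and> f x = y"
proof (cases "x = 0")
  case True
  then have "rotation (\<lambda>x. x) \<and> x = y" using eq by (simp add: rotation_def matrix_id_mat_1[unfolded id_def])
  then show ?thesis by blast
next
  case False
  then have y: "y \<noteq> 0" using eq by auto
  have "norm (x /\<^sub>R norm x) = 1" "norm (y /\<^sub>R norm y) = 1" using False y by auto
  then obtain f where f: "orthogonal_transformation f" "det (matrix f) = 1" "f (x /\<^sub>R norm x) = y /\<^sub>R norm y"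
    using rotation_exists_1[OF n] by metis
  have "f x = f (norm x *\<^sub>R (x /\<^sub>R norm x))" using False by simp
  also have "\<dots> = norm x *\<^sub>R f (x /\<^sub>R norm x)"
    by (rule linear_scale[OF orthogonal_transformation_linear[OF f(1)]])
  also have "\<dots> = y" using f(3) y eq by simp
  finally show ?thesis using f by (auto simp: rotation_def)
qed

text \<open>Integrals of radial functions depend only on the distribution of the norm. The minus
  sign turns centred open balls into upper rays, whose masses determine a finite distribution on the
  line.\<close>

lemma nn_integral_radial_eq:
  fixes M N :: "(real^'n) measure" and c :: "real^'n \<Rightarrow> ennreal"
  assumes M: "finite_measure M" "sets M = sets borel" and N: "finite_measure N" "sets N = sets borel"
    and balls: "\<And>r. emeasure M (ball 0 r) = emeasure N (ball 0 r)"
    and c: "c \<in> borel_measurable borel" "\<And>x y. norm x = norm y \<Longrightarrow> c x = c y"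
  shows "(\<integral>\<^sup>+x. c x \<partial>M) = (\<integral>\<^sup>+x. c x \<partial>N)"
proof -
  note [measurable_cong] = M(2) N(2)
  have sp: "space M = UNIV" "space N = UNIV" using sets_eq_imp_space_eq[OF M(2)] sets_eq_imp_space_eq[OF N(2)] by simp_all
  have pre: "(\<lambda>x::real^'n. - norm x) -` {t<..} = ball 0 (- t)" for t by auto
  have mm: "(\<lambda>x::real^'n. - norm x) \<in> borel_measurable M" "(\<lambda>x::real^'n. - norm x) \<in> borel_measurable N"
    by measurable
  have "distr M borel (\<lambda>x. - norm x) = distr N borel (\<lambda>x. - norm x)"
  proof (rule measure_eqI_lessThan)
    fix t :: real
    have eM: "emeasure (distr M borel (\<lambda>x. - norm x)) {t<..} = emeasure M (ball 0 (- t))"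
      using mm by (simp add: emeasure_distr sp pre)
    have eN: "emeasure (distr N borel (\<lambda>x. - norm x)) {t<..} = emeasure N (ball 0 (- t))"
      using mm by (simp add: emeasure_distr sp pre)
    show "emeasure (distr M borel (\<lambda>x. - norm x)) {t<..} < \<infinity>"
      unfolding eM using finite_measure.emeasure_finite[OF M(1)] by (simp add: top.not_eq_extremum)
    show "emeasure (distr M borel (\<lambda>x. - norm x)) {t<..} = emeasure (distr N borel (\<lambda>x. - norm x)) {t<..}"
      unfolding eM eN by (rule balls)
  qed auto
  then have eq: "(\<integral>\<^sup>+t. g t \<partial>distr M borel (\<lambda>x. - norm x)) = (\<integral>\<^sup>+t. g t \<partial>distr N borel (\<lambda>x. - norm x))"
    for g :: "real \<Rightarrow> ennreal" by simp
  obtain e :: "real^'n" where e: "norm e = 1" using vector_choose_size[of 1] by auto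
  define g where "g t = c (t *\<^sub>R e)" for t
  have g: "g \<in> borel_measurable borel" unfolding g_def using c(1) by measurable
  have "g (- norm x) = c x" for x unfolding g_def by (rule c(2)) (simp add: e)
  then show ?thesis
    using eq[of g] g mm by (simp add: nn_integral_distr)
qed

text \<open>Tonelli for the symmetric kernel that indicates
  \<open>dist z y < \<delta>\<close>.\<close>

lemma nn_integral_ball_swap:
  fixes M :: "(real^'n) measure" and c :: "real^'n \<Rightarrow> ennreal"
  assumes M: "finite_measure M" "sets M = sets borel" and c: "c \<in> borel_measurable borel"
  shows "(\<integral>\<^sup>+z. c z * emeasure M (ball z \<delta>) \<partial>lborel)
    = (\<integral>\<^sup>+y. (\<integral>\<^sup>+z. c z * indicator (ball y \<delta>) z \<partial>lborel) \<partial>M)"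
proof -
  note [measurable_cong] = M(2)
  interpret M: finite_measure M by (rule M(1))
  interpret pair_sigma_finite lborel M ..
  have op: "{p :: (real^'n) \<times> (real^'n). dist (fst p) (snd p) < \<delta>} \<in> sets (borel \<Otimes>\<^sub>M borel)"
    unfolding borel_prod by (intro borel_open open_Collect_less continuous_intros)
  then have "(\<lambda>p. indicator {p :: (real^'n) \<times> (real^'n). dist (fst p) (snd p) < \<delta>} p :: ennreal)
      \<in> borel_measurable (borel \<Otimes>\<^sub>M borel)" by simp
  moreover have "sets (lborel \<Otimes>\<^sub>M M) = sets (borel \<Otimes>\<^sub>M borel)"
    by (intro sets_pair_measure_cong) (simp_all add: M(2))
  ultimately have ind: "(\<lambda>p. indicator {p :: (real^'n) \<times> (real^'n). dist (fst p) (snd p) < \<delta>} p :: ennreal)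
      \<in> borel_measurable (lborel \<Otimes>\<^sub>M M)" by (simp cong: measurable_cong_sets)
  have "(\<integral>\<^sup>+z. c z * emeasure M (ball z \<delta>) \<partial>lborel)
      = (\<integral>\<^sup>+z. (\<integral>\<^sup>+y. c z * indicator {p. dist (fst p) (snd p) < \<delta>} (z, y) \<partial>M) \<partial>lborel)"
  proof (rule nn_integral_cong)
    fix z
    have "(\<integral>\<^sup>+y. c z * indicator {p. dist (fst p) (snd p) < \<delta>} (z, y) \<partial>M) = (\<integral>\<^sup>+y. c z * indicator (ball z \<delta>) y \<partial>M)"
      by (intro nn_integral_cong) (auto simp: indicator_def)
    also have "\<dots> = c z * emeasure M (ball z \<delta>)"
      by (rule nn_integral_cmult_indicator) (simp add: M(2))
    finally show "c z * emeasure M (ball z \<delta>) = (\<integral>\<^sup>+y. c z * indicator {p. dist (fst p) (snd p) < \<delta>} (z, y) \<partial>M)" by simp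
  qed
  also have "\<dots> = (\<integral>\<^sup>+y. (\<integral>\<^sup>+z. c z * indicator {p. dist (fst p) (snd p) < \<delta>} (z, y) \<partial>lborel) \<partial>M)"
    by (rule Fubini'[symmetric]) (use ind c in \<open>simp add: split_def\<close>)
  also have "\<dots> = (\<integral>\<^sup>+y. (\<integral>\<^sup>+z. c z * indicator (ball y \<delta>) z \<partial>lborel) \<partial>M)"
    by (intro nn_integral_cong) (auto simp: indicator_def dist_commute)
  finally show ?thesis .
qed

lemma measurable_ball_measure:
  fixes M :: "(real^'n) measure"
  assumes M: "finite_measure M" "sets M = sets borel"
  shows "(\<lambda>z. emeasure M (ball z \<delta>)) \<in> borel_measurable borel"
proof -
  interpret M: finite_measure M by (rule M(1))
  have "{p :: (real^'n) \<times> (real^'n). dist (fst p) (snd p) < \<delta>} \<in> sets (borel \<Otimes>\<^sub>M borel)"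
    unfolding borel_prod by (intro borel_open open_Collect_less continuous_intros)
  moreover have "sets ((borel :: (real^'n) measure) \<Otimes>\<^sub>M M) = sets (borel \<Otimes>\<^sub>M borel)"
    by (intro sets_pair_measure_cong) (simp_all add: M(2))
  ultimately have "(\<lambda>z. emeasure M (Pair z -` {p :: (real^'n) \<times> (real^'n). dist (fst p) (snd p) < \<delta>})) \<in> borel_measurable borel"
    by (intro M.measurable_emeasure_Pair) simp
  moreover have "Pair z -` {p :: (real^'n) \<times> (real^'n). dist (fst p) (snd p) < \<delta>} = ball z \<delta>" for z by auto
  ultimately show ?thesis by simp
qed

lemma nn_integral_lborel_orthogonal:
  fixes f :: "real^'n \<Rightarrow> real^'n"
  assumes f: "orthogonal_transformation f" and c: "c \<in> borel_measurable borel"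
  shows "(\<integral>\<^sup>+z. c (f z) \<partial>lborel) = (\<integral>\<^sup>+z. c z \<partial>lborel)"
proof -
  have fm: "f \<in> borel_measurable borel"
    using f by (intro borel_measurable_continuous_onI linear_continuous_on)
      (simp add: orthogonal_transformation_linear linear_conv_bounded_linear[symmetric])
  have "(\<integral>\<^sup>+z. c z \<partial>lborel) = (\<integral>\<^sup>+z. c z \<partial>distr lborel borel f)"
    by (simp add: lborel_distr_orthogonal[OF f])
  also have "\<dots> = (\<integral>\<^sup>+z. c (f z) \<partial>lborel)"
    using fm c by (intro nn_integral_distr) auto
  finally show ?thesis by simp
qed

text \<open>Let \<open>a\<close> and \<open>b\<close> be the masses of
  \<open>ball z \<delta>\<close> as functions of \<open>z\<close>. Both are radial, and for radial
  \<open>c\<close> the integral of \<open>c * a\<close> is by Tonelli the \<open>M\<close>-integral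
  of a radial function, hence unchanged when \<open>M\<close> is replaced by \<open>N\<close>. With
  \<open>c = a\<close> and \<open>c = b\<close>, the integrals of \<open>a * a\<close>,
  \<open>a * b\<close> and \<open>b * b\<close> agree, so the squared difference integrates to
  0.\<close>

lemma ball_measures_eq_AE:
  fixes M N :: "(real^'n) measure"
  assumes n: "2 \<le> CARD('n)"
    and M: "finite_measure M" "sets M = sets borel" and N: "finite_measure N" "sets N = sets borel"
    and invM: "\<And>f A. rotation f \<Longrightarrow> open A \<Longrightarrow> emeasure M (f ` A) = emeasure M A"
    and invN: "\<And>f A. rotation f \<Longrightarrow> open A \<Longrightarrow> emeasure N (f ` A) = emeasure N A"
    and balls: "\<And>r. emeasure M (ball 0 r) = emeasure N (ball 0 r)"
  shows "AE z in lborel. measure M (ball z \<delta>) = measure N (ball z \<delta>)"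
proof -
  interpret M: finite_measure M by (rule M(1))
  interpret N: finite_measure N by (rule N(1))
  let ?a = "\<lambda>z. emeasure M (ball z \<delta>)" and ?b = "\<lambda>z. emeasure N (ball z \<delta>)"
  have radial: "emeasure P (ball x \<delta>) = emeasure P (ball y \<delta>)"
    if inv: "\<And>f A. rotation f \<Longrightarrow> open A \<Longrightarrow> emeasure P (f ` A) = emeasure P A" and xy: "norm x = norm y"
    for P :: "(real^'n) measure" and x y
  proof -
    obtain f where f: "rotation f" "f x = y" using rotation_exists[OF n xy] by blast
    have "f ` ball x \<delta> = ball y \<delta>"
      using image_orthogonal_transformation_ball[of f x \<delta>] f by (simp add: rotation_def)
    then show ?thesis using inv[OF f(1) open_ball, of x \<delta>] by simp
  qed
  have am: "?a \<in> borel_measurable borel" by (rule measurable_ball_measure[OF M])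
  have bm: "?b \<in> borel_measurable borel" by (rule measurable_ball_measure[OF N])
  have swap: "(\<integral>\<^sup>+z. c z * ?a z \<partial>lborel) = (\<integral>\<^sup>+z. c z * ?b z \<partial>lborel)"
    if c: "c \<in> borel_measurable borel" "\<And>x y. norm x = norm y \<Longrightarrow> c x = c y" for c :: "real^'n \<Rightarrow> ennreal"
  proof -
    let ?k = "\<lambda>y. \<integral>\<^sup>+z. c z * indicator (ball y \<delta>) z \<partial>lborel"
    have krad: "?k x = ?k y" if xy: "norm x = norm y" for x y
    proof -
      obtain f where f: "rotation f" "f x = y" using rotation_exists[OF n xy] by blast
      then have o: "orthogonal_transformation f" by (simp add: rotation_def)
      have "?k y = (\<integral>\<^sup>+z. c (f z) * indicator (ball y \<delta>) (f z) \<partial>lborel)"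
        using nn_integral_lborel_orthogonal[OF o, of "\<lambda>z. c z * indicator (ball y \<delta>) z"] c(1)
        by (simp only: borel_measurable_times_ennreal borel_measurable_indicator borel_open open_ball)
      also have "\<dots> = ?k x"
      proof (intro nn_integral_cong arg_cong2[where f="(*)"])
        fix z
        show "c (f z) = c z" by (rule c(2)) (rule orthogonal_transformation_norm[OF o])
        have "dist y (f z) = dist x z"
          using f(2) orthogonal_transformation_norm[OF o, of "x - z"]
          by (simp add: dist_norm linear_diff[OF orthogonal_transformation_linear[OF o]])
        then show "(indicator (ball y \<delta>) (f z) :: ennreal) = indicator (ball x \<delta>) z"
          by (simp add: indicator_def)
      qed
      finally show ?thesis by simp
    qed
    have km: "?k \<in> borel_measurable borel"
    proof -
      have "{p :: (real^'n) \<times> (real^'n). dist (fst p) (snd p) < \<delta>} \<in> sets (borel \<Otimes>\<^sub>M borel)"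
        unfolding borel_prod by (intro borel_open open_Collect_less continuous_intros)
      then have "(\<lambda>p. c (snd p) * indicator {p :: (real^'n) \<times> (real^'n). dist (fst p) (snd p) < \<delta>} p :: ennreal)
          \<in> borel_measurable (borel \<Otimes>\<^sub>M borel)" using c(1) by measurable
      then have "(\<lambda>p. c (snd p) * indicator {p :: (real^'n) \<times> (real^'n). dist (fst p) (snd p) < \<delta>} p :: ennreal)
          \<in> borel_measurable (borel \<Otimes>\<^sub>M lborel)"
        by (simp cong: measurable_cong_sets sets_pair_measure_cong)
      from lborel.borel_measurable_nn_integral_fst[OF this] show ?thesis
        by (simp add: indicator_def)
    qed
    show ?thesis
      unfolding nn_integral_ball_swap[OF M c(1)] nn_integral_ball_swap[OF N c(1)]
      by (rule nn_integral_radial_eq[OF M N balls km krad])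
  qed
  have aa: "(\<integral>\<^sup>+z. ?a z * ?a z \<partial>lborel) = (\<integral>\<^sup>+z. ?a z * ?b z \<partial>lborel)"
    by (rule swap[OF am]) (rule radial[OF invM])
  have bb: "(\<integral>\<^sup>+z. ?b z * ?a z \<partial>lborel) = (\<integral>\<^sup>+z. ?b z * ?b z \<partial>lborel)"
    by (rule swap[OF bm]) (rule radial[OF invN])
  let ?ra = "\<lambda>z. measure M (ball z \<delta>)" and ?rb = "\<lambda>z. measure N (ball z \<delta>)"
  have ram: "?ra \<in> borel_measurable borel" and rbm: "?rb \<in> borel_measurable borel"
    using am bm unfolding measure_def by measurable
  \<comment> \<open>Finiteness: one factor is bounded by the total mass, and the other integrates to
    the total mass times the volume of a ball.\<close>
  have "(\<integral>\<^sup>+z. ?a z * ?a z \<partial>lborel) \<le> (\<integral>\<^sup>+z. emeasure M UNIV * ?a z \<partial>lborel)"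
    using M(2) by (intro nn_integral_mono mult_right_mono emeasure_mono) auto
  also have "\<dots> = (\<integral>\<^sup>+y. (\<integral>\<^sup>+z. emeasure M UNIV * indicator (ball y \<delta>) z \<partial>lborel) \<partial>M)"
    by (rule nn_integral_ball_swap[OF M]) simp
  also have "\<dots> = (\<integral>\<^sup>+y. emeasure M UNIV * emeasure lborel (ball (0::real^'n) \<delta>) \<partial>M)"
  proof (rule nn_integral_cong)
    fix y :: "real^'n"
    have "emeasure lborel (ball y \<delta>) = emeasure lborel (ball (0::real^'n) \<delta>)"
      by (cases "0 \<le> \<delta>") (simp_all add: emeasure_ball ball_empty)
    then show "(\<integral>\<^sup>+z. emeasure M UNIV * indicator (ball y \<delta>) z \<partial>lborel) = emeasure M UNIV * emeasure lborel (ball (0::real^'n) \<delta>)"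
      by (simp add: nn_integral_cmult_indicator)
  qed
  also have "\<dots> < \<infinity>"
    using emeasure_lborel_ball_finite[of "0::real^'n" \<delta>]
    by (simp add: ennreal_mult_eq_top_iff less_top[symmetric])
  finally have finaa: "(\<integral>\<^sup>+z. ?a z * ?a z \<partial>lborel) < \<infinity>" .
  have finab: "(\<integral>\<^sup>+z. ?a z * ?b z \<partial>lborel) < \<infinity>" using finaa aa by simp
  have finbb: "(\<integral>\<^sup>+z. ?b z * ?b z \<partial>lborel) < \<infinity>" using finab bb by (simp add: mult.commute)
  have iaa: "integrable lborel (\<lambda>z. ?ra z * ?ra z)"
    using finaa ram by (intro integrableI_bounded) (simp_all add: M.emeasure_eq_measure ennreal_mult abs_mult)
  have iab: "integrable lborel (\<lambda>z. ?ra z * ?rb z)"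
    using finab ram rbm by (intro integrableI_bounded) (simp_all add: M.emeasure_eq_measure N.emeasure_eq_measure ennreal_mult abs_mult)
  have ibb: "integrable lborel (\<lambda>z. ?rb z * ?rb z)"
    using finbb rbm by (intro integrableI_bounded) (simp_all add: N.emeasure_eq_measure ennreal_mult abs_mult)
  have eq1: "(\<integral>z. ?ra z * ?ra z \<partial>lborel) = (\<integral>z. ?ra z * ?rb z \<partial>lborel)"
    using aa ram rbm by (simp add: integral_eq_nn_integral M.emeasure_eq_measure N.emeasure_eq_measure ennreal_mult)
  have eq2: "(\<integral>z. ?rb z * ?rb z \<partial>lborel) = (\<integral>z. ?ra z * ?rb z \<partial>lborel)"
    using bb ram rbm by (simp add: integral_eq_nn_integral M.emeasure_eq_measure N.emeasure_eq_measure ennreal_mult mult.commute)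
  have sq: "(?ra z - ?rb z)\<^sup>2 = ?ra z * ?ra z - 2 * (?ra z * ?rb z) + ?rb z * ?rb z" for z
    by (simp add: power2_eq_square algebra_simps)
  have int: "integrable lborel (\<lambda>z. (?ra z - ?rb z)\<^sup>2)"
    unfolding sq using iaa iab ibb by (intro Bochner_Integration.integrable_add Bochner_Integration.integrable_diff integrable_mult_right) auto
  moreover have "(\<integral>z. (?ra z - ?rb z)\<^sup>2 \<partial>lborel) = 0"
    unfolding sq using iaa iab ibb eq1 eq2 by simp
  ultimately have "AE z in lborel. (?ra z - ?rb z)\<^sup>2 = 0"
    using integral_nonneg_eq_0_iff_AE[OF int] by simp
  then show ?thesis by simp
qed

text \<open>
  Both measures give the same mass to almost every ball of each radius; averaging over the
  centres in an open set and shrinking the radius recovers the mass of that set.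
\<close>

theorem rotation_invariant_measure_eqI:
  fixes M N :: "(real^'n) measure"
  assumes n: "2 \<le> CARD('n)"
    and M: "finite_measure M" "sets M = sets borel" and N: "finite_measure N" "sets N = sets borel"
    and invM: "\<And>f A. rotation f \<Longrightarrow> open A \<Longrightarrow> emeasure M (f ` A) = emeasure M A"
    and invN: "\<And>f A. rotation f \<Longrightarrow> open A \<Longrightarrow> emeasure N (f ` A) = emeasure N A"
    and balls: "\<And>r. emeasure M (ball 0 r) = emeasure N (ball 0 r)"
  shows "M = N"
proof -
  have open_eq: "measure M A = measure N A"
    if A: "open A" and fr: "emeasure M (frontier A) = 0" "emeasure N (frontier A) = 0" for A
  proof -
    define \<delta> where "\<delta> j = 1 / real (Suc j)" for j
    have dpos: "\<delta> j > 0" for j by (simp add: \<delta>_def)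
    define V where "V j = measure lborel (ball (0::real^'n) (\<delta> j))" for j
    have Vpos: "V j > 0" for j unfolding V_def using dpos by (simp add: content_ball_gt_0_iff)
    \<comment> \<open>The share of the ball about \<open>y\<close> that lies in \<open>A\<close>; it
      tends to the indicator of \<open>A\<close> away from the frontier.\<close>
    define g where "g j y = measure lborel (A \<inter> ball y (\<delta> j)) / V j" for j y
    have Vy: "measure lborel (ball y (\<delta> j)) = V j" for y :: "real^'n" and j
      using dpos[of j] by (simp add: V_def content_ball)
    have lm: "A \<inter> ball y (\<delta> j) \<in> fmeasurable lborel" for y j
    proof (rule fmeasurableI2)
      show "ball y (\<delta> j) \<in> fmeasurable lborel"
        using emeasure_lborel_ball_finite[of y "\<delta> j"] by (simp add: fmeasurable_def)
    qed (use A in auto)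
    have g01: "0 \<le> g j y" "g j y \<le> 1" for j y
    proof -
      show "0 \<le> g j y" using Vpos[of j] by (simp add: g_def)
      have "measure lborel (A \<inter> ball y (\<delta> j)) \<le> measure lborel (ball y (\<delta> j))"
        using A emeasure_lborel_ball_finite[of y "\<delta> j"]
        by (intro measure_mono_fmeasurable) (auto simp: fmeasurable_def)
      then show "g j y \<le> 1" using Vpos[of j] by (simp add: g_def Vy)
    qed
    have d0: "\<delta> \<longlonglongrightarrow> 0" unfolding \<delta>_def using LIMSEQ_Suc[OF lim_const_over_n[of 1]] by simp
    have lim: "(\<lambda>j. g j y) \<longlonglongrightarrow> indicator A y" if y: "y \<notin> frontier A" for y
    proof (cases "y \<in> A")
      case True
      then obtain e where e: "e > 0" "ball y e \<subseteq> A" using A open_contains_ball_eq by blast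
      have "eventually (\<lambda>j. \<delta> j < e) sequentially" using order_tendstoD(2)[OF d0 e(1)] .
      then have "eventually (\<lambda>j. g j y = indicator A y) sequentially"
      proof eventually_elim
        case (elim j)
        then have "A \<inter> ball y (\<delta> j) = ball y (\<delta> j)" using e(2) subset_ball[of "\<delta> j" e y] by auto
        then show ?case using True Vpos[of j] by (simp add: g_def Vy)
      qed
      then show ?thesis by (rule tendsto_eventually)
    next
      case False
      then have "y \<notin> closure A" using y A by (auto simp: frontier_def interior_open)
      then obtain e where e: "e > 0" "ball y e \<subseteq> - closure A"
        using open_contains_ball_eq[of "- closure A"] by auto
      have "eventually (\<lambda>j. \<delta> j < e) sequentially" using order_tendstoD(2)[OF d0 e(1)] .
      then have "eventually (\<lambda>j. g j y = indicator A y) sequentially"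
      proof eventually_elim
        case (elim j)
        then have "A \<inter> ball y (\<delta> j) = {}" using e(2) subset_ball[of "\<delta> j" e y] closure_subset[of A] by auto
        then show ?case using False by (simp add: g_def)
      qed
      then show ?thesis by (rule tendsto_eventually)
    qed
    have gint: "(\<integral>\<^sup>+z. indicator A z * emeasure P (ball z (\<delta> j)) \<partial>lborel) = (\<integral>\<^sup>+y. ennreal (V j * g j y) \<partial>P)"
      if P: "finite_measure P" "sets P = sets borel" for P j
    proof -
      have "(\<integral>\<^sup>+z. indicator A z * emeasure P (ball z (\<delta> j)) \<partial>lborel)
          = (\<integral>\<^sup>+y. (\<integral>\<^sup>+z. indicator A z * indicator (ball y (\<delta> j)) z \<partial>lborel) \<partial>P)"
        by (rule nn_integral_ball_swap[OF P]) (use A in simp)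
      also have "\<dots> = (\<integral>\<^sup>+y. ennreal (V j * g j y) \<partial>P)"
      proof (rule nn_integral_cong)
        fix y
        have "(\<integral>\<^sup>+z. indicator A z * indicator (ball y (\<delta> j)) z \<partial>lborel) = emeasure lborel (A \<inter> ball y (\<delta> j))"
          using A by (simp add: indicator_inter_arith[symmetric])
        also have "\<dots> = ennreal (V j * g j y)"
          using lm[of y j] Vpos[of j] by (simp add: g_def emeasure_eq_measure2)
        finally show "(\<integral>\<^sup>+z. indicator A z * indicator (ball y (\<delta> j)) z \<partial>lborel) = ennreal (V j * g j y)" .
      qed
      finally show ?thesis .
    qed
    have gm: "g j \<in> borel_measurable borel" for j
    proof -
      have "open {p :: (real^'n) \<times> (real^'n). snd p \<in> A}"
        using open_vimage_snd[OF A] by (simp add: vimage_def)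
      moreover have "open {p :: (real^'n) \<times> (real^'n). dist (fst p) (snd p) < \<delta> j}"
        by (intro open_Collect_less continuous_intros)
      ultimately have op: "open ({p :: (real^'n) \<times> (real^'n). snd p \<in> A} \<inter> {p. dist (fst p) (snd p) < \<delta> j})"
        by (rule open_Int)
      have "{p :: (real^'n) \<times> (real^'n). snd p \<in> A} \<inter> {p. dist (fst p) (snd p) < \<delta> j} \<in> sets (borel \<Otimes>\<^sub>M lborel)"
      proof -
        have "sets ((borel :: (real^'n) measure) \<Otimes>\<^sub>M (lborel :: (real^'n) measure)) = sets (borel \<Otimes>\<^sub>M borel)"
          by (intro sets_pair_measure_cong) auto
        then show ?thesis unfolding borel_prod using borel_open[OF op] by simp
      qed
      from lborel.measurable_emeasure_Pair[OF this]
      have "(\<lambda>y. emeasure lborel (Pair y -` ({p :: (real^'n) \<times> (real^'n). snd p \<in> A} \<inter> {p. dist (fst p) (snd p) < \<delta> j})))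
          \<in> borel_measurable borel" .
      moreover have "Pair y -` ({p :: (real^'n) \<times> (real^'n). snd p \<in> A} \<inter> {p. dist (fst p) (snd p) < \<delta> j}) = A \<inter> ball y (\<delta> j)" for y
        by auto
      ultimately have "(\<lambda>y. emeasure lborel (A \<inter> ball y (\<delta> j))) \<in> borel_measurable borel" by simp
      then show ?thesis unfolding g_def[abs_def] measure_def by measurable
    qed
    have eqint: "(\<integral>y. g j y \<partial>M) = (\<integral>y. g j y \<partial>N)" for j
    proof -
      have "(\<integral>\<^sup>+z. indicator A z * emeasure M (ball z (\<delta> j)) \<partial>lborel) = (\<integral>\<^sup>+z. indicator A z * emeasure N (ball z (\<delta> j)) \<partial>lborel)"
      proof (rule nn_integral_cong_AE)
        have "AE z in lborel. measure M (ball z (\<delta> j)) = measure N (ball z (\<delta> j))"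
          by (rule ball_measures_eq_AE[OF n M N _ _ balls]) (fact invM invN)+
        then show "AE z in lborel. indicator A z * emeasure M (ball z (\<delta> j)) = indicator A z * emeasure N (ball z (\<delta> j))"
          by (rule AE_mp) (simp add: finite_measure.emeasure_eq_measure M N)
      qed
      then have "(\<integral>\<^sup>+y. ennreal (V j * g j y) \<partial>M) = (\<integral>\<^sup>+y. ennreal (V j * g j y) \<partial>N)"
        by (simp add: gint M N)
      then have "(\<integral>y. V j * g j y \<partial>M) = (\<integral>y. V j * g j y \<partial>N)"
      proof -
        assume eq: "(\<integral>\<^sup>+y. ennreal (V j * g j y) \<partial>M) = (\<integral>\<^sup>+y. ennreal (V j * g j y) \<partial>N)"
        have pos: "0 \<le> V j * g j y" for y using g01(1) Vpos[of j] by simp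
        have meas: "(\<lambda>y. V j * g j y) \<in> borel_measurable P" if "sets P = sets borel" for P
          using gm[of j] unfolding measurable_cong_sets[OF that refl] by measurable
        show ?thesis
          unfolding integral_eq_nn_integral[OF meas[OF M(2)] AE_I2[OF pos]]
            integral_eq_nn_integral[OF meas[OF N(2)] AE_I2[OF pos]] eq ..
      qed
      then show ?thesis using Vpos[of j] by simp
    qed
    have conv: "(\<lambda>j. \<integral>y. g j y \<partial>P) \<longlonglongrightarrow> measure P A"
      if P: "finite_measure P" "sets P = sets borel" "emeasure P (frontier A) = 0" for P
    proof -
      interpret P: finite_measure P by (rule P(1))
      have "(\<lambda>j. \<integral>y. g j y \<partial>P) \<longlonglongrightarrow> (\<integral>y. indicator A y \<partial>P)"
      proof (rule integral_dominated_convergence[where w = "\<lambda>_. 1"])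
        have "AE y in P. y \<notin> frontier A" using P by (intro AE_not_in null_setsI) auto
        then show "AE y in P. (\<lambda>j. g j y) \<longlonglongrightarrow> indicator A y"
          by (rule AE_mp) (use lim in auto)
        show "AE y in P. norm (g j y) \<le> 1" for j using g01 by auto
        show "g j \<in> borel_measurable P" for j
          unfolding measurable_cong_sets[OF P(2) refl] by (rule gm)
        show "indicator A \<in> borel_measurable P"
          unfolding measurable_cong_sets[OF P(2) refl] using A by simp
      qed simp
      then show ?thesis using A P(2) by simp
    qed
    show ?thesis
      using conv[OF M fr(1)] conv[OF N fr(2)] LIMSEQ_unique unfolding eqint by blast
  qed
  \<comment> \<open>Continuity sets are extended to Borel sets by
    \<open>signed_measure_nonneg\<close>; \<open>s = 1\<close> and \<open>s = -1\<close> together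
    give equality.\<close>
  have ge: "0 \<le> s * (measure M B - measure N B)" if B: "B \<in> sets borel" for B and s :: real
  proof -
    have "0 \<le> (\<Sum>l\<in>{True, False}. (if l then s else - s) * measure (if l then M else N) B)"
    proof (rule signed_measure_nonneg[where U = UNIV])
      show "B \<in> sets borel" "B \<subseteq> UNIV" "open (UNIV :: (real^'n) set)" "finite {True, False}" using B by auto
      show "finite_measure (if l then M else N)" "sets (if l then M else N) = sets borel" for l using M N by auto
      fix A :: "(real^'n) set" assume A: "open A" and "\<And>l. l \<in> {True, False} \<Longrightarrow> emeasure (if l then M else N) (frontier A) = 0"
      from this(2)[of True] this(2)[of False] open_eq[OF A]
      show "0 \<le> (\<Sum>l\<in>{True, False}. (if l then s else - s) * measure (if l then M else N) A)" by simp
    qed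
    then show ?thesis by (simp add: algebra_simps)
  qed
  show ?thesis
  proof (rule measure_eqI)
    show "sets M = sets N" using M N by simp
    fix B assume "B \<in> sets M"
    then have "measure M B = measure N B" using ge[of B 1] ge[of B "-1"] M(2) by simp
    then show "emeasure M B = emeasure N B" by (simp add: finite_measure.emeasure_eq_measure M N)
  qed
qed

section \<open>Radial profiles\<close>

text \<open>On a partition into \<open>N\<close> equal steps the bounds telescope to
  \<open>(g b - g a) * (b - a) / N\<close>, which tends to 0. No differentiation is involved, so
  jumps of \<open>g\<close> do no harm.\<close>

lemma eq_of_increment_bound:
  fixes d g :: "real \<Rightarrow> real"
  assumes "a \<le> b" and bound: "\<And>s t. a \<le> s \<Longrightarrow> s < t \<Longrightarrow> t \<le> b \<Longrightarrow> \<bar>d t - d s\<bar> \<le> (g t - g s) * (t - s)"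
  shows "d b = d a"
proof (rule ccontr)
  assume ne: "d b \<noteq> d a"
  then have ab: "a < b" using \<open>a \<le> b\<close> by (cases "a = b") auto
  obtain N :: nat where N: "(g b - g a) * (b - a) < real N * \<bar>d b - d a\<bar>"
    using reals_Archimedean3[of "\<bar>d b - d a\<bar>"] ne by auto
  have "N \<noteq> 0"
  proof
    assume "N = 0"
    moreover have "0 \<le> (g b - g a) * (b - a)" using bound[of a b] ab by (simp add: order_trans[OF abs_ge_zero])
    ultimately show False using N by simp
  qed
  then have N0: "N > 0" by simp
  define h where "h = (b - a) / real N"
  have h: "h > 0" using ab N0 by (simp add: h_def)
  define x where "x i = a + real i * h" for i :: nat
  have x: "a \<le> x i" "x i < x (Suc i)" "x (Suc i) - x i = h" for i using h by (auto simp: x_def algebra_simps)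
  have xb: "x i \<le> b" if "i \<le> N" for i
  proof -
    have "real i * h \<le> real N * h" using that h by (intro mult_right_mono) auto
    then show ?thesis using N0 by (simp add: x_def h_def)
  qed
  have ends: "x 0 = a" "x N = b" using N0 by (simp_all add: x_def h_def)
  have "\<bar>d b - d a\<bar> = \<bar>\<Sum>i<N. d (x (Suc i)) - d (x i)\<bar>"
    by (simp add: sum_lessThan_telescope[of "\<lambda>i. d (x i)"] ends)
  also have "\<dots> \<le> (\<Sum>i<N. \<bar>d (x (Suc i)) - d (x i)\<bar>)" by (rule sum_abs)
  also have "\<dots> \<le> (\<Sum>i<N. (g (x (Suc i)) - g (x i)) * h)"
  proof (rule sum_mono)
    fix i assume "i \<in> {..<N}"
    then show "\<bar>d (x (Suc i)) - d (x i)\<bar> \<le> (g (x (Suc i)) - g (x i)) * h"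
      using bound[of "x i" "x (Suc i)"] x[of i] xb[of "Suc i"] by simp
  qed
  also have "\<dots> = (g b - g a) * h"
    by (simp add: sum_distrib_right[symmetric] sum_lessThan_telescope[of "\<lambda>i. g (x i)"] ends)
  finally have "real N * \<bar>d b - d a\<bar> \<le> real N * ((g b - g a) * h)"
    by (intro mult_left_mono) auto
  also have "\<dots> = (g b - g a) * (b - a)" using N0 by (simp add: h_def)
  finally show False using N by simp
qed

lemma integral_mono_bounds:
  fixes g :: "real \<Rightarrow> real"
  assumes g: "mono_on {0..R} g" and st: "0 \<le> s" "s \<le> t" "t \<le> R"
  shows "g integrable_on {s..t}"
    and "g s * (t - s) \<le> integral {s..t} g" and "integral {s..t} g \<le> g t * (t - s)"
    and "integral {s..R} g = integral {s..t} g + integral {t..R} g"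
proof -
  have int: "g integrable_on {a..b}" if "0 \<le> a" "b \<le> R" for a b
    by (rule integrable_on_mono_on) (rule mono_on_subset[OF g], use that in auto)
  show gi: "g integrable_on {s..t}" using int st by simp
  have gm: "g x \<le> g y" if "0 \<le> x" "x \<le> y" "y \<le> R" for x y
    using mono_onD[OF g, of x y] that by simp
  have "integral {s..t} (\<lambda>_. g s) \<le> integral {s..t} g"
    using st gm by (intro integral_le gi) auto
  then show "g s * (t - s) \<le> integral {s..t} g" using st by (simp add: mult.commute)
  have "integral {s..t} g \<le> integral {s..t} (\<lambda>_. g t)"
    using st gm by (intro integral_le gi) auto
  then show "integral {s..t} g \<le> g t * (t - s)" using st by (simp add: mult.commute)
  show "integral {s..R} g = integral {s..t} g + integral {t..R} g"
    using Henstock_Kurzweil_Integration.integral_combine[of s t R g] st int by simp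
qed

text \<open>A subgradient at \<open>z\<close> may be longer than
  \<open>slope_sup R v (norm z)\<close>, which sees only smaller radii; the upper bound is therefore
  obtained through radii \<open>t\<close> that increase to \<open>norm z\<close>.\<close>

lemma (in radial_convex) slope_bounds:
  assumes y: "y \<in> ball 0 R" and z: "z \<in> ball 0 R" and less: "norm y < norm z"
  shows "slope_sup R v (norm y) * (norm z - norm y) \<le> v z - v y"
    and "v z - v y \<le> slope_sup R v (norm z) * (norm z - norm y)"
proof -
  obtain q where q: "q \<in> subdifferential (ball 0 R) v y"
    using subdifferential_nonempty[OF open_dom convex y] by blast
  have "slope_sup R v (norm y) * (norm z - norm y) \<le> norm q * (norm z - norm y)"
    using slope_sup_le[OF q y] less by (intro mult_right_mono) auto
  also have "\<dots> \<le> v z - v y" using radial_subgradient[OF radial q z] by simp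
  finally show "slope_sup R v (norm y) * (norm z - norm y) \<le> v z - v y" .
  obtain p where p: "p \<in> subdifferential (ball 0 R) v z"
    using subdifferential_nonempty[OF open_dom convex z] by blast
  let ?S = "slope_sup R v (norm z)"
  have zR: "norm z < R" using z by simp
  have step: "v z - v y \<le> ?S * (t - norm y) + norm p * (norm z - t)" if t: "norm y < t" "t < norm z" for t
  proof -
    obtain w q where w: "norm w = t" "w \<in> ball 0 R" "q \<in> subdifferential (ball 0 R) v w"
      using exists_subgradient[of t] t zR norm_ge_zero[of y] by (metis less_trans order.strict_trans1 less_imp_le)
    have "v w + norm q * (norm y - norm w) \<le> v y" by (rule radial_subgradient[OF radial w(3) y])
    moreover have "norm q * (t - norm y) \<le> ?S * (t - norm y)"
      using slope_sup_upper[OF w(3) _ zR] w(1) t by (intro mult_right_mono) auto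
    moreover have "v z + norm p * (norm w - norm z) \<le> v w" by (rule radial_subgradient[OF radial p w(2)])
    ultimately show ?thesis using w(1) by (simp add: algebra_simps)
  qed
  have "((\<lambda>t. ?S * (t - norm y) + norm p * (norm z - t)) \<longlongrightarrow> ?S * (norm z - norm y) + norm p * (norm z - norm z)) (at_left (norm z))"
    by (intro tendsto_intros)
  moreover have "eventually (\<lambda>t. v z - v y \<le> ?S * (t - norm y) + norm p * (norm z - t)) (at_left (norm z))"
    unfolding eventually_at_left_field using step less by blast
  ultimately have "v z - v y \<le> ?S * (norm z - norm y) + norm p * (norm z - norm z)"
    by (rule tendsto_lowerbound) simp
  then show "v z - v y \<le> ?S * (norm z - norm y)" by simp
qed

lemma slope_sup_zero [simp]: "slope_sup R (v :: 'a::euclidean_space \<Rightarrow> real) 0 = 0"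
proof -
  have "(\<Union>x\<in>ball (0::'a) 0. subdifferential (ball 0 R) v x) = {}" by auto
  then show ?thesis unfolding slope_sup_def p_sup_def by (simp add: bot_ennreal)
qed

text \<open>Increments of the profile and of the integral of \<open>g\<close> both lie between
  \<open>g a * (b - a)\<close> and \<open>g b * (b - a)\<close>, so their difference is constant by
  \<open>eq_of_increment_bound\<close>. The boundary values fix the constant along radii tending to
  \<open>R\<close>.\<close>

lemma (in radial_convex) eq_integral_of_slope:
  assumes g: "mono_on {0..R} g" and slope: "\<And>r. 0 \<le> r \<Longrightarrow> r < R \<Longrightarrow> slope_sup R v r = g r"
    and bd: "vanishes_on_boundary (ball 0 R) v" and x: "x \<in> ball 0 R"
  shows "v x = - integral {norm x..R} g"
proof -
  obtain e :: 'a where e: "norm e = 1" using vector_choose_size[of 1] by auto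
  define \<psi> where "\<psi> t = v (t *\<^sub>R e)" for t
  have te: "t *\<^sub>R e \<in> ball 0 R" "norm (t *\<^sub>R e) = t" if "0 \<le> t" "t < R" for t
    using that e by auto
  have diff: "\<psi> t - \<psi> s = integral {s..t} g" if st: "0 \<le> s" "s \<le> t" "t < R" for s t
  proof -
    define d where "d t = \<psi> t - integral {s..t} g" for t
    have "d t = d s"
    proof (rule eq_of_increment_bound[OF st(2)])
      fix a b assume ab: "s \<le> a" "a < b" "b \<le> t"
      have bounds: "g a * (b - a) \<le> \<psi> b - \<psi> a" "\<psi> b - \<psi> a \<le> g b * (b - a)"
        using slope_bounds[OF te(1)[of a] te(1)[of b]] te[of a] te[of b] slope[of a] slope[of b] ab st
        by (auto simp: \<psi>_def)
      have "integral {s..b} g = integral {s..a} g + integral {a..b} g"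
      proof -
        have "g integrable_on {s..b}" using integral_mono_bounds(1)[OF g] ab st by simp
        then show ?thesis
          using Henstock_Kurzweil_Integration.integral_combine[of s a b g] ab by simp
      qed
      then have "d b - d a = \<psi> b - \<psi> a - integral {a..b} g" by (simp add: d_def)
      moreover have "g a * (b - a) \<le> integral {a..b} g" "integral {a..b} g \<le> g b * (b - a)"
        using integral_mono_bounds(2,3)[OF g, of a b] ab st by auto
      ultimately show "\<bar>d b - d a\<bar> \<le> (g b - g a) * (b - a)"
        using bounds by (simp add: left_diff_distrib abs_le_iff)
    qed
    then show ?thesis by (simp add: d_def)
  qed
  obtain W where W: "continuous_on (closure (ball 0 R)) W" "\<And>x. x \<in> ball 0 R \<Longrightarrow> W x = v x"
    "\<And>x. x \<in> frontier (ball 0 R) \<Longrightarrow> W x = 0"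
    using bd unfolding vanishes_on_boundary_def by blast
  define s where "s = norm x"
  have s: "0 \<le> s" "s < R" using x by (auto simp: s_def)
  \<comment> \<open>Starts at \<open>s\<close> and tends to \<open>R\<close> without reaching it,
    since \<open>v\<close> is controlled only inside the open ball.\<close>
  define t where "t j = R - (R - s) / real (Suc j)" for j
  have tj: "s \<le> t j" "t j < R" for j
  proof -
    have "(R - s) / real (Suc j) \<le> (R - s) / 1" using s by (intro divide_left_mono) auto
    then show "s \<le> t j" by (simp add: t_def)
    show "t j < R" using s by (simp add: t_def)
  qed
  have tlim: "t \<longlonglongrightarrow> R"
    unfolding t_def using tendsto_diff[OF tendsto_const[of R] LIMSEQ_Suc[OF lim_const_over_n[of "R - s"]]] by simp
  have "(\<lambda>j. W (t j *\<^sub>R e)) \<longlonglongrightarrow> W (R *\<^sub>R e)"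
  proof (rule continuous_on_tendsto_compose[OF W(1)])
    show "(\<lambda>j. t j *\<^sub>R e) \<longlonglongrightarrow> R *\<^sub>R e" by (intro tendsto_intros tlim)
    show "R *\<^sub>R e \<in> closure (ball 0 R)" using R e by simp
    show "\<forall>\<^sub>F j in sequentially. t j *\<^sub>R e \<in> closure (ball 0 R)"
      using te(1)[of "t _"] tj s by (intro always_eventually allI subsetD[OF closure_subset]) (meson order_trans)
  qed
  moreover have "W (R *\<^sub>R e) = 0" using W(3) R e by simp
  moreover have "W (t j *\<^sub>R e) = \<psi> (t j)" for j
    using W(2) te(1)[of "t j"] tj[of j] s by (simp add: \<psi>_def)
  ultimately have psi0: "(\<lambda>j. \<psi> (t j)) \<longlonglongrightarrow> 0" by simp
  have "(\<lambda>j. \<psi> (t j) - integral {s..t j} g) \<longlonglongrightarrow> 0 - integral {s..R} g"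
  proof (rule tendsto_diff[OF psi0])
    have "(\<lambda>j. integral {t j..R} g) \<longlonglongrightarrow> 0"
    proof (rule tendsto_sandwich)
      show "(\<lambda>j. g (t j) * (R - t j)) \<longlonglongrightarrow> 0"
      proof (rule tendsto_sandwich)
        show "(\<lambda>j. g 0 * (R - t j)) \<longlonglongrightarrow> 0" "(\<lambda>j. g R * (R - t j)) \<longlonglongrightarrow> 0"
          using tendsto_mult_left[OF tendsto_diff[OF tendsto_const[of R] tlim]] by simp_all
        have "g 0 \<le> g (t j)" "g (t j) \<le> g R" for j
          using mono_onD[OF g, of 0 "t j"] mono_onD[OF g, of "t j" R] tj[of j] s by auto
        then show "\<forall>\<^sub>F j in sequentially. g 0 * (R - t j) \<le> g (t j) * (R - t j)"
          "\<forall>\<^sub>F j in sequentially. g (t j) * (R - t j) \<le> g R * (R - t j)"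
          using tj(2) by (auto intro!: always_eventually mult_right_mono simp: less_imp_le)
      qed
      show "(\<lambda>j. g R * (R - t j)) \<longlonglongrightarrow> 0"
        using tendsto_mult_left[OF tendsto_diff[OF tendsto_const[of R] tlim]] by simp
      show "\<forall>\<^sub>F j in sequentially. g (t j) * (R - t j) \<le> integral {t j..R} g"
        "\<forall>\<^sub>F j in sequentially. integral {t j..R} g \<le> g R * (R - t j)"
        using integral_mono_bounds(2,3)[OF g, of "t _" R] tj s
        by (auto intro!: always_eventually simp: less_imp_le order_trans[OF s(1)])
    qed
    then have "(\<lambda>j. integral {s..R} g - integral {t j..R} g) \<longlonglongrightarrow> integral {s..R} g - 0"
      by (intro tendsto_intros)
    moreover have "integral {s..R} g - integral {t j..R} g = integral {s..t j} g" for j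
      using integral_mono_bounds(4)[OF g, of s "t j"] tj[of j] s by simp
    ultimately show "(\<lambda>j. integral {s..t j} g) \<longlonglongrightarrow> integral {s..R} g" by simp
  qed
  moreover have "\<psi> (t j) - integral {s..t j} g = \<psi> s" for j
    using diff[of s "t j"] tj[of j] s by simp
  ultimately have "\<psi> s = - integral {s..R} g" by (simp add: LIMSEQ_const_iff)
  moreover have "v x = \<psi> s"
    unfolding \<psi>_def by (rule radially_symmetric_onD[OF radial x te(1)]) (use s te(2) in \<open>auto simp: s_def e\<close>)
  ultimately show ?thesis by (simp add: s_def)
qed

text \<open>The vector of length \<open>g (norm x)\<close> in the direction of \<open>x\<close> is a
  subgradient by Cauchy-Schwarz, which gives convexity. As \<open>g\<close> need not be left
  continuous, the slope at \<open>r\<close> is only enclosed between \<open>g s\<close> for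
  \<open>s < r\<close> and \<open>g r\<close>.\<close>

lemma radial_integral_function:
  fixes g :: "real \<Rightarrow> real"
  assumes R: "0 < R" and g: "mono_on {0..R} g" and g0: "g 0 = 0"
  defines "u \<equiv> \<lambda>x :: 'a::euclidean_space. - integral {norm x..R} g"
  shows "radial_convex R u" and "vanishes_on_boundary (ball 0 R) u"
    and "\<And>r. r < R \<Longrightarrow> 0 \<le> r \<Longrightarrow> slope_sup R u r \<le> g r"
    and "\<And>r s. 0 \<le> s \<Longrightarrow> s < r \<Longrightarrow> r < R \<Longrightarrow> g s \<le> slope_sup R u r"
proof -
  have gpos: "0 \<le> g t" if "0 \<le> t" "t \<le> R" for t
    using mono_onD[OF g, of 0 t] that R g0 by simp
  have udiff: "u z - u x = integral {norm x..norm z} g" if "norm x \<le> norm z" "norm z \<le> R" for x z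
    using integral_mono_bounds(4)[OF g, of "norm x" "norm z"] that by (simp add: u_def)
  have lower: "u x + g (norm x) * (norm z - norm x) \<le> u z" if "norm x \<le> R" "norm z \<le> R" for x z
  proof (cases "norm x \<le> norm z")
    case True
    then show ?thesis using udiff[of x z] integral_mono_bounds(2)[OF g, of "norm x" "norm z"] that by simp
  next
    case False
    then have "u x - u z \<le> g (norm x) * (norm x - norm z)"
      using udiff[of z x] integral_mono_bounds(3)[OF g, of "norm z" "norm x"] that by simp
    then show ?thesis by (simp add: algebra_simps)
  qed
  define p where "p x = (if x = 0 then 0 else (g (norm x) / norm x) *\<^sub>R x)" for x :: 'a
  have np: "norm (p x) = g (norm x)" if "norm x \<le> R" for x
    using gpos[of "norm x"] that g0 by (simp add: p_def)
  have sub: "p x \<in> subdifferential (ball 0 R) u x" if x: "norm x < R" for x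
    unfolding subdifferential_def
  proof clarify
    fix z :: 'a assume z: "z \<in> ball 0 R"
    have "p x \<bullet> z \<le> g (norm x) * norm z"
      using norm_cauchy_schwarz[of "p x" z] np[of x] x by simp
    moreover have "p x \<bullet> x = g (norm x) * norm x"
      by (simp add: p_def power2_norm_eq_inner[symmetric] power2_eq_square)
    ultimately show "u x + p x \<bullet> (z - x) \<le> u z"
      using lower[of x z] x z by (simp add: inner_diff_right right_diff_distrib)
  qed
  show rc: "radial_convex R u"
  proof
    show "0 < R" by (rule R)
    show "convex_on (ball 0 R) u"
      using sub by (intro convex_on_if_subdifferential_nonempty) auto
    show "radially_symmetric_on (ball 0 R) u" by (simp add: radially_symmetric_on_def u_def)
  qed
  interpret radial_convex R u by (rule rc)
  have lip: "\<bar>u z - u x\<bar> \<le> g R * \<bar>norm z - norm x\<bar>" if "norm x \<le> R" "norm z \<le> R" for x z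
  proof -
    have *: "\<bar>u b - u a\<bar> \<le> g R * \<bar>norm b - norm a\<bar>" if ab: "norm a \<le> norm b" "norm b \<le> R" for a b
    proof -
      have "g (norm a) * (norm b - norm a) \<le> u b - u a" "u b - u a \<le> g (norm b) * (norm b - norm a)"
        using udiff[OF ab] integral_mono_bounds(2,3)[OF g, of "norm a" "norm b"] ab by auto
      moreover have "0 \<le> g (norm a) * (norm b - norm a)" using gpos[of "norm a"] ab by simp
      moreover have "g (norm b) * (norm b - norm a) \<le> g R * (norm b - norm a)"
        using mono_onD[OF g, of "norm b" R] ab R by (intro mult_right_mono) auto
      ultimately show ?thesis using ab by simp
    qed
    show ?thesis
    proof (cases "norm x \<le> norm z")
      case True then show ?thesis using * that by blast
    next
      case False then show ?thesis using *[of z x] that by (simp add: abs_minus_commute)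
    qed
  qed
  show "vanishes_on_boundary (ball 0 R) u"
    unfolding vanishes_on_boundary_def
  proof (intro exI[of _ u] conjI ballI)
    \<comment> \<open>The same formula extends \<open>u\<close> to the boundary, and the finite
      value \<open>g R\<close> is a Lipschitz constant.\<close>
    show "continuous_on (closure (ball 0 R)) u"
    proof (rule lipschitz_on_continuous_on[of "g R"], rule lipschitz_onI)
      show "0 \<le> g R" using gpos[of R] R by simp
      fix x z :: 'a assume "x \<in> closure (ball 0 R)" "z \<in> closure (ball 0 R)"
      then have xz: "norm x \<le> R" "norm z \<le> R" using R by auto
      have "dist (u x) (u z) \<le> g R * \<bar>norm x - norm z\<bar>" using lip[OF xz(2,1)] by (simp add: dist_norm)
      also have "\<dots> \<le> g R * dist x z"
        using gpos[of R] R norm_triangle_ineq3[of x z] by (intro mult_left_mono) (auto simp: dist_norm)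
      finally show "dist (u x) (u z) \<le> g R * dist x z" .
    qed
    show "u x = 0" if "x \<in> frontier (ball 0 R)" for x using that R by (simp add: u_def)
  qed simp
  show "slope_sup R u r \<le> g r" if r: "r < R" "0 \<le> r" for r
  proof (rule slope_sup_least[OF r(1) gpos])
    show "0 \<le> r" "r \<le> R" using r by auto
    fix q x assume x: "norm x < r" "q \<in> subdifferential (ball 0 R) u x"
    obtain t where t: "norm x < t" "t < r" using dense[OF x(1)] by blast
    obtain z :: 'a where z: "norm z = t" using vector_choose_size[of t] t norm_ge_zero[of x] by (metis less_imp_le order_trans)
    have "norm q * (norm z - norm x) \<le> u z - u x"
      using radial_subgradient[OF radial x(2), of z] z t r by simp
    also have "\<dots> \<le> g (norm z) * (norm z - norm x)"
      using udiff[of x z] integral_mono_bounds(3)[OF g, of "norm x" "norm z"] z t r by simp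
    finally have "norm q \<le> g (norm z)" using z t by simp
    also have "\<dots> \<le> g r" using mono_onD[OF g, of "norm z" r] z t r norm_ge_zero[of x] by simp
    finally show "norm q \<le> g r" .
  qed
  show "g s \<le> slope_sup R u r" if "0 \<le> s" "s < r" "r < R" for r s
  proof -
    obtain z :: 'a where z: "norm z = s" using vector_choose_size[OF \<open>0 \<le> s\<close>] by blast
    have "norm (p z) \<le> slope_sup R u r"
      by (rule slope_sup_upper[OF sub]) (use z that in auto)
    then show ?thesis using np[of z] z that by simp
  qed
qed

text \<open>The double successor makes every radius positive: the sequence starts at
  \<open>r / 2\<close>.\<close>

definition inner_radius :: "real \<Rightarrow> nat \<Rightarrow> real" where
  "inner_radius r j = r - r / real (Suc (Suc j))"

lemma inner_radius:
  assumes "0 < r"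
  shows "mono (inner_radius r)" "inner_radius r \<longlonglongrightarrow> r" "0 < inner_radius r j" "inner_radius r j < r"
proof -
  show "mono (inner_radius r)"
    using assms by (intro monoI) (auto simp: inner_radius_def intro!: divide_left_mono)
  have "(\<lambda>j. r / real (Suc (Suc j))) \<longlonglongrightarrow> 0"
    using LIMSEQ_Suc[OF LIMSEQ_Suc[OF lim_const_over_n[of r]]] by simp
  from tendsto_diff[OF tendsto_const[of r] this] show "inner_radius r \<longlonglongrightarrow> r"
    by (simp add: inner_radius_def[abs_def])
  have "r / real (Suc (Suc j)) < r / 1" using assms by (intro divide_strict_left_mono) auto
  then show "0 < inner_radius r j" by (simp add: inner_radius_def)
  show "inner_radius r j < r" using assms by (simp add: inner_radius_def)
qed

lemma emeasure_Int_ball_limit: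
  fixes A :: "'a::real_normed_vector set"
  assumes "0 < r" and m: "\<And>j. A \<inter> ball 0 (inner_radius r j) \<in> sets M"
  shows "(\<lambda>j. emeasure M (A \<inter> ball 0 (inner_radius r j))) \<longlonglongrightarrow> emeasure M (A \<inter> ball 0 r)"
proof -
  have "incseq (\<lambda>j. A \<inter> ball 0 (inner_radius r j))"
    using inner_radius(1)[OF assms(1)] unfolding incseq_def mono_def
    by (meson Int_mono order_refl subset_ball)
  moreover have "(\<Union>j. A \<inter> ball 0 (inner_radius r j)) = A \<inter> ball 0 r"
  proof
    show "(\<Union>j. A \<inter> ball 0 (inner_radius r j)) \<subseteq> A \<inter> ball 0 r"
      using subset_ball[OF less_imp_le[OF inner_radius(4)[OF assms(1)]]] by blast
    show "A \<inter> ball 0 r \<subseteq> (\<Union>j. A \<inter> ball 0 (inner_radius r j))"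
    proof
      fix x assume x: "x \<in> A \<inter> ball 0 r"
      then have "eventually (\<lambda>j. norm x < inner_radius r j) sequentially"
        using order_tendstoD(1)[OF inner_radius(2)[OF assms(1)]] by auto
      then obtain j where "norm x < inner_radius r j" by (auto simp: eventually_sequentially)
      then show "x \<in> (\<Union>j. A \<inter> ball 0 (inner_radius r j))" using x by auto
    qed
  qed
  ultimately show ?thesis using Lim_emeasure_incseq[of "\<lambda>j. A \<inter> ball 0 (inner_radius r j)" M] m by auto
qed

text \<open>What the Dirichlet problem needs to know about mixed measures. Balls and rotations are
  treated below the radius \<open>R\<close>, where closed balls are compact subsets of the domain
  and \<open>mixed_ma\<close> gives the values.\<close>

lemma
  fixes ws :: "(real^'n \<Rightarrow> real) list"
  assumes R: "0 < R" and ws: "length ws = CARD('n)" "\<And>u. u \<in> set ws \<Longrightarrow> radial_convex R u"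
  shows sets_mixed_monge_ampere: "sets (mixed_monge_ampere (ball 0 R) ws) = sets (restrict_space borel (ball 0 R))"
    and mixed_monge_ampere_ball: "\<And>r. 0 < r \<Longrightarrow> r < R \<Longrightarrow> emeasure (mixed_monge_ampere (ball 0 R) ws) (ball 0 r)
      = ennreal (kappa TYPE(real^'n) * prod_list (map (\<lambda>u. slope_sup R u r) ws))"
    and mixed_monge_ampere_rotation: "\<And>f A r. rotation f \<Longrightarrow> open A \<Longrightarrow> A \<subseteq> ball 0 r \<Longrightarrow> r < R \<Longrightarrow>
      emeasure (mixed_monge_ampere (ball 0 R) ws) (f ` A) = emeasure (mixed_monge_ampere (ball 0 R) ws) A"
proof -
  have cv: "convex_on (ball 0 R) u" if "u \<in> set ws" for u using ws(2)[OF that] by (simp add: radial_convex_def)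
  have eq: "mixed_monge_ampere (ball 0 R) ws = mixed_ma_measure (ball 0 R) ws"
    by (rule mixed_monge_ampere_eq[OF open_ball convex_ball ws(1) cv])
  have val: "emeasure (mixed_monge_ampere (ball 0 R) ws) B = ennreal (mixed_ma (ball 0 R) ws B)"
    if "B \<in> sets borel" "B \<subseteq> cball 0 r" "r < R" for B r
    unfolding eq
    by (rule emeasure_mixed_ma_measure[OF open_ball convex_ball ws(1) cv that(1,2) compact_cball])
       (use that in auto)
  show "sets (mixed_monge_ampere (ball 0 R) ws) = sets (restrict_space borel (ball 0 R))"
    using radon_mixed_ma_measure[OF open_ball convex_ball ws(1) cv] by (simp add: eq radon_measure_on_def)
  show "emeasure (mixed_monge_ampere (ball 0 R) ws) (ball 0 r)
      = ennreal (kappa TYPE(real^'n) * prod_list (map (\<lambda>u. slope_sup R u r) ws))" if "0 < r" "r < R" for r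
    using val[of "ball 0 r" r] that mixed_ma_ball[OF ws that] by simp
  fix f :: "real^'n \<Rightarrow> real^'n" and A :: "(real^'n) set" and r :: real assume f: "rotation f" and A: "open A" "A \<subseteq> ball 0 r" "r < R"
  have o: "orthogonal_transformation f" using f by (simp add: rotation_def)
  have "f ` A \<subseteq> cball 0 r" using A(2) orthogonal_transformation_norm[OF o] by fastforce
  moreover have "open (f ` A)"
    by (rule open_bijective_linear_image_eq[THEN iffD2, OF _ _ A(1)])
      (use o orthogonal_transformation_linear orthogonal_transformation_bij in auto)
  ultimately have "emeasure (mixed_monge_ampere (ball 0 R) ws) (f ` A) = ennreal (mixed_ma (ball 0 R) ws (f ` A))"
    using val A(3) by (simp add: borel_open)
  also have "mixed_ma (ball 0 R) ws (f ` A) = mixed_ma (ball 0 R) ws A"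
    by (rule mixed_ma_orthogonal_image[OF o ws R A(1)]) (use A in auto)
  also have "ennreal \<dots> = emeasure (mixed_monge_ampere (ball 0 R) ws) A"
    by (rule val[symmetric]) (use A in auto)
  finally show "emeasure (mixed_monge_ampere (ball 0 R) ws) (f ` A) = emeasure (mixed_monge_ampere (ball 0 R) ws) A" .
qed

section \<open>The Dirichlet problem\<close>

lemma powr_root_unique:
  fixes y c :: real
  assumes "0 \<le> y" "y ^ k = c" "0 < k"
  shows "c powr (1 / real k) = y"
proof (cases "y = 0")
  case True then show ?thesis using assms by (auto simp: power_0_left)
next
  case False
  then have "y > 0" using assms by simp
  then have "c powr (1 / real k) = (y powr real k) powr (1 / real k)"
    using assms(2) by (simp add: powr_realpow)
  also have "\<dots> = y" using \<open>y > 0\<close> assms(3) by (simp add: powr_powr)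
  finally show ?thesis .
qed

lemma power_of_root:
  fixes c :: real
  assumes "0 \<le> c" "0 < k"
  shows "(c powr (1 / real k)) ^ k = c"
proof (cases "c = 0")
  case True then show ?thesis using assms by simp
next
  case False
  then have "(c powr (1 / real k)) ^ k = (c powr (1 / real k)) powr real k"
    by (simp add: powr_realpow)
  also have "\<dots> = c" using False assms by (simp add: powr_powr)
  finally show ?thesis .
qed

lemma kappa_pos: "0 < kappa TYPE('a::euclidean_space)"
  by (simp add: kappa_def content_ball_gt_0_iff)

section \<open>Necessity, uniqueness and construction of the solution\<close>

locale radial_dirichlet =
  fixes R :: real and \<mu> :: "(real^'n) measure" and k :: nat and us :: "nat \<Rightarrow> real^'n \<Rightarrow> real"
  assumes n: "2 \<le> CARD('n)" and R: "0 < R"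
    and sets_mu: "sets \<mu> = sets (restrict_space borel (ball 0 R))" and fin: "finite_measure \<mu>"
    and inv: "rotation_invariant_on (ball 0 R) \<mu>" and k: "k \<in> {1..CARD('n)}"
    and us: "\<And>i. i \<in> {k+1..CARD('n)} \<Longrightarrow> convex_on (ball 0 R) (us i) \<and> radially_symmetric_on (ball 0 R) (us i)"
    and p_us: "\<And>i r. i \<in> {k+1..CARD('n)} \<Longrightarrow> r \<in> {0<..R} \<Longrightarrow> 0 < p_sup R (us i) r \<and> p_sup R (us i) r < \<infinity>"
begin

sublocale finite_measure \<mu> by (rule fin)

abbreviation "F \<equiv> F_quot R \<mu> k us"

definition entries :: "(real^'n \<Rightarrow> real) \<Rightarrow> (real^'n \<Rightarrow> real) list" where
  "entries u = replicate k u @ map us [k+1..<CARD('n)+1]"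

definition Q :: "real \<Rightarrow> real" where
  "Q r = (\<Prod>i\<in>{k+1..CARD('n)}. slope_sup R (us i) r)"

definition g :: "real \<Rightarrow> real" where
  "g t = (F t / kappa TYPE(real^'n)) powr (1 / real k)"

lemma kpos: "0 < k" using k by simp

lemma F_eq: "F r = measure \<mu> (ball 0 r) / Q r"
  by (simp add: F_quot_def Q_def slope_sup_def)

lemma ball_sets: "r \<le> R \<Longrightarrow> ball 0 r \<in> sets \<mu>"
  using subset_ball[of r R "0 :: real^'n"] by (auto simp: sets_mu sets_restrict_space_iff)

lemma Q_pos:
  assumes "r \<in> {0<..R}"
  shows "0 < Q r"
  unfolding Q_def slope_sup_def using p_us[OF _ assms] by (intro prod_pos) (auto simp: enn2real_positive_iff)

lemma F_nonneg: "0 \<le> F r"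
  unfolding F_quot_def by (intro divide_nonneg_nonneg prod_nonneg) auto

text \<open>Continuity from below of \<open>\<mu>\<close> and left continuity of each
  \<open>p_sup\<close>; positivity of \<open>Q r\<close> permits the quotient. It gives access to
  the endpoint \<open>R\<close> and identifies the slopes of the constructed solution.\<close>

lemma F_left_limit:
  assumes r: "r \<in> {0<..R}"
  shows "(\<lambda>j. F (inner_radius r j)) \<longlonglongrightarrow> F r"
proof -
  have r0: "0 < r" "r \<le> R" using r by auto
  note ir = inner_radius[OF r0(1)]
  have "(\<lambda>j. emeasure \<mu> (UNIV \<inter> ball 0 (inner_radius r j))) \<longlonglongrightarrow> emeasure \<mu> (UNIV \<inter> ball 0 r)"
    by (rule emeasure_Int_ball_limit[OF r0(1)])
       (simp add: ball_sets[OF less_imp_le[OF less_le_trans[OF ir(4) r0(2)]]])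
  then have m: "(\<lambda>j. measure \<mu> (ball 0 (inner_radius r j))) \<longlonglongrightarrow> measure \<mu> (ball 0 r)"
    by (simp add: emeasure_eq_measure)
  have "(\<lambda>j. Q (inner_radius r j)) \<longlonglongrightarrow> Q r"
    unfolding Q_def slope_sup_def
  proof (intro tendsto_prod tendsto_enn2real)
    fix i assume i: "i \<in> {k+1..CARD('n)}"
    have "ennreal (enn2real (p_sup R (us i) r)) = p_sup R (us i) r"
      using p_us[OF i r] by simp
    then show "(\<lambda>j. p_sup R (us i) (inner_radius r j)) \<longlonglongrightarrow> ennreal (enn2real (p_sup R (us i) r))"
      using p_sup_left_limit[OF ir(1,2,4), of R "us i"] by simp
  qed simp
  then show ?thesis
    unfolding F_eq using Q_pos[OF r] by (intro tendsto_divide m) auto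
qed

lemma radial_convex_us: "i \<in> {k+1..CARD('n)} \<Longrightarrow> radial_convex R (us i)"
  using us R by (simp add: radial_convex_def)

lemma entries:
  assumes "radial_convex R u"
  shows "length (entries u) = CARD('n)" "\<And>v. v \<in> set (entries u) \<Longrightarrow> radial_convex R v"
    "prod_list (map (\<lambda>v. slope_sup R v r) (entries u)) = slope_sup R u r ^ k * Q r"
proof -
  show "length (entries u) = CARD('n)" using k by (simp add: entries_def)
  show "radial_convex R v" if "v \<in> set (entries u)" for v
    using that assms radial_convex_us by (auto simp: entries_def)
  have "prod_list (map (\<lambda>i. slope_sup R (us i) r) [k+1..<CARD('n)+1]) = Q r"
    unfolding Q_def using prod.distinct_set_conv_list[of "[k+1..<CARD('n)+1]" "\<lambda>i. slope_sup R (us i) r"]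
    by (simp add: atLeastLessThanSuc_atLeastAtMost del: upt_Suc)
  moreover have "prod_list (replicate k (slope_sup R u r)) = slope_sup R u r ^ k"
    by (induction k) auto
  ultimately show "prod_list (map (\<lambda>v. slope_sup R v r) (entries u)) = slope_sup R u r ^ k * Q r"
    by (simp add: entries_def o_def del: upt_Suc)
qed

lemma solves_iff: "solves_dirichlet R \<mu> k us u \<longleftrightarrow> radial_convex R u \<and>
    mixed_monge_ampere (ball 0 R) (entries u) = \<mu> \<and> vanishes_on_boundary (ball 0 R) u"
  using R by (auto simp: solves_dirichlet_def radial_convex_def entries_def simp del: upt_Suc)

text \<open>The equation is evaluated on the ball of radius \<open>r\<close>: the prescribed slopes
  form the positive factor \<open>Q r\<close>, which can be divided out.\<close>

lemma solution_slope:
  assumes u: "solves_dirichlet R \<mu> k us u" and r: "0 < r" "r < R"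
  shows "slope_sup R u r ^ k = F r / kappa TYPE(real^'n)"
proof -
  have rc: "radial_convex R u" and eq: "mixed_monge_ampere (ball 0 R) (entries u) = \<mu>"
    using u by (auto simp: solves_iff)
  have Q: "0 < Q r" using Q_pos r by simp
  have "emeasure \<mu> (ball 0 r) = ennreal (kappa TYPE(real^'n) * (slope_sup R u r ^ k * Q r))"
    using mixed_monge_ampere_ball[OF R entries(1,2)[OF rc] r] unfolding eq entries(3)[OF rc] .
  then have "measure \<mu> (ball 0 r) = kappa TYPE(real^'n) * (slope_sup R u r ^ k * Q r)"
    using Q kappa_pos[where 'a="real^'n"] by (simp add: measure_def slope_sup_def less_imp_le)
  then show ?thesis using Q kappa_pos[where 'a="real^'n"] by (simp add: F_eq)
qed

text \<open>Slopes of \<open>u\<close> increase with the radius below \<open>R\<close>; the endpoint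
  \<open>R\<close> is added by the left limit of \<open>F\<close>.\<close>

lemma solution_mono:
  assumes u: "solves_dirichlet R \<mu> k us u"
  shows "mono_on {0<..R} F"
proof -
  interpret radial_convex R u using u by (simp add: solves_iff)
  have inner: "F s \<le> F t" if "0 < s" "s \<le> t" "t < R" for s t
  proof -
    have "slope_sup R u s \<le> slope_sup R u t"
      using p_sup_mono[OF that(2), of R u] that slope_sup_nonneg
      by (simp flip: ennreal_slope_sup)
    then have "slope_sup R u s ^ k \<le> slope_sup R u t ^ k" by (rule power_mono) (rule slope_sup_nonneg)
    then show ?thesis
      using solution_slope[OF u, of s] solution_slope[OF u, of t] that kappa_pos[where 'a="real^'n"]
      by (simp add: divide_le_cancel)
  qed
  show ?thesis
  proof (rule mono_onI)
    fix s t assume st: "s \<in> {0<..R}" "t \<in> {0<..R}" "s \<le> t"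
    show "F s \<le> F t"
    proof (cases "s < t")
      case True
      then have "eventually (\<lambda>j. s < inner_radius t j) sequentially"
        using order_tendstoD(1)[OF inner_radius(2)] st by auto
      then have "eventually (\<lambda>j. F s \<le> F (inner_radius t j)) sequentially"
      proof eventually_elim
        case (elim j)
        then show ?case using inner[of s "inner_radius t j"] inner_radius(4)[of t j] st by simp
      qed
      with F_left_limit[OF st(2)] show ?thesis
        by (intro tendsto_lowerbound[of _ "F t" sequentially]) auto
    next
      case False then show ?thesis using st by simp
    qed
  qed
qed

text \<open>\<open>ball 0 0\<close> is empty, so the numerator of \<open>F 0\<close> is 0 whatever
  the denominator.\<close>

lemma g_zero: "g 0 = 0"
  by (simp add: g_def F_quot_def)

lemma g_nonneg: "0 \<le> g t" by (simp add: g_def)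

lemma mono_on_g:
  assumes "mono_on {0<..R} F"
  shows "mono_on {0..R} g"
proof (rule mono_onI)
  fix s t assume st: "s \<in> {0..R}" "t \<in> {0..R}" "s \<le> t"
  show "g s \<le> g t"
  proof (cases "s = 0")
    case True then show ?thesis using g_zero g_nonneg by simp
  next
    case False
    then have "F s \<le> F t" using mono_onD[OF assms, of s t] st by simp
    then have "F s / kappa TYPE(real^'n) \<le> F t / kappa TYPE(real^'n)" using kappa_pos[where 'a="real^'n"] by (simp add: divide_right_mono less_imp_le)
    then show ?thesis
      unfolding g_def using F_nonneg kappa_pos[where 'a="real^'n"] by (intro powr_mono2) auto
  qed
qed

lemma solution_formula:
  assumes u: "solves_dirichlet R \<mu> k us u" and x: "x \<in> ball 0 R"
  shows "u x = - integral {norm x..R} g"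
proof -
  interpret radial_convex R u using u by (simp add: solves_iff)
  show ?thesis
  proof (rule eq_integral_of_slope[OF mono_on_g[OF solution_mono[OF u]] _ _ x])
    show "vanishes_on_boundary (ball 0 R) u" using u by (simp add: solves_iff)
    show "slope_sup R u r = g r" if "0 \<le> r" "r < R" for r
    proof (cases "r = 0")
      case True then show ?thesis by (simp add: g_zero)
    next
      case False
      then show ?thesis
        unfolding g_def using that solution_slope[OF u, of r] slope_sup_nonneg kpos
        by (intro powr_root_unique[symmetric]) auto
    qed
  qed
qed

text \<open>Both measures are extended by zero to the whole space. The assumptions see
  \<open>\<nu>\<close> only below the radius \<open>R\<close>; its total mass and its full rotation
  invariance are recovered by exhausting the ball with inner radii.\<close>

lemma measure_eqI_radial:
  assumes sets: "sets \<nu> = sets (restrict_space borel (ball 0 R))"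
    and balls: "\<And>r. 0 < r \<Longrightarrow> r < R \<Longrightarrow> emeasure \<nu> (ball 0 r) = emeasure \<mu> (ball 0 r)"
    and rot: "\<And>f A r. rotation f \<Longrightarrow> open A \<Longrightarrow> A \<subseteq> ball 0 r \<Longrightarrow> r < R \<Longrightarrow> emeasure \<nu> (f ` A) = emeasure \<nu> A"
  shows "\<nu> = \<mu>"
proof -
  let ?D = "ball 0 R :: (real^'n) set"
  note ir = inner_radius[OF R]
  have meas: "B \<inter> ball 0 r \<in> sets P" if "sets P = sets (restrict_space borel ?D)" "B \<in> sets borel" "r \<le> R" for B r P
    using that subset_ball[of r R "0 :: real^'n"] by (auto simp: sets_restrict_space_iff)
  have sp: "space P = ?D" if "sets P = sets (restrict_space borel ?D)" for P
    using sets_eq_imp_space_eq[OF that] by (simp add: space_restrict_space)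
  have idm: "(\<lambda>x. x) \<in> measurable P borel" if P: "sets P = sets (restrict_space borel ?D)" for P
    unfolding measurable_cong_sets[OF P refl] by (rule measurable_restrict_space1) simp
  have em: "emeasure (distr P borel (\<lambda>x. x)) B = emeasure P (B \<inter> ?D)"
    if P: "sets P = sets (restrict_space borel ?D)" and "B \<in> sets borel" for P B
    using that idm[OF P] sp[OF P] by (simp add: emeasure_distr)
  have lim: "(\<lambda>j. emeasure P (B \<inter> ball 0 (inner_radius R j))) \<longlonglongrightarrow> emeasure P (B \<inter> ?D)"
    if P: "sets P = sets (restrict_space borel ?D)" and B: "B \<in> sets borel" for P B
    by (rule emeasure_Int_ball_limit[OF R meas[OF P B]]) (use ir(4) in \<open>simp add: less_imp_le\<close>)
  have totals: "emeasure \<nu> ?D = emeasure \<mu> ?D"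
    using lim[OF sets, of UNIV] lim[OF sets_mu, of UNIV] balls ir(3,4) LIMSEQ_unique by simp blast
  have "distr \<nu> borel (\<lambda>x. x) = distr \<mu> borel (\<lambda>x. x)"
  proof (rule rotation_invariant_measure_eqI[OF n])
    show "finite_measure (distr \<mu> borel (\<lambda>x. x))"
      by (intro finite_measure_distr idm sets_mu)
    show "finite_measure (distr \<nu> borel (\<lambda>x. x))"
      by (intro finite_measureI) (use em[OF sets, of UNIV] totals in \<open>simp add: emeasure_eq_measure\<close>)
    show "emeasure (distr \<nu> borel (\<lambda>x. x)) (ball 0 r) = emeasure (distr \<mu> borel (\<lambda>x. x)) (ball 0 r)" for r
    proof -
      consider "r \<le> 0" | "0 < r" "r < R" | "R \<le> r" by linarith
      then have "emeasure \<nu> (ball 0 r \<inter> ?D) = emeasure \<mu> (ball 0 r \<inter> ?D)"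
      proof cases
        case 1 then show ?thesis by (simp add: ball_empty)
      next
        case 2
        then have "ball 0 r \<inter> ?D = ball 0 r" by auto
        then show ?thesis using balls 2 by simp
      next
        case 3
        then have "ball 0 r \<inter> ?D = ?D" by auto
        then show ?thesis using totals by simp
      qed
      then show ?thesis by (simp add: em sets sets_mu)
    qed
    fix f :: "real^'n \<Rightarrow> real^'n" and A :: "(real^'n) set" assume f: "rotation f" and A: "open A"
    have o: "orthogonal_transformation f" using f by (simp add: rotation_def)
    have fA: "open (f ` A)"
      by (rule open_bijective_linear_image_eq[THEN iffD2, OF _ _ A])
        (use o orthogonal_transformation_linear orthogonal_transformation_bij in auto)
    have cut: "f ` A \<inter> ball 0 r = f ` (A \<inter> ball 0 r)" for r
      using orthogonal_transformation_norm[OF o] by auto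
    have "rotation_matrix (matrix f)"
      using f orthogonal_transformation_matrix[of f] by (simp add: rotation_def rotation_matrix_def)
    moreover have "(\<lambda>x. matrix f *v x) = f"
      by (rule matrix_vector_mul(2)) (rule orthogonal_transformation_linear[OF o])
    ultimately have "emeasure \<mu> (f ` B) = emeasure \<mu> B" if "B \<in> sets borel" "B \<subseteq> ?D" for B
      using inv that unfolding rotation_invariant_on_def by metis
    then show "emeasure (distr \<mu> borel (\<lambda>x. x)) (f ` A) = emeasure (distr \<mu> borel (\<lambda>x. x)) A"
      using A fA by (simp add: em sets_mu cut)
    have "emeasure \<nu> (f ` A \<inter> ball 0 (inner_radius R j)) = emeasure \<nu> (A \<inter> ball 0 (inner_radius R j))" for j
      unfolding cut by (rule rot[OF f _ _ ir(4)]) (use A in auto)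
    then have "emeasure \<nu> (f ` A \<inter> ?D) = emeasure \<nu> (A \<inter> ?D)"
      using lim[OF sets, of "f ` A"] lim[OF sets, of A] A fA LIMSEQ_unique by simp blast
    then show "emeasure (distr \<nu> borel (\<lambda>x. x)) (f ` A) = emeasure (distr \<nu> borel (\<lambda>x. x)) A"
      using A fA by (simp add: em sets)
  qed auto
  show ?thesis
  proof (rule measure_eqI)
    show "sets \<nu> = sets \<mu>" using sets sets_mu by simp
    fix X assume "X \<in> sets \<nu>"
    then have X: "X \<in> sets borel" "X \<inter> ?D = X" using sets by (auto simp: sets_restrict_space_iff)
    then show "emeasure \<nu> X = emeasure \<mu> X"
      using em[OF sets X(1)] em[OF sets_mu X(1)] \<open>distr \<nu> borel (\<lambda>x. x) = distr \<mu> borel (\<lambda>x. x)\<close> by simp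
  qed
qed

text \<open>The slope of the candidate at \<open>r\<close> lies between
  \<open>g (inner_radius r j)\<close> and \<open>g r\<close>, and left continuity of
  \<open>F\<close> closes the gap. The mixed measure and \<open>\<mu>\<close> then agree on centred
  balls.\<close>

lemma solution_exists:
  assumes mono: "mono_on {0<..R} F"
  shows "solves_dirichlet R \<mu> k us (\<lambda>x. - integral {norm x..R} g)"
proof -
  let ?u = "\<lambda>x :: real^'n. - integral {norm x..R} g"
  note rif = radial_integral_function[where 'a="real^'n", OF R mono_on_g[OF mono] g_zero]
  interpret radial_convex R ?u by (rule rif(1))
  have gk: "g r ^ k = F r / kappa TYPE(real^'n)" for r
    unfolding g_def using F_nonneg kappa_pos[where 'a="real^'n"] kpos by (intro power_of_root) auto
  have slope: "slope_sup R ?u r ^ k = F r / kappa TYPE(real^'n)" if r: "0 < r" "r < R" for r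
  proof (rule antisym)
    have "slope_sup R ?u r \<le> g r" using rif(3) r by simp
    then show "slope_sup R ?u r ^ k \<le> F r / kappa TYPE(real^'n)"
      unfolding gk[symmetric] by (rule power_mono) (rule slope_sup_nonneg)
    have "F (inner_radius r j) / kappa TYPE(real^'n) \<le> slope_sup R ?u r ^ k" for j
      unfolding gk[symmetric]
      using rif(4)[of "inner_radius r j" r] inner_radius(3,4)[OF r(1), of j] r g_nonneg
      by (intro power_mono) auto
    moreover have "(\<lambda>j. F (inner_radius r j) / kappa TYPE(real^'n)) \<longlonglongrightarrow> F r / kappa TYPE(real^'n)"
      using F_left_limit[of r] r kappa_pos[where 'a="real^'n"] by (intro tendsto_divide tendsto_const) auto
    ultimately show "F r / kappa TYPE(real^'n) \<le> slope_sup R ?u r ^ k"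
      by (intro LIMSEQ_le_const2) auto
  qed
  have "mixed_monge_ampere (ball 0 R) (entries ?u) = \<mu>"
  proof (rule measure_eqI_radial)
    show "sets (mixed_monge_ampere (ball 0 R) (entries ?u)) = sets (restrict_space borel (ball 0 R))"
      by (rule sets_mixed_monge_ampere[OF R entries(1,2)[OF rif(1)]])
    show "emeasure (mixed_monge_ampere (ball 0 R) (entries ?u)) (f ` A) = emeasure (mixed_monge_ampere (ball 0 R) (entries ?u)) A"
      if "rotation f" "open A" "A \<subseteq> ball 0 r" "r < R" for f A r
      by (rule mixed_monge_ampere_rotation[OF R entries(1,2)[OF rif(1)] that])
    fix r assume r: "0 < r" "r < R"
    have "kappa TYPE(real^'n) * (slope_sup R ?u r ^ k * Q r) = measure \<mu> (ball 0 r)"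
      using slope[OF r] Q_pos[of r] r kappa_pos[where 'a="real^'n"] by (simp add: F_eq)
    moreover have "emeasure (mixed_monge_ampere (ball 0 R) (entries ?u)) (ball 0 r)
        = ennreal (kappa TYPE(real^'n) * prod_list (map (\<lambda>v. slope_sup R v r) (entries ?u)))"
      by (rule mixed_monge_ampere_ball[OF R entries(1,2)[OF rif(1)] r])
    ultimately show "emeasure (mixed_monge_ampere (ball 0 R) (entries ?u)) (ball 0 r) = emeasure \<mu> (ball 0 r)"
      unfolding entries(3)[OF rif(1)] by (simp add: emeasure_eq_measure)
  qed
  then show ?thesis using rif(1,2) by (simp add: solves_iff)
qed

end

theorem theorem3p4:
  fixes R :: real and \<mu> :: "(real^'n) measure" and k :: nat
    and us :: "nat \<Rightarrow> real^'n \<Rightarrow> real"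
  assumes "CARD('n) \<ge> 2"
    and "R > 0"
    and "sets \<mu> = sets (restrict_space borel (ball 0 R))"
    and "finite_measure \<mu>"
    and "rotation_invariant_on (ball 0 R) \<mu>"
    and "k \<in> {1..CARD('n)}"
    and "\<forall>i\<in>{k+1..CARD('n)}. convex_on (ball 0 R) (us i) \<and> radially_symmetric_on (ball 0 R) (us i)"
    and "\<forall>i\<in>{k+1..CARD('n)}. \<forall>r\<in>{0<..R}. 0 < p_sup R (us i) r \<and> p_sup R (us i) r < \<infinity>"
  shows "((\<exists>u. solves_dirichlet R \<mu> k us u \<and>
             (\<forall>w. solves_dirichlet R \<mu> k us w \<longrightarrow> (\<forall>x\<in>ball 0 R. w x = u x)))
          \<longleftrightarrow> mono_on {0<..R} (F_quot R \<mu> k us))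
       \<and> (mono_on {0<..R} (F_quot R \<mu> k us) \<longrightarrow>
           (\<forall>u. solves_dirichlet R \<mu> k us u \<longrightarrow>
              (\<forall>x\<in>ball 0 R.
                 u x = - integral {norm x..R}
                           (\<lambda>t. (F_quot R \<mu> k us t / kappa TYPE(real^'n)) powr (1 / real k)))))"
proof -
  interpret radial_dirichlet R \<mu> k us
  proof (rule radial_dirichlet.intro)
    show "convex_on (ball 0 R) (us i) \<and> radially_symmetric_on (ball 0 R) (us i)"
      if "i \<in> {k+1..CARD('n)}" for i using assms(7) that by blast
    show "0 < p_sup R (us i) r \<and> p_sup R (us i) r < \<infinity>"
      if "i \<in> {k+1..CARD('n)}" "r \<in> {0<..R}" for i r using assms(8) that by blast
  qed (fact assms)+
  have g: "(\<lambda>t. (F t / kappa TYPE(real^'n)) powr (1 / real k)) = g" by (simp add: fun_eq_iff g_def)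
  show ?thesis
    unfolding g
  proof (intro conjI iffI impI allI ballI)
    assume "\<exists>u. solves_dirichlet R \<mu> k us u \<and>
      (\<forall>w. solves_dirichlet R \<mu> k us w \<longrightarrow> (\<forall>x\<in>ball 0 R. w x = u x))"
    then show "mono_on {0<..R} F" using solution_mono by blast
  next
    assume "mono_on {0<..R} F"
    \<comment> \<open>Every solution is given by the same formula, which settles uniqueness.\<close>
    from solution_exists[OF this] solution_formula
    show "\<exists>u. solves_dirichlet R \<mu> k us u \<and>
      (\<forall>w. solves_dirichlet R \<mu> k us w \<longrightarrow> (\<forall>x\<in>ball 0 R. w x = u x))"
      by (intro exI[of _ "\<lambda>x. - integral {norm x..R} g"]) simp
  qed (rule solution_formula)
qed

end
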